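(* The set $\mathcal{H}=\{\xi_1,\ldots,\xi_m,d_{1,m},\ldots,d_{m,m}\}$ is a homogeneous system of parameters; that is, these $n=2m$ homogeneous elements of positive degree generate a subalgebra $\mathbb{F}_q[\mathcal{H}]$ over which $S_m$ (equivalently $S_m^{G_m}$) is a finitely generated module.
   Context: Let $q$ be a power of an odd prime $p$, let $m\ge 1$ and $n=2m$. Let $S_m=\mathbb{F}_q[y_m,\ldots,y_1,x_1,\ldots,x_m]$ be the polynomial ring in $n$ variables with its standard grading. The group $\mathrm{GL}_n(\mathbb{F}_q)$ acts on the right on $S_m$ by $\mathbb{F}_q$-algebra automorphisms: identify a linear form with its row vector of coefficients with respect to the ordered basis $[y_m,\ldots,y_1,x_1,\ldots,x_m]$, and let $g$ act by right multiplication. Put $\xi_1=\sum_{k=1}^m y_kx_k$ and, for $i\ge2$, $\xi_i=\sum_{k=1}^m\bigl(y_k^{q^{i-1}}x_k+y_kx_k^{q^{i-1}}\bigr)$. Let $G_m=\mathrm{O}^+_{2m}(\mathbb{F}_q)=\{g\in\mathrm{GL}_n(\mathbb{F}_q)\mid \xi_1\cdot g=\xi_1\}$ and $S_m^{G_m}$ its ring of invariants. Let $P_m$ be the group of upper triangular unipotent matrices in $G_m$. For a linear form $v$, let $N(v)$ be the product of the distinct elements of the $P_m$-orbit of $v$. Put $u_m=\prod_{i=1}^mN(y_i)N(x_i)$. The Steenrod operations $\mathcal{P}^i:S_m\to S_m$ are defined by $\mathcal{P}(t)(f)=\sum_i\mathcal{P}^i(f)t^i$, where $\mathcal{P}(t):S_m\to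 S_m[t]$ is the $\mathbb{F}_q$-algebra homomorphism with $\mathcal{P}(t)(v)=v+v^qt$ for every linear form $v$. For $1\le i\le m$ put $e(i,m)=\sum_{j=1}^iq^{n-1-j}$ and define $d_{i,m}\in S_m$ by $u_md_{i,m}=\mathcal{P}^{e(i,m)}(u_m)$ (the polynomial $u_m$, a product of pairwise non-proportional linear forms, divides every $\mathcal{P}^j(u_m)$). The $d_{i,m}$ are $G_m$-invariant. *)

theory Defs
  imports
    "HOL-Library.Cardinality"
    "HOL-Library.Poly_Mapping"
    "HOL-Computational_Algebra.Polynomial"
    "HOL-Computational_Algebra.Primes"
    "Jordan_Normal_Form.Matrix"
begin

text \<open>
  A finite field \<open>F\<^sub>q\<close> is a type \<open>'a :: {field, finite}\<close>, with \<open>q = CARD('a)\<close>. Polynomials over it in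
  variables \<open>z\<^sub>0, z\<^sub>1, \<dots>\<close> are finitely supported maps from exponent vectors to coefficients, with
  the convolution product. The ordered basis \<open>[y\<^sub>m, \<dots>, y\<^sub>1, x\<^sub>1, \<dots>, x\<^sub>m]\<close> is
  numbered from 0, so that \<open>y\<^sub>i = z\<^bsub>m-i\<^esub>\<close> and \<open>x\<^sub>i = z\<^bsub>m+i-1\<^esub>\<close> for \<open>1 \<le> i \<le> m\<close>.
\<close>

type_synonym 'a mpoly = "(nat \<Rightarrow>\<^sub>0 nat) \<Rightarrow>\<^sub>0 'a"

definition Const :: "'a::zero \<Rightarrow> 'a mpoly" where
  "Const c = Poly_Mapping.single 0 c"

definition Var :: "nat \<Rightarrow> 'a::zero_neq_one mpoly" where
  "Var k = Poly_Mapping.single (Poly_Mapping.single k 1) 1"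

definition yvar :: "nat \<Rightarrow> nat \<Rightarrow> 'a::zero_neq_one mpoly" where
  "yvar m i = Var (m - i)"

definition xvar :: "nat \<Rightarrow> nat \<Rightarrow> 'a::zero_neq_one mpoly" where
  "xvar m i = Var (m + i - 1)"

definition polyring :: "nat \<Rightarrow> 'a::zero mpoly set" where
  "polyring m = {f. \<forall>\<mu>\<in>Poly_Mapping.keys f. Poly_Mapping.keys \<mu> \<subseteq> {..<2 * m}}"

definition homogeneous :: "nat \<Rightarrow> 'a::zero mpoly \<Rightarrow> bool" where
  "homogeneous k f \<longleftrightarrow>
     (\<forall>\<mu>\<in>Poly_Mapping.keys f. (\<Sum>v\<in>Poly_Mapping.keys \<mu>. Poly_Mapping.lookup \<mu> v) = k)"

text \<open>
  For a ring homomorphism \<open>c\<close> into a commutative ring, this is the ring homomorphism that extends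
  \<open>c\<close> and sends the variable \<open>z\<^sub>k\<close> to \<open>z k\<close>.
\<close>

definition mpoly_eval ::
  "('a::zero \<Rightarrow> 'b::comm_semiring_1) \<Rightarrow> (nat \<Rightarrow> 'b) \<Rightarrow> 'a mpoly \<Rightarrow> 'b" where
  "mpoly_eval c z f =
     (\<Sum>\<mu>\<in>Poly_Mapping.keys f. c (Poly_Mapping.lookup f \<mu>) *
        (\<Prod>k\<in>Poly_Mapping.keys \<mu>. z k ^ Poly_Mapping.lookup \<mu> k))"

text \<open>
  The form with coefficient row \<open>c\<close> goes to the form with coefficient row \<open>c g\<close>; in particular
  \<open>z\<^sub>k\<close> goes to the form whose coefficients are row \<open>k\<close> of \<open>g\<close>. Only used for \<open>f \<in> polyring m\<close> and
  \<open>2m \<times> 2m\<close> matrices \<open>g\<close>.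
\<close>

definition act :: "nat \<Rightarrow> 'a::comm_ring_1 mat \<Rightarrow> 'a mpoly \<Rightarrow> 'a mpoly" where
  "act m g f = mpoly_eval Const (\<lambda>k. \<Sum>j<2 * m. Const (g $$ (k, j)) * Var j) f"

definition xi :: "nat \<Rightarrow> nat \<Rightarrow> 'a::{field,finite} mpoly" where
  "xi m i =
     (if i = 1 then (\<Sum>k=1..m. yvar m k * xvar m k)
      else (\<Sum>k=1..m. yvar m k ^ (CARD('a) ^ (i - 1)) * xvar m k
                     + yvar m k * xvar m k ^ (CARD('a) ^ (i - 1))))"

definition orth_group :: "nat \<Rightarrow> 'a::{field,finite} mat set" where
  "orth_group m =
     {g \<in> carrier_mat (2 * m) (2 * m). invertible_mat g \<and> act m g (xi m 1) = xi m 1}"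

definition invariants :: "nat \<Rightarrow> 'a::{field,finite} mpoly set" where
  "invariants m = {f \<in> polyring m. \<forall>g\<in>orth_group m. act m g f = f}"

definition unipotent_group :: "nat \<Rightarrow> 'a::{field,finite} mat set" where
  "unipotent_group m =
     {g \<in> orth_group m. upper_triangular g \<and> (\<forall>k<2 * m. g $$ (k, k) = 1)}"

definition orbit_prod :: "nat \<Rightarrow> 'a::{field,finite} mpoly \<Rightarrow> 'a mpoly" where
  "orbit_prod m v = \<Prod>((\<lambda>g. act m g v) ` unipotent_group m)"

definition u_poly :: "nat \<Rightarrow> 'a::{field,finite} mpoly" where
  "u_poly m = (\<Prod>i=1..m. orbit_prod m (yvar m i) * orbit_prod m (xvar m i))"

text \<open>
  The total Steenrod operation, with values in polynomials in \<open>t\<close> over \<open>polyring m\<close>. It is prescribed on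
  variables; since \<open>v \<mapsto> v + v\<^sup>q t\<close> is \<open>F\<^sub>q\<close>-linear, the same formula then holds for
  every linear form \<open>v\<close>.
\<close>

definition steenrod_total :: "'a::{field,finite} mpoly \<Rightarrow> 'a mpoly poly" where
  "steenrod_total f = mpoly_eval (\<lambda>c. [:Const c:]) (\<lambda>k. [:Var k, Var k ^ CARD('a):]) f"

definition steenrod :: "nat \<Rightarrow> 'a::{field,finite} mpoly \<Rightarrow> 'a mpoly" where
  "steenrod i f = poly.coeff (steenrod_total f) i"

definition e_exp :: "nat \<Rightarrow> nat \<Rightarrow> nat \<Rightarrow> nat" where
  "e_exp q i m = (\<Sum>j=1..i. q ^ (2 * m - 1 - j))"

text \<open>
  The polynomial ring is a domain and \<open>u_poly m\<close> is a nonzero product of linear forms, each of which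
  divides its image under the total Steenrod operation, so the quotient exists and is unique.
\<close>

definition d_poly :: "nat \<Rightarrow> nat \<Rightarrow> 'a::{field,finite} mpoly" where
  "d_poly i m = (THE f. f \<in> polyring m \<and> u_poly m * f = steenrod (e_exp CARD('a) i m) (u_poly m))"

definition Hsys :: "nat \<Rightarrow> 'a::{field,finite} mpoly set" where
  "Hsys m = xi m ` {1..m} \<union> (\<lambda>i. d_poly i m) ` {1..m}"

inductive_set gen_subalgebra :: "'a::comm_ring_1 mpoly set \<Rightarrow> 'a mpoly set"
  for X :: "'a mpoly set" where
  const: "Const c \<in> gen_subalgebra X"
| gen: "f \<in> X \<Longrightarrow> f \<in> gen_subalgebra X"
| add: "f \<in> gen_subalgebra X \<Longrightarrow> g \<in> gen_subalgebra X \<Longrightarrow> f + g \<in> gen_subalgebra X"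
| mult: "f \<in> gen_subalgebra X \<Longrightarrow> g \<in> gen_subalgebra X \<Longrightarrow> f * g \<in> gen_subalgebra X"

text \<open>The equality includes that \<open>R\<close> is closed under multiplication by \<open>A\<close>.\<close>

definition finite_module_over :: "'a::comm_ring_1 mpoly set \<Rightarrow> 'a mpoly set \<Rightarrow> bool" where
  "finite_module_over A R \<longleftrightarrow>
     (\<exists>B. finite B \<and> B \<subseteq> R \<and> R = {\<Sum>b\<in>B. a b * b | a. \<forall>b\<in>B. a b \<in> A})"

text \<open>Here \<open>n\<close> is to be the Krull dimension of the graded algebra \<open>R\<close>.\<close>

definition hsop :: "nat \<Rightarrow> 'a::comm_ring_1 mpoly set \<Rightarrow> 'a mpoly set \<Rightarrow> bool" where
  "hsop n R X \<longleftrightarrow>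
     X \<subseteq> R \<and> finite X \<and> card X = n \<and>
     (\<forall>f\<in>X. f \<noteq> 0 \<and> (\<exists>k>0. homogeneous k f)) \<and>
     finite_module_over (gen_subalgebra X) R"

end

theory Submission
  imports Defs
    "Jordan_Normal_Form.Determinant"
    "HOL-Computational_Algebra.Polynomial_Factorial"
begin

text \<open>
  By the graded Nakayama lemma it suffices that every point \<open>v\<close> over a field \<open>K\<close> containing \<open>F\<^sub>q\<close> at which
  all elements of the system vanish is zero; as points we take the residue fields of prime ideals, which
  avoids the Nullstellensatz.

  Vanishing of \<open>\<xi>\<^sub>1, \<dots>, \<xi>\<^sub>m\<close> at \<open>v\<close> means that \<open>v\<close> is orthogonal to its first Frobenius twists. For a
  form of plus type this forces orthogonality to all Frobenius twists, so \<open>v\<close> lies in the scalar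
  extension of a totally isotropic subspace of dimension \<open>e \<le> m\<close> over \<open>F\<^sub>q\<close>, where \<open>e\<close> is the dimension of
  the \<open>F\<^sub>q\<close>-span of the coordinates of \<open>v\<close>.

  The orbits that define \<open>u\<^sub>m\<close> consist of the normalised isotropic linear forms, hence \<open>d\<^bsub>i,m\<^esub>\<close> is the
  elementary symmetric function of degree \<open>e(i,m)\<close> in the \<open>c\<^bsup>q-1\<^esup>\<close>, with \<open>c\<close> running over the isotropic
  points. Exactly \<open>e(e,m)\<close> isotropic points do not vanish at \<open>v\<close>, so \<open>d\<^bsub>e,m\<^esub>(v)\<close> is a product of nonzero
  factors, unless \<open>e = 0\<close>.

  The ring of invariants is a submodule of a finitely generated module over a Noetherian ring.
\<close>

section \<open>Evaluation of polynomials\<close>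

text \<open>A point has \<open>2 * m\<close> coordinates but satisfies only \<open>m\<close>
  equations B(v, v^(q^i)) = 0, so Moore's criterion cannot be applied to all coordinates at once.
  The way out is to split \<open>v\<close> into \<open>m\<close> hyperbolic pairs (x_k, y_k). If the
  x_k are independent over \<open>F\<^sub>q\<close>, a matrix C satisfies y^(q^i) = C x^(q^i) for i
  < m; the equations make C alternating and then rational, and a rational alternating C yields the
  equations for all i.

  The exponent e(i,m) is a count of points. If the coordinates of \<open>v\<close> span an
  i-dimensional space, q^(2m) - q^(2m-i) linear forms do not vanish at \<open>v\<close>. One in q of
  them is isotropic, and each isotropic line contains q - 1 of these; dividing by q(q - 1) leaves
  the geometric sum e(i,m). The elementary symmetric function whose degree is the number of nonzero
  arguments equals their product, so the exponents are exactly those for which some member of the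
  system detects \<open>v\<close>.\<close>

definition mon_eval :: "(nat \<Rightarrow> 'b::comm_semiring_1) \<Rightarrow> (nat \<Rightarrow>\<^sub>0 nat) \<Rightarrow> 'b" where
  "mon_eval z \<mu> = (\<Prod>k\<in>Poly_Mapping.keys \<mu>. z k ^ Poly_Mapping.lookup \<mu> k)"

lemma mon_eval_superset:
  "finite S \<Longrightarrow> Poly_Mapping.keys \<mu> \<subseteq> S \<Longrightarrow>
    mon_eval z \<mu> = (\<Prod>k\<in>S. z k ^ Poly_Mapping.lookup \<mu> k)"
  unfolding mon_eval_def by (rule prod.mono_neutral_left) (auto simp: in_keys_iff)

lemma mon_eval_0 [simp]: "mon_eval z 0 = 1"
  by (simp add: mon_eval_def)

lemma mon_eval_add: "mon_eval z (\<mu> + \<nu>) = mon_eval z \<mu> * mon_eval z \<nu>"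
proof -
  let ?S = "Poly_Mapping.keys \<mu> \<union> Poly_Mapping.keys \<nu>"
  have "Poly_Mapping.keys (\<mu> + \<nu>) \<subseteq> ?S" by (rule keys_add)
  then show ?thesis
    by (simp add: mon_eval_superset[of ?S] lookup_add power_add prod.distrib)
qed

lemma mon_eval_single [simp]: "mon_eval z (Poly_Mapping.single k n) = z k ^ n"
  by (cases "n = 0") (auto simp: mon_eval_def)

lemma mpoly_eval_alt:
  "mpoly_eval c z f = (\<Sum>\<mu>\<in>Poly_Mapping.keys f. c (Poly_Mapping.lookup f \<mu>) * mon_eval z \<mu>)"
  by (simp add: mpoly_eval_def mon_eval_def)

lemma poly_mapping_decomp:
  "f = (\<Sum>\<mu>\<in>Poly_Mapping.keys f. Poly_Mapping.single \<mu> (Poly_Mapping.lookup f \<mu>))"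
  by (rule poly_mapping_eqI)
    (auto simp: lookup_sum lookup_single when_def in_keys_iff)

text \<open>Every finitely supported map is a finite sum of single terms. Supports may overlap in
  the sum case, which suits additive statements such as multiplicativity of evaluation.\<close>

lemma poly_mapping_add_induct [case_names zero single add]:
  fixes f :: "'b \<Rightarrow>\<^sub>0 'c::comm_monoid_add"
  assumes "P 0" "\<And>\<mu> a. P (Poly_Mapping.single \<mu> a)" "\<And>f g. P f \<Longrightarrow> P g \<Longrightarrow> P (f + g)"
  shows "P f"
proof -
  have "finite S \<Longrightarrow> P (\<Sum>\<mu>\<in>S. Poly_Mapping.single \<mu> (h \<mu>))" for S h
    by (induction S rule: finite_induct) (auto simp: assms)
  from this[of "Poly_Mapping.keys f" "Poly_Mapping.lookup f"] show ?thesis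
    by (simp flip: poly_mapping_decomp)
qed

context comm_ring_hom
begin

lemma mpoly_eval_add: "mpoly_eval hom z (f + g) = mpoly_eval hom z f + mpoly_eval hom z g"
  unfolding mpoly_eval_alt
  by (rule setsum_keys_plus_distrib) (auto simp: hom_distribs algebra_simps)

lemma mpoly_eval_0 [simp]: "mpoly_eval hom z 0 = 0"
  by (simp add: mpoly_eval_def)

lemma mpoly_eval_single: "mpoly_eval hom z (Poly_Mapping.single \<mu> a) = hom a * mon_eval z \<mu>"
  by (cases "a = 0") (auto simp: mpoly_eval_alt)

lemma mpoly_eval_mult: "mpoly_eval hom z (f * g) = mpoly_eval hom z f * mpoly_eval hom z g"
proof (induction f rule: poly_mapping_add_induct)
  case (single \<mu> a)
  show ?case
    by (induction g rule: poly_mapping_add_induct)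
      (auto simp: mult_single mpoly_eval_single mpoly_eval_add mon_eval_add hom_distribs algebra_simps)
qed (auto simp: algebra_simps mpoly_eval_add)

lemma mpoly_eval_Const [simp]: "mpoly_eval hom z (Const a) = hom a"
  by (simp add: Const_def mpoly_eval_single)

lemma mpoly_eval_Var [simp]: "mpoly_eval hom z (Var k) = z k"
  by (simp add: Var_def mpoly_eval_single)

lemma mpoly_eval_1 [simp]: "mpoly_eval hom z 1 = 1"
  using mpoly_eval_Const[of z 1] by (simp add: Const_def)

lemma mpoly_eval_hom: "comm_ring_hom (mpoly_eval hom z)"
  by unfold_locales (auto simp: mpoly_eval_add mpoly_eval_mult)

lemma hom_mon_eval: "hom (mon_eval z \<mu>) = mon_eval (\<lambda>k. hom (z k)) \<mu>"
  by (simp add: mon_eval_def hom_distribs)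

lemma hom_mpoly_eval: "hom (mpoly_eval c z f) = mpoly_eval (\<lambda>a. hom (c a)) (\<lambda>k. hom (z k)) f"
  by (simp add: mpoly_eval_alt hom_distribs hom_mon_eval)

end

lemma Const_hom: "comm_ring_hom (Const :: 'a::comm_ring_1 \<Rightarrow> 'a mpoly)"
  by unfold_locales (auto simp: Const_def single_add mult_single)

lemma inj_Const: "inj (Const :: 'a::zero \<Rightarrow> 'a mpoly)"
  by (rule injI) (metis Const_def lookup_single_eq)

lemma Var_power: "(Var k :: 'a::comm_ring_1 mpoly) ^ n = Poly_Mapping.single (Poly_Mapping.single k n) 1"
  by (induction n) (auto simp: Var_def mult_single simp flip: single_add)

lemma mon_eval_Var: "mon_eval Var \<mu> = (Poly_Mapping.single \<mu> 1 :: 'a::comm_ring_1 mpoly)"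
  by (induction \<mu> rule: poly_mapping_add_induct) (auto simp: mon_eval_add mult_single Var_power)

lemma act_hom: "comm_ring_hom (act m g)"
  unfolding act_def[abs_def] by (rule comm_ring_hom.mpoly_eval_hom[OF Const_hom])

section \<open>Noetherian modules and Hilbert's basis theorem\<close>

definition subring_set :: "'r::comm_ring_1 set \<Rightarrow> bool" where
  "subring_set A \<longleftrightarrow> 1 \<in> A \<and> (\<forall>a\<in>A. \<forall>b\<in>A. a + b \<in> A \<and> a * b \<in> A \<and> - a \<in> A)"

text \<open>Modules are subsets of the ambient ring, so that one notion covers its ideals
  (\<open>A = UNIV\<close>), ideals of a subring and submodules such as the ring of
  invariants.\<close>

definition module_over :: "'r::comm_ring_1 set \<Rightarrow> 'r set \<Rightarrow> bool" where
  "module_over A N \<longleftrightarrow> 0 \<in> N \<and> (\<forall>x\<in>N. \<forall>y\<in>N. x + y \<in> N) \<and> (\<forall>a\<in>A. \<forall>x\<in>N. a * x \<in> N)"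

text \<open>The inductive form gives an induction rule and allows an infinite \<open>B\<close>, such
  as all powers of an element; for finite \<open>B\<close>, \<open>lin_hull_eq_sums\<close> turns it
  into explicit sums.\<close>

inductive_set lin_hull :: "'r::comm_ring_1 set \<Rightarrow> 'r set \<Rightarrow> 'r set" for A B where
  zero: "0 \<in> lin_hull A B"
| step: "a \<in> A \<Longrightarrow> b \<in> B \<Longrightarrow> x \<in> lin_hull A B \<Longrightarrow> a * b + x \<in> lin_hull A B"

definition noetherian_mod :: "'r::comm_ring_1 set \<Rightarrow> 'r set \<Rightarrow> bool" where
  "noetherian_mod A M \<longleftrightarrow>
    (\<forall>N\<subseteq>M. module_over A N \<longrightarrow> (\<exists>B. finite B \<and> B \<subseteq> N \<and> N \<subseteq> lin_hull A B))"

lemma subring_setD: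
  assumes "subring_set A"
  shows "1 \<in> A" "0 \<in> A" "a \<in> A \<Longrightarrow> b \<in> A \<Longrightarrow> a + b \<in> A" "a \<in> A \<Longrightarrow> b \<in> A \<Longrightarrow> a * b \<in> A"
    "a \<in> A \<Longrightarrow> - a \<in> A"
proof -
  have "1 + - 1 \<in> A" using assms unfolding subring_set_def by blast
  then show "0 \<in> A" by simp
qed (use assms in \<open>auto simp: subring_set_def\<close>)

lemma module_overD:
  assumes "module_over A N"
  shows "0 \<in> N" "x \<in> N \<Longrightarrow> y \<in> N \<Longrightarrow> x + y \<in> N" "a \<in> A \<Longrightarrow> x \<in> N \<Longrightarrow> a * x \<in> N"
  using assms by (auto simp: module_over_def)

lemma module_over_diff:
  assumes "module_over A N" "subring_set A" "x \<in> N" "y \<in> N"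
  shows "x - y \<in> N"
proof -
  have "- 1 \<in> A" using subring_setD[OF assms(2)] by blast
  then have "- 1 * y \<in> N" using module_overD[OF assms(1)] assms(4) by blast
  then have "x + - 1 * y \<in> N" using module_overD[OF assms(1)] assms(3) by blast
  then show ?thesis by simp
qed

lemma lin_hull_subset: "module_over A N \<Longrightarrow> B \<subseteq> N \<Longrightarrow> lin_hull A B \<subseteq> N"
proof
  fix x assume N: "module_over A N" "B \<subseteq> N" and "x \<in> lin_hull A B"
  from this(3) show "x \<in> N"
    by (induction rule: lin_hull.induct) (use N module_overD in blast)+
qed

lemma lin_hull_mono: "A \<subseteq> A' \<Longrightarrow> B \<subseteq> B' \<Longrightarrow> lin_hull A B \<subseteq> lin_hull A' B'"
proof
  fix x assume s: "A \<subseteq> A'" "B \<subseteq> B'" and "x \<in> lin_hull A B"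
  from this(3) show "x \<in> lin_hull A' B'"
    by (induction rule: lin_hull.induct) (use s in \<open>auto intro: lin_hull.intros\<close>)
qed

lemma lin_hull_add: "x \<in> lin_hull A B \<Longrightarrow> y \<in> lin_hull A B \<Longrightarrow> x + y \<in> lin_hull A B"
  by (induction rule: lin_hull.induct) (auto simp: add.assoc intro: lin_hull.intros)

lemma lin_hull_module:
  assumes "subring_set A" shows "module_over A (lin_hull A B)"
  unfolding module_over_def
proof (intro conjI ballI)
  fix a x assume a: "a \<in> A" and "x \<in> lin_hull A B"
  from this(2) show "a * x \<in> lin_hull A B"
  proof (induction rule: lin_hull.induct)
    case (step b c x)
    then have "(a * b) * c + a * x \<in> lin_hull A B"
      using a subring_setD[OF assms] by (blast intro: lin_hull.step)
    then show ?case by (simp add: algebra_simps)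
  qed (simp add: lin_hull.zero)
qed (auto intro: lin_hull.zero lin_hull_add)

lemma lin_hull_base: "subring_set A \<Longrightarrow> b \<in> B \<Longrightarrow> b \<in> lin_hull A B"
  using lin_hull.step[of 1 A b B 0] subring_setD[of A] by (simp add: lin_hull.zero)

lemma lin_hull_insert:
  assumes "subring_set A" "x \<in> lin_hull A (insert b B)"
  shows "\<exists>a\<in>A. \<exists>y\<in>lin_hull A B. x = a * b + y"
  using assms(2)
proof (induction rule: lin_hull.induct)
  case zero
  show ?case using subring_setD[OF assms(1)] lin_hull.zero by (intro bexI[of _ 0]) auto
next
  case (step c d x)
  then obtain a y where x: "a \<in> A" "y \<in> lin_hull A B" "x = a * b + y" by blast
  show ?case
  proof (cases "d = b")
    case True
    then have "c * d + x = (c + a) * b + y" using x by (simp add: algebra_simps)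
    then show ?thesis using x step.hyps subring_setD[OF assms(1)] by blast
  next
    case False
    then have "c * d + y \<in> lin_hull A B" using step.hyps x by (auto intro: lin_hull.step)
    moreover have "c * d + x = a * b + (c * d + y)" using x by (simp add: algebra_simps)
    ultimately show ?thesis using x by blast
  qed
qed

lemma lin_hull_eq_sums:
  assumes A: "subring_set A" and "finite B"
  shows "lin_hull A B = {\<Sum>b\<in>B. a b * b | a. \<forall>b\<in>B. a b \<in> A}"
proof (intro equalityI subsetI)
  fix x assume "x \<in> lin_hull A B"
  then show "x \<in> {\<Sum>b\<in>B. a b * b | a. \<forall>b\<in>B. a b \<in> A}"
  proof (induction rule: lin_hull.induct)
    case zero
    then show ?case using subring_setD[OF A] by (auto intro!: exI[of _ "\<lambda>_. 0"])
  next
    case (step c d x)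
    then obtain a where a: "x = (\<Sum>b\<in>B. a b * b)" "\<forall>b\<in>B. a b \<in> A" by blast
    have "(\<Sum>b\<in>B. (if b = d then c + a b else a b) * b) = (\<Sum>b\<in>B. (if b = d then c * b else 0) + a b * b)"
      by (intro sum.cong) (auto simp: algebra_simps)
    also have "\<dots> = c * d + x" using step.hyps assms(2) a by (simp add: sum.distrib)
    finally show ?case
      using a step.hyps subring_setD[OF A]
      by (intro CollectI exI[of _ "\<lambda>b. if b = d then c + a b else a b"]) auto
  qed
next
  fix x assume "x \<in> {\<Sum>b\<in>B. a b * b | a. \<forall>b\<in>B. a b \<in> A}"
  then obtain a where a: "x = (\<Sum>b\<in>B. a b * b)" "\<forall>b\<in>B. a b \<in> A" by blast
  have "finite C \<Longrightarrow> C \<subseteq> B \<Longrightarrow> (\<Sum>b\<in>C. a b * b) \<in> lin_hull A B" for C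
    by (induction rule: finite_induct) (use a in \<open>auto intro: lin_hull.intros\<close>)
  then show "x \<in> lin_hull A B" using a assms by blast
qed

lemma finite_module_overI:
  assumes "subring_set A" "module_over A R" "finite B" "B \<subseteq> R" "R \<subseteq> lin_hull A B"
  shows "finite_module_over A R"
  unfolding finite_module_over_def
proof (intro exI conjI)
  show "R = {\<Sum>b\<in>B. a b * b | a. \<forall>b\<in>B. a b \<in> A}"
    using assms lin_hull_subset[of A R B] lin_hull_eq_sums[of A B] by blast
qed (use assms in auto)

text \<open>Carries a combination of coefficients over to module elements: if each \<open>g\<close>
  in \<open>G\<close> is the coefficient at \<open>b\<close>, modulo \<open>P\<close>, of an element
  \<open>n g\<close>, the same combination of the \<open>n g\<close> has coefficient
  \<open>a\<close>. It serves with \<open>b\<close> a new generator and with \<open>b\<close> a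
  power of an adjoined element.\<close>

lemma lin_hull_lift:
  assumes "subring_set A" "module_over A P" "\<And>g. g \<in> G \<Longrightarrow> \<exists>y\<in>P. n g = g * b + y" "a \<in> lin_hull A G"
  shows "\<exists>z\<in>lin_hull A (n ` G). \<exists>y\<in>P. z = a * b + y"
  using assms(4)
proof (induction rule: lin_hull.induct)
  case zero
  show ?case using lin_hull.zero module_overD[OF assms(2)] by force
next
  case (step c g x)
  then obtain z y where z: "z \<in> lin_hull A (n ` G)" "y \<in> P" "z = x * b + y" by blast
  obtain y' where y': "y' \<in> P" "n g = g * b + y'" using assms(3) step.hyps by blast
  have "c * n g + z \<in> lin_hull A (n ` G)" using z step.hyps by (auto intro: lin_hull.step)
  moreover have "c * y' + y \<in> P" using z y' step.hyps module_overD[OF assms(2)] by blast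
  moreover have "c * n g + z = (c * g + x) * b + (c * y' + y)"
    using z y' by (simp add: algebra_simps)
  ultimately show ?case by blast
qed

text \<open>Induction on the generators: a submodule is controlled by the ideal of its coefficients
  at the new generator \<open>b\<close> and by its intersection with the hull of the old ones, both
  finitely generated.\<close>

lemma noetherian_lin_hull:
  assumes A: "subring_set A" and noeth: "noetherian_mod A A" and "finite B"
  shows "noetherian_mod A (lin_hull A B)"
  using assms(3)
proof (induction rule: finite_induct)
  case empty
  have "lin_hull A {} \<subseteq> {0}"
  proof
    fix x assume "x \<in> lin_hull A {}"
    then show "x \<in> {0}" by (induction rule: lin_hull.induct) auto
  qed
  then show ?case
    unfolding noetherian_mod_def by (auto intro!: exI[of _ "{}"] lin_hull.zero)
next
  case (insert b B)
  show ?case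
    unfolding noetherian_mod_def
  proof (intro allI impI)
    fix N assume N: "N \<subseteq> lin_hull A (insert b B)" "module_over A N"
    let ?P = "lin_hull A B"
    have P: "module_over A ?P" by (rule lin_hull_module[OF A])
    \<comment> \<open>The coefficient at \<open>b\<close> need not be unique, so the coefficients of
      all representations are collected.\<close>
    define I where "I = {a \<in> A. \<exists>y\<in>?P. a * b + y \<in> N}"
    have "module_over A I"
      unfolding module_over_def
    proof (intro conjI ballI)
      show "0 \<in> I"
        using subring_setD[OF A] module_overD[OF N(2)] lin_hull.zero unfolding I_def by force
    next
      fix x y assume "x \<in> I" "y \<in> I"
      then obtain u v where "u \<in> ?P" "v \<in> ?P" "x * b + u \<in> N" "y * b + v \<in> N" "x \<in> A" "y \<in> A"
        unfolding I_def by blast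
      moreover have "(x + y) * b + (u + v) = (x * b + u) + (y * b + v)" by (simp add: algebra_simps)
      ultimately show "x + y \<in> I"
        using subring_setD[OF A] module_overD[OF N(2)] module_overD[OF P] unfolding I_def
        by (metis (mono_tags, lifting) mem_Collect_eq)
    next
      fix a x assume a: "a \<in> A" and "x \<in> I"
      then obtain u where "u \<in> ?P" "x * b + u \<in> N" "x \<in> A" unfolding I_def by blast
      moreover have "(a * x) * b + a * u = a * (x * b + u)" by (simp add: algebra_simps)
      ultimately show "a * x \<in> I"
        using a subring_setD[OF A] module_overD[OF N(2)] module_overD[OF P] unfolding I_def
        by (metis (mono_tags, lifting) mem_Collect_eq)
    qed
    moreover have "I \<subseteq> A" by (auto simp: I_def)
    ultimately obtain G where G: "finite G" "G \<subseteq> I" "I \<subseteq> lin_hull A G"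
      using noeth unfolding noetherian_mod_def by meson
    have "\<forall>g\<in>G. \<exists>y. y \<in> ?P \<and> g * b + y \<in> N" using G(2) unfolding I_def by blast
    then obtain y where y: "\<And>g. g \<in> G \<Longrightarrow> y g \<in> ?P \<and> g * b + y g \<in> N" by metis
    define n where "n g = g * b + y g" for g
    have "module_over A (N \<inter> ?P)" using N(2) P unfolding module_over_def by blast
    then obtain H where H: "finite H" "H \<subseteq> N \<inter> ?P" "N \<inter> ?P \<subseteq> lin_hull A H"
      using insert.IH unfolding noetherian_mod_def by (meson inf_le2)
    let ?C = "n ` G \<union> H"
    have C: "module_over A (lin_hull A ?C)" by (rule lin_hull_module[OF A])
    have CN: "?C \<subseteq> N" using y H unfolding n_def by blast
    have "x \<in> lin_hull A ?C" if "x \<in> N" for x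
    proof -
      obtain a u where a: "a \<in> A" "u \<in> ?P" "x = a * b + u"
        using lin_hull_insert[OF A, of x b B] N(1) \<open>x \<in> N\<close> by blast
      then have "a \<in> lin_hull A G" using G(3) \<open>x \<in> N\<close> unfolding I_def by blast
      then obtain z w where z: "z \<in> lin_hull A (n ` G)" "w \<in> ?P" "z = a * b + w"
        using lin_hull_lift[OF A P, of G n b a] y unfolding n_def by blast
      have "z \<in> N" using lin_hull_subset[OF N(2), of "n ` G"] CN z(1) by blast
      \<comment> \<open>\<open>x\<close> and \<open>z\<close> have the same coefficient
        \<open>a\<close> at \<open>b\<close>, so their difference falls into
        \<open>N \<inter> ?P\<close>.\<close>
      then have "x - z \<in> N" using module_over_diff[OF N(2) A] \<open>x \<in> N\<close> by blast
      moreover have "x - z = u - w" using a z by simp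
      moreover have "u - w \<in> ?P" using module_over_diff[OF P A] a z by blast
      ultimately have "x - z \<in> lin_hull A ?C"
        using H(3) lin_hull_mono[of A A H ?C] by auto
      moreover have "z \<in> lin_hull A ?C" using z(1) lin_hull_mono[of A A "n ` G" ?C] by blast
      ultimately have "z + (x - z) \<in> lin_hull A ?C" by (intro lin_hull_add)
      then show ?thesis by simp
    qed
    then show "\<exists>B. finite B \<and> B \<subseteq> N \<and> N \<subseteq> lin_hull A B"
      using G(1) H(1) CN by (intro exI[of _ ?C]) blast
  qed
qed

section \<open>Adjoining one element to a subring\<close>

definition adjoin :: "'r::comm_ring_1 set \<Rightarrow> 'r \<Rightarrow> 'r set" where
  "adjoin A x = lin_hull A (range (\<lambda>i. x ^ i))"

text \<open>Expressions in \<open>x\<close> of formal degree below \<open>d\<close>. As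
  \<open>x\<close> may satisfy relations over \<open>A\<close>, a degree belongs to an expression
  and not to an element; this filtration takes its place.\<close>

definition polys_below :: "'r::comm_ring_1 set \<Rightarrow> 'r \<Rightarrow> nat \<Rightarrow> 'r set" where
  "polys_below A x d = lin_hull A ((\<lambda>i. x ^ i) ` {..<d})"

lemma polys_below_module: "subring_set A \<Longrightarrow> module_over A (polys_below A x d)"
  unfolding polys_below_def by (rule lin_hull_module)

lemma polys_below_mono: "d \<le> e \<Longrightarrow> polys_below A x d \<subseteq> polys_below A x e"
  unfolding polys_below_def by (intro lin_hull_mono image_mono) auto

lemma polys_below_adjoin: "polys_below A x d \<subseteq> adjoin A x"
  unfolding polys_below_def adjoin_def by (intro lin_hull_mono) auto

lemma adjoin_polys_below: "f \<in> adjoin A x \<Longrightarrow> \<exists>d. f \<in> polys_below A x d"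
  unfolding adjoin_def
proof (induction rule: lin_hull.induct)
  case zero
  show ?case by (auto simp: polys_below_def intro: lin_hull.zero)
next
  case (step a b f)
  then obtain d i where d: "f \<in> polys_below A x d" and b: "b = x ^ i" by auto
  have "f \<in> polys_below A x (max d (Suc i))"
    using d polys_below_mono[of d "max d (Suc i)"] by auto
  then have "a * b + f \<in> polys_below A x (max d (Suc i))"
    using step.hyps unfolding polys_below_def b by (intro lin_hull.step) auto
  then show ?case by blast
qed

lemma polys_below_Suc:
  "subring_set A \<Longrightarrow> f \<in> polys_below A x (Suc d) \<Longrightarrow> \<exists>a\<in>A. \<exists>y\<in>polys_below A x d. f = a * x ^ d + y"
  unfolding polys_below_def lessThan_Suc image_insert by (rule lin_hull_insert)

lemma polys_below_shift: "f \<in> polys_below A x d \<Longrightarrow> x ^ e * f \<in> polys_below A x (d + e)"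
  unfolding polys_below_def
proof (induction rule: lin_hull.induct)
  case (step a b f)
  then obtain i where i: "i < d" "b = x ^ i" by auto
  have "a * x ^ (i + e) + x ^ e * f \<in> lin_hull A ((\<lambda>i. x ^ i) ` {..<d + e})"
    using step i by (intro lin_hull.step imageI) auto
  then show ?case using i by (simp add: algebra_simps power_add)
qed (simp add: lin_hull.zero)

lemma subset_adjoin:
  assumes "subring_set A" shows "A \<subseteq> adjoin A x"
proof
  fix a assume "a \<in> A"
  then have "a * x ^ 0 + 0 \<in> adjoin A x" unfolding adjoin_def by (intro lin_hull.intros rangeI)
  then show "a \<in> adjoin A x" by simp
qed

lemma power_adjoin: "subring_set A \<Longrightarrow> x ^ i \<in> adjoin A x"
  unfolding adjoin_def by (rule lin_hull_base) auto

lemma adjoin_subring: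
  assumes A: "subring_set A" shows "subring_set (adjoin A x)"
proof -
  have mod: "module_over A (adjoin A x)" unfolding adjoin_def by (rule lin_hull_module[OF A])
  have pw: "x ^ i * f \<in> adjoin A x" if "f \<in> adjoin A x" for i f
    using adjoin_polys_below[OF that] polys_below_shift polys_below_adjoin by blast
  have "f * g \<in> adjoin A x" if "f \<in> adjoin A x" "g \<in> adjoin A x" for f g
    using that(1) unfolding adjoin_def
  proof (induction rule: lin_hull.induct)
    case (step a b f)
    then have "b * g \<in> adjoin A x" using pw that(2) by blast
    then have "a * (b * g) \<in> adjoin A x" using mod step.hyps module_overD by blast
    then show ?case using step.IH lin_hull_add unfolding adjoin_def
      by (metis distrib_right mult.assoc)
  qed (simp add: lin_hull.zero)
  moreover have "- f \<in> adjoin A x" if "f \<in> adjoin A x" for f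
    using module_over_diff[OF mod A, of 0 f] module_overD[OF mod] that by simp
  moreover have "1 \<in> adjoin A x" using power_adjoin[OF A, of x 0] by simp
  ultimately show ?thesis using module_overD[OF mod] unfolding subring_set_def by blast
qed

text \<open>The ideals \<open>I d\<close> of leading coefficients of formal expressions increase
  with \<open>d\<close>. Their union is finitely generated, so generators of it all occur at one
  level \<open>D\<close>. Elements of formal degree at least \<open>D\<close> are reduced by shifted
  lifts of these generators, and the rest lies in the Noetherian module \<open>?P D\<close>.\<close>

theorem hilbert_basis:
  assumes A: "subring_set A" and noeth: "noetherian_mod A A"
  shows "noetherian_mod (adjoin A x) (adjoin A x)"
  unfolding noetherian_mod_def
proof (intro allI impI)
  fix N assume N: "N \<subseteq> adjoin A x" "module_over (adjoin A x) N"
  let ?T = "adjoin A x" and ?P = "polys_below A x"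
  have T: "subring_set ?T" by (rule adjoin_subring[OF A])
  have P: "module_over A (?P d)" for d by (rule polys_below_module[OF A])
  have NA: "module_over A N" using N(2) subset_adjoin[OF A, of x] unfolding module_over_def by blast
  define I where "I d = {a \<in> A. \<exists>y\<in>?P d. a * x ^ d + y \<in> N}" for d
  have I_up: "a \<in> I (d + e)" if aI: "a \<in> I d" for a d e
  proof -
    obtain y where y: "a \<in> A" "y \<in> ?P d" "a * x ^ d + y \<in> N" using aI unfolding I_def by blast
    have "x ^ e * (a * x ^ d + y) \<in> N" using y N(2) power_adjoin[OF A] module_overD by blast
    moreover have "x ^ e * (a * x ^ d + y) = a * x ^ (d + e) + x ^ e * y"
      by (simp add: algebra_simps power_add)
    ultimately show ?thesis using y polys_below_shift unfolding I_def by fastforce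
  qed
  have I_mono: "a \<in> I e" if "a \<in> I d" "d \<le> e" for a d e
    using I_up[OF that(1), of "e - d"] that(2) by simp
  define L where "L = (\<Union>d. I d)"
  have "module_over A L"
    unfolding module_over_def
  proof (intro conjI ballI)
    have "0 \<in> I 0" using subring_setD(2)[OF A] module_overD(1)[OF NA] module_overD(1)[OF P]
      unfolding I_def by (intro CollectI conjI bexI[of _ 0]) simp_all
    then show "0 \<in> L" unfolding L_def by blast
  next
    fix a b assume "a \<in> L" "b \<in> L"
    then obtain d e where "a \<in> I d" "b \<in> I e" unfolding L_def by blast
    then have "a \<in> I (max d e)" "b \<in> I (max d e)" using I_mono by auto
    then obtain u v where "a \<in> A" "b \<in> A" "u \<in> ?P (max d e)" "v \<in> ?P (max d e)"
      "a * x ^ max d e + u \<in> N" "b * x ^ max d e + v \<in> N" unfolding I_def by blast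
    moreover have "(a + b) * x ^ max d e + (u + v) = (a * x ^ max d e + u) + (b * x ^ max d e + v)"
      by (simp add: algebra_simps)
    ultimately have "a + b \<in> I (max d e)"
      using subring_setD[OF A] module_overD[OF NA] module_overD[OF P] unfolding I_def
      by (metis (mono_tags, lifting) mem_Collect_eq)
    then show "a + b \<in> L" unfolding L_def by blast
  next
    fix a b assume a: "a \<in> A" and "b \<in> L"
    then obtain d where "b \<in> I d" unfolding L_def by blast
    then obtain u where "b \<in> A" "u \<in> ?P d" "b * x ^ d + u \<in> N" unfolding I_def by blast
    moreover have "(a * b) * x ^ d + a * u = a * (b * x ^ d + u)" by (simp add: algebra_simps)
    ultimately have "a * b \<in> I d"
      using a subring_setD[OF A] module_overD[OF NA] module_overD[OF P] unfolding I_def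
      by (metis (mono_tags, lifting) mem_Collect_eq)
    then show "a * b \<in> L" unfolding L_def by blast
  qed
  moreover have "L \<subseteq> A" unfolding L_def I_def by blast
  ultimately obtain G where G: "finite G" "G \<subseteq> L" "L \<subseteq> lin_hull A G"
    using noeth unfolding noetherian_mod_def by meson
  have "\<exists>D. \<forall>g\<in>G. g \<in> I D"
    using G(1,2)
  proof (induction rule: finite_induct)
    case (insert g G)
    then obtain D d where "\<forall>g\<in>G. g \<in> I D" "g \<in> I d" unfolding L_def by auto
    then show ?case using I_mono[of _ D "max D d"] I_mono[of _ d "max D d"]
      by (intro exI[of _ "max D d"]) auto
  qed simp
  then obtain D where D: "\<forall>g\<in>G. g \<in> I D" by blast
  have "\<forall>g\<in>G. \<exists>y. y \<in> ?P D \<and> g * x ^ D + y \<in> N" using D unfolding I_def by blast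
  then obtain y where y: "\<And>g. g \<in> G \<Longrightarrow> y g \<in> ?P D \<and> g * x ^ D + y g \<in> N" by metis
  define n where "n g = g * x ^ D + y g" for g
  have "noetherian_mod A (?P D)"
    unfolding polys_below_def by (rule noetherian_lin_hull[OF A noeth]) simp
  moreover have "module_over A (N \<inter> ?P D)" using NA P[of D] unfolding module_over_def by blast
  ultimately obtain H where H: "finite H" "H \<subseteq> N \<inter> ?P D" "N \<inter> ?P D \<subseteq> lin_hull A H"
    unfolding noetherian_mod_def by (meson inf_le2)
  let ?C = "n ` G \<union> H"
  have CN: "?C \<subseteq> N" using y H unfolding n_def by blast
  have C: "module_over ?T (lin_hull ?T ?C)" by (rule lin_hull_module[OF T])
  have hull: "f \<in> lin_hull ?T ?C" if "f \<in> N" "f \<in> ?P d" for f d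
    using that
  proof (induction d arbitrary: f)
    case 0
    then have "f \<in> ?P D" using polys_below_mono[of 0 D] by auto
    then show ?case using 0 H(3) lin_hull_mono[OF subset_adjoin[OF A, of x], of H ?C] by blast
  next
    case (Suc e)
    show ?case
    proof (cases "Suc e \<le> D")
      case True
      then have "f \<in> ?P D" using polys_below_mono[of "Suc e" D] Suc.prems by auto
      then show ?thesis using Suc.prems H(3) lin_hull_mono[OF subset_adjoin[OF A, of x], of H ?C] by blast
    next
      case False
      then have De: "D + (e - D) = e" by simp
      obtain a u where a: "a \<in> A" "u \<in> ?P e" "f = a * x ^ e + u"
        using polys_below_Suc[OF A Suc.prems(2)] by blast
      then have "a \<in> L" using Suc.prems(1) unfolding L_def I_def by blast
      then obtain z w where z: "z \<in> lin_hull A (n ` G)" "w \<in> ?P D" "z = a * x ^ D + w"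
        using lin_hull_lift[OF A P, of G D n "x ^ D" a] y G(3) unfolding n_def by blast
      have zC: "z \<in> lin_hull ?T ?C"
        using z(1) lin_hull_mono[OF subset_adjoin[OF A, of x], of "n ` G" ?C] by blast
      then have "z \<in> N" using lin_hull_subset[OF N(2) CN] by blast
      \<comment> \<open>The factor raises the leading term \<open>a * x ^ D\<close> of
        \<open>z\<close> to the leading term \<open>a * x ^ e\<close> of \<open>f\<close>, so the
        difference has smaller formal degree.\<close>
      let ?z = "x ^ (e - D) * z"
      have zN: "?z \<in> N" using \<open>z \<in> N\<close> N(2) power_adjoin[OF A] module_overD by blast
      have "?z = a * x ^ e + x ^ (e - D) * w"
      proof -
        have "?z = a * x ^ (D + (e - D)) + x ^ (e - D) * w"
          unfolding z(3) power_add by (simp add: algebra_simps)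
        then show ?thesis by (simp only: De)
      qed
      then have diff: "f - ?z = u - x ^ (e - D) * w" using a by simp
      have "x ^ (e - D) * w \<in> ?P e" using polys_below_shift[OF z(2), of "e - D"] De by simp
      then have "f - ?z \<in> ?P e" unfolding diff using module_over_diff[OF P A] a by blast
      moreover have "f - ?z \<in> N" using module_over_diff[OF NA A] Suc.prems zN by blast
      ultimately have "f - ?z \<in> lin_hull ?T ?C" using Suc.IH by blast
      moreover have "?z \<in> lin_hull ?T ?C" using zC C power_adjoin[OF A] module_overD by blast
      ultimately have "?z + (f - ?z) \<in> lin_hull ?T ?C" by (intro lin_hull_add)
      then show ?thesis by simp
    qed
  qed
  then have "N \<subseteq> lin_hull ?T ?C" using N(1) adjoin_polys_below by blast
  then show "\<exists>B. finite B \<and> B \<subseteq> N \<and> N \<subseteq> lin_hull ?T B"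
    using G(1) H(1) CN by (intro exI[of _ ?C]) blast
qed

section \<open>Noetherianity of finitely generated subalgebras\<close>

lemma gen_subalgebra_uminus: "f \<in> gen_subalgebra X \<Longrightarrow> - f \<in> gen_subalgebra X"
proof -
  assume "f \<in> gen_subalgebra X"
  then have "Const (- 1) * f \<in> gen_subalgebra X" by (intro gen_subalgebra.mult gen_subalgebra.const)
  moreover have "Const (- 1 :: 'a) = - 1"
    by (simp add: Const_def) (metis single_one single_uminus)
  ultimately show ?thesis by simp
qed

lemma gen_subalgebra_subring: "subring_set (gen_subalgebra (X :: 'a::comm_ring_1 mpoly set))"
proof -
  have "(1 :: 'a mpoly) = Const 1" by (simp add: Const_def)
  then have "1 \<in> gen_subalgebra X" using gen_subalgebra.const by metis
  then show ?thesis
    unfolding subring_set_def using gen_subalgebra_uminus by (blast intro: gen_subalgebra.intros)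
qed

lemma gen_subalgebra_mono: "X \<subseteq> Y \<Longrightarrow> gen_subalgebra X \<subseteq> gen_subalgebra Y"
proof
  fix f assume "X \<subseteq> Y" "f \<in> gen_subalgebra X"
  from this(2,1) show "f \<in> gen_subalgebra Y"
    by (induction rule: gen_subalgebra.induct) (auto intro: gen_subalgebra.intros)
qed

lemma gen_subalgebra_insert: "gen_subalgebra (insert h X) = adjoin (gen_subalgebra X) h"
proof (intro equalityI subsetI)
  let ?A = "gen_subalgebra X"
  have A: "subring_set ?A" by (rule gen_subalgebra_subring)
  fix f assume "f \<in> gen_subalgebra (insert h X)"
  then show "f \<in> adjoin ?A h"
  proof (induction rule: gen_subalgebra.induct)
    case (const c)
    then show ?case using subset_adjoin[OF A] gen_subalgebra.const by blast
  next
    case (gen f)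
    then show ?case
      using subset_adjoin[OF A] power_adjoin[OF A, of h 1] gen_subalgebra.gen[of f X] by auto
  qed (use subring_setD[OF adjoin_subring[OF A]] in blast)+
next
  let ?B = "gen_subalgebra (insert h X)"
  have B: "subring_set ?B" by (rule gen_subalgebra_subring)
  fix f assume "f \<in> adjoin (gen_subalgebra X) h"
  then show "f \<in> ?B"
    unfolding adjoin_def
  proof (induction rule: lin_hull.induct)
    case zero
    then show ?case using subring_setD[OF B] by blast
  next
    case (step a b f)
    have "h ^ i \<in> ?B" for i
      by (induction i) (use subring_setD[OF B] gen_subalgebra.gen[of h "insert h X"] in auto)
    then have "b \<in> ?B" using step.hyps by blast
    moreover have "a \<in> ?B" using step.hyps gen_subalgebra_mono[of X "insert h X"] by blast
    ultimately show ?case using step.IH by (blast intro: gen_subalgebra.intros)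
  qed
qed

text \<open>Generators are adjoined one at a time to the constants. These form a field, so a nonzero
  submodule of them contains 1.\<close>

lemma noetherian_gen_subalgebra:
  fixes X :: "'a::field mpoly set"
  assumes "finite X"
  shows "noetherian_mod (gen_subalgebra X) (gen_subalgebra X)"
  using assms
proof (induction rule: finite_induct)
  case empty
  let ?A = "gen_subalgebra ({} :: 'a mpoly set)"
  have A: "f \<in> range Const" if "f \<in> ?A" for f
    using that
  proof (induction rule: gen_subalgebra.induct)
    case (add f g)
    then show ?case by (auto simp: Const_def single_add[symmetric])
  next
    case (mult f g)
    then show ?case by (auto simp: Const_def mult_single)
  qed auto
  show ?case
    unfolding noetherian_mod_def
  proof (intro allI impI)
    fix N assume N: "N \<subseteq> ?A" "module_over ?A N"
    show "\<exists>B. finite B \<and> B \<subseteq> N \<and> N \<subseteq> lin_hull ?A B"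
    proof (cases "N \<subseteq> {0}")
      case True
      then show ?thesis by (intro exI[of _ "{}"]) (auto intro: lin_hull.zero)
    next
      case False
      then obtain c where c: "Const c \<in> N" "c \<noteq> 0" using N(1) A by (force simp: Const_def)
      have "Const (inverse c) * Const c \<in> N"
        using c module_overD[OF N(2)] gen_subalgebra.const by blast
      moreover have "Const (inverse c) * Const c = 1" using c by (simp add: Const_def mult_single)
      ultimately have "1 \<in> N" by simp
      moreover have "f \<in> lin_hull ?A {1}" if "f \<in> N" for f
        using lin_hull.step[of f ?A 1 "{1}" 0] N(1) that by (auto intro: lin_hull.zero)
      ultimately show ?thesis by (intro exI[of _ "{1}"]) auto
    qed
  qed
next
  case (insert h X)
  then show ?case unfolding gen_subalgebra_insert by (intro hilbert_basis gen_subalgebra_subring)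
qed

section \<open>Points orthogonal to their Frobenius twists\<close>

text \<open>Multiplication by a nonzero \<open>x\<close> permutes the nonzero elements, whose
  product can be cancelled.\<close>

lemma power_card_eq_self: "(x :: 'a::{field,finite}) ^ CARD('a) = x"
proof (cases "x = 0")
  case False
  have pos: "0 < CARD('a)" by (simp add: card_gt_0_iff)
  have "x * (\<Prod>y\<in>UNIV-{0}. x * y) = x * x ^ (CARD('a) - 1) * \<Prod>(UNIV-{0})"
    by (simp add: prod.distrib mult_ac)
  also have "x * x ^ (CARD('a) - 1) = x ^ CARD('a)"
    using pos by (metis power_Suc Suc_diff_1)
  also have "(\<Prod>y\<in>UNIV-{0}. x * y) = (\<Prod>y\<in>UNIV-{0}. y)"
    by (rule prod.reindex_bij_witness[of _ "\<lambda>y. y / x" "\<lambda>y. x * y"]) (use False in auto)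
  finally show ?thesis
    by simp
qed (simp add: card_gt_0_iff)

lemma power_card_power_eq_self: "(x :: 'a::{field,finite}) ^ (CARD('a) ^ i) = x"
  by (induction i) (simp_all add: power_mult power_card_eq_self)

text \<open>Translation by 1 permutes the field, so adding \<open>CARD('a)\<close> ones to the sum
  of all elements does not change it.\<close>

lemma of_nat_CARD_eq_0: "of_nat CARD('a) = (0 :: 'a::{field,finite})"
proof -
  have "(\<Sum>x\<in>(UNIV::'a set). x) = (\<Sum>x\<in>(UNIV::'a set). x + 1)"
    by (rule sum.reindex_bij_witness[of _ "\<lambda>x. x + 1" "\<lambda>x. x - 1"]) auto
  then show ?thesis by (simp add: sum.distrib)
qed

text \<open>The target \<open>'k\<close> is a domain rather than a field so that the Frobenius
  identities also hold, with \<open>emb = Const\<close>, inside the polynomial ring. Recording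
  \<open>q\<close> as a power of \<open>p\<close> makes the \<open>q\<close>-th power an iterate of
  the additive \<open>p\<close>-th power.\<close>

locale fq_algebra = comm_ring_hom emb
  for emb :: "'a::{field,finite} \<Rightarrow> 'k::idom" +
  fixes p r q :: nat
  assumes prime_p: "prime p" and odd_p: "odd p" and q_card: "q = CARD('a)" and q_power: "q = p ^ r"
begin

lemma emb_eq_0_iff [simp]: "emb a = 0 \<longleftrightarrow> a = 0"
proof
  assume "emb a = 0"
  then have "emb (a * inverse a) = 0" by (simp add: hom_distribs)
  then show "a = 0" by (metis hom_one right_inverse zero_neq_one)
qed simp

lemma emb_eq_iff [simp]: "emb a = emb b \<longleftrightarrow> a = b"
  using emb_eq_0_iff[of "a - b"] by (simp add: hom_distribs)

lemma of_nat_p: "of_nat p = (0 :: 'k)"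
proof -
  have "of_nat (p ^ r) = (0 :: 'a)" using of_nat_CARD_eq_0 q_card q_power by metis
  then have "of_nat p = (0 :: 'a)" by simp
  then show ?thesis by (metis hom_of_nat hom_zero)
qed

lemma char_k: "CHAR('k) = p"
proof -
  have "CHAR('k) dvd p" using of_nat_p of_nat_eq_0_iff_char_dvd by blast
  then show ?thesis using prime_p by (metis CHAR_not_1' One_nat_def prime_nat_iff)
qed

lemma two_neq_0: "(2 :: 'k) \<noteq> 0"
proof
  assume "(2 :: 'k) = 0"
  then have "CHAR('k) dvd 2" using of_nat_eq_0_iff_char_dvd[of 2, where ?'a='k] by simp
  then have "p \<le> 2" using char_k by (auto dest: dvd_imp_le)
  then show False using prime_p odd_p prime_ge_2_nat[of p] by (auto simp: le_less)
qed

lemma q_pos: "0 < q" by (simp add: q_card card_gt_0_iff)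

lemma q_gt_1: "1 < q"
proof -
  have "card {0, 1 :: 'a} \<le> CARD('a)" by (rule card_mono) auto
  then show ?thesis by (simp add: q_card)
qed

lemma frob_sum: "(sum f A :: 'k) ^ (q ^ i) = (\<Sum>x\<in>A. f x ^ (q ^ i))"
  by (rule freshmans_dream_sum'[of _ "r * i"]) (simp_all add: char_k prime_p q_power power_mult)

lemma frob_add: "(x + y :: 'k) ^ (q ^ i) = x ^ (q ^ i) + y ^ (q ^ i)"
  by (rule freshmans_dream'[of _ "r * i"]) (simp_all add: char_k prime_p q_power power_mult)

lemma frob_emb: "emb a ^ (q ^ i) = emb a"
  by (metis hom_power power_card_power_eq_self q_card)

lemma frob_frob: "((x :: 'k) ^ (q ^ i)) ^ (q ^ j) = x ^ (q ^ (i + j))"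
  by (simp add: power_add power_mult)

text \<open>The polynomial X^q - X has at most \<open>q\<close> roots in a domain, and the image of
  \<open>emb\<close> already supplies \<open>q\<close> of them.\<close>

lemma frob_fixed:
  assumes "(c :: 'k) ^ q = c" shows "\<exists>a. c = emb a"
proof -
  let ?P = "monom 1 q - monom 1 1 :: 'k poly"
  have "coeff ?P q = 1" using q_gt_1 by simp
  then have nz: "?P \<noteq> 0" by (metis coeff_0 zero_neq_one)
  have deg: "degree ?P \<le> q" using q_gt_1 by (intro degree_diff_le) (auto simp: degree_monom_eq)
  have sub: "range emb \<subseteq> {x. poly ?P x = 0}"
    using frob_emb[of _ 1] by (auto simp: poly_monom)
  have "card (range emb) = q" unfolding q_card by (intro card_image injI) simp
  moreover have "card {x. poly ?P x = 0} \<le> q"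
    using card_poly_roots_bound[OF nz] deg by linarith
  ultimately have "range emb = {x. poly ?P x = 0}"
    by (intro card_seteq[OF poly_roots_finite[OF nz] sub]) simp
  then show ?thesis using assms by (auto simp: poly_monom)
qed

definition fq_indep :: "('i \<Rightarrow> 'k) \<Rightarrow> 'i set \<Rightarrow> bool" where
  "fq_indep x I \<longleftrightarrow> (\<forall>a. (\<Sum>k\<in>I. emb (a k) * x k) = 0 \<longrightarrow> (\<forall>k\<in>I. a k = 0))"

lemma fq_indep_subset:
  assumes "fq_indep x I" "J \<subseteq> I" "finite I" shows "fq_indep x J"
  unfolding fq_indep_def
proof (intro allI impI ballI)
  fix a k assume a: "(\<Sum>k\<in>J. emb (a k) * x k) = 0" and k: "k \<in> J"
  have "(\<Sum>k\<in>I. emb (if k \<in> J then a k else 0) * x k) = (\<Sum>k\<in>J. emb (a k) * x k)"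
    using assms by (intro sum.mono_neutral_cong_right) auto
  then have "\<forall>k\<in>I. (if k \<in> J then a k else 0) = 0"
    using assms(1)[unfolded fq_indep_def, rule_format, of "\<lambda>k. if k \<in> J then a k else 0"] a by simp
  moreover have "k \<in> I" using k assms(2) by auto
  ultimately show "a k = 0" using k by metis
qed

text \<open>A relation between the \<open>q\<close>-th powers with coefficients in
  \<open>F\<^sub>q\<close> is the \<open>q\<close>-th power of the same relation between the
  \<open>x k\<close>.\<close>

lemma fq_indep_frob:
  assumes "fq_indep x I" shows "fq_indep (\<lambda>k. x k ^ q) I"
  unfolding fq_indep_def
proof (intro allI impI)
  fix a assume "(\<Sum>k\<in>I. emb (a k) * x k ^ q) = 0"
  then have "(\<Sum>k\<in>I. emb (a k) * x k) ^ q = 0"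
    using frob_sum[of "\<lambda>k. emb (a k) * x k" I 1] frob_emb[of _ 1] by (simp add: power_mult_distrib)
  then show "\<forall>k\<in>I. a k = 0" using assms q_pos unfolding fq_indep_def by simp
qed

end

text \<open>Elimination removes one unknown for each equation, and with more unknowns than equations
  one stays free.\<close>

lemma underdetermined_system:
  fixes a :: "nat \<Rightarrow> 'i \<Rightarrow> 'k::field"
  assumes "finite I" "n < card I"
  shows "\<exists>c. (\<exists>k\<in>I. c k \<noteq> 0) \<and> (\<forall>i<n. (\<Sum>k\<in>I. a i k * c k) = 0)"
  using assms
proof (induction n arbitrary: I a)
  case 0
  then have "I \<noteq> {}" by auto
  then show ?case by (intro exI[of _ "\<lambda>_. 1"]) auto
next
  case (Suc n)
  show ?case
  proof (cases "\<forall>k\<in>I. a n k = 0")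
    case True
    obtain c where "\<exists>k\<in>I. c k \<noteq> 0" "\<forall>i<n. (\<Sum>k\<in>I. a i k * c k) = 0"
      using Suc.IH[of I a] Suc.prems by auto
    then show ?thesis using True by (intro exI[of _ c]) (auto simp: less_Suc_eq)
  next
    case False
    then obtain j where j: "j \<in> I" "a n j \<noteq> 0" by auto
    let ?J = "I - {j}"
    have "n < card ?J" using Suc.prems j by simp
    then obtain c where c: "\<exists>k\<in>?J. c k \<noteq> 0"
      "\<forall>i<n. (\<Sum>k\<in>?J. (a i k - a i j * a n k / a n j) * c k) = 0"
      using Suc.IH[of ?J "\<lambda>i k. a i k - a i j * a n k / a n j"] Suc.prems by auto
    let ?s = "\<Sum>k\<in>?J. a n k * c k"
    define d where "d = c(j := - ?s / a n j)"
    have sum_d: "(\<Sum>k\<in>I. a i k * d k) = (\<Sum>k\<in>?J. a i k * c k) - a i j * ?s / a n j" for i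
    proof -
      have "(\<Sum>k\<in>I. a i k * d k) = a i j * d j + (\<Sum>k\<in>?J. a i k * d k)"
        using j Suc.prems by (simp add: sum.remove)
      also have "(\<Sum>k\<in>?J. a i k * d k) = (\<Sum>k\<in>?J. a i k * c k)"
        by (intro sum.cong) (auto simp: d_def)
      finally show ?thesis by (simp add: d_def)
    qed
    have "(\<Sum>k\<in>I. a i k * d k) = 0" if "i < Suc n" for i
    proof (cases "i = n")
      case True
      then show ?thesis using j sum_d[of n] by simp
    next
      case False
      with that have "(\<Sum>k\<in>?J. (a i k - a i j * a n k / a n j) * c k) = 0" using c(2) by simp
      moreover have "(\<Sum>k\<in>?J. (a i k - a i j * a n k / a n j) * c k) =
          (\<Sum>k\<in>?J. a i k * c k) - a i j * ?s / a n j"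
        by (simp add: algebra_simps sum_subtractf sum_distrib_left sum_divide_distrib)
      ultimately show ?thesis using sum_d by simp
    qed
    moreover have "\<exists>k\<in>I. d k \<noteq> 0" using c(1) by (auto simp: d_def)
    ultimately show ?thesis by blast
  qed
qed

locale fq_field = fq_algebra emb p r q for emb :: "'a::{field,finite} \<Rightarrow> 'k::field" and p r q
begin

text \<open>
  Moore's criterion: after normalising one coefficient to 1, subtracting the Frobenius image of the
  system shortens it, so the coefficients lie in \<open>F\<^sub>q\<close>.
\<close>

lemma moore:
  assumes "finite I" "fq_indep x I" "\<forall>i<card I. (\<Sum>k\<in>I. d k * x k ^ (q ^ i)) = 0" "k \<in> I"
  shows "d k = 0"
  using assms
proof (induction "card I" arbitrary: I x d k)
  case 0
  then show ?case by simp
next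
  case (Suc n)
  show ?case
  proof (rule ccontr)
    assume nz: "d k \<noteq> 0"
    define e where "e l = d l / d k" for l
    let ?J = "I - {k}"
    have e_sum: "(\<Sum>l\<in>I. e l * x l ^ (q ^ i)) = 0" if "i < card I" for i
    proof -
      have "(\<Sum>l\<in>I. e l * x l ^ (q ^ i)) = (\<Sum>l\<in>I. d l * x l ^ (q ^ i)) / d k"
        by (simp add: e_def sum_divide_distrib)
      then show ?thesis using Suc.prems(3) that by simp
    qed
    have "e l ^ q - e l = 0" if l: "l \<in> ?J" for l
    proof (rule Suc.hyps(1)[of ?J "\<lambda>l. x l ^ q" "\<lambda>l. e l ^ q - e l"])
      show "n = card ?J" "finite ?J" using Suc.hyps(2) Suc.prems by simp_all
      show "fq_indep (\<lambda>l. x l ^ q) ?J"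
        using Suc.prems by (intro fq_indep_frob) (auto intro: fq_indep_subset)
      show "\<forall>i<card ?J. (\<Sum>l\<in>?J. (e l ^ q - e l) * (x l ^ q) ^ (q ^ i)) = 0"
      proof (intro allI impI)
        fix i assume "i < card ?J"
        then have i: "Suc i < card I" using Suc.prems Suc.hyps(2) by simp
        have pw: "(x l ^ q) ^ (q ^ i) = x l ^ (q ^ Suc i)" for l
          by (simp add: power_mult)
        have "(\<Sum>l\<in>?J. (e l ^ q - e l) * (x l ^ q) ^ (q ^ i)) =
            (\<Sum>l\<in>I. (e l ^ q - e l) * x l ^ (q ^ Suc i))"
          using Suc.prems nz unfolding pw by (intro sum.mono_neutral_left) (auto simp: e_def)
        also have "\<dots> = (\<Sum>l\<in>I. (e l * x l ^ (q ^ i)) ^ (q ^ 1)) - (\<Sum>l\<in>I. e l * x l ^ (q ^ Suc i))"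
          unfolding power_mult_distrib frob_frob
          by (simp add: algebra_simps sum_subtractf)
        also have "\<dots> = (\<Sum>l\<in>I. e l * x l ^ (q ^ i)) ^ (q ^ 1) - (\<Sum>l\<in>I. e l * x l ^ (q ^ Suc i))"
          by (simp only: frob_sum)
        also have "\<dots> = 0" using e_sum[of i] e_sum[of "Suc i"] i q_pos by simp
        finally show "(\<Sum>l\<in>?J. (e l ^ q - e l) * (x l ^ q) ^ (q ^ i)) = 0" .
      qed
      show "l \<in> ?J" by (rule l)
    qed
    then have "\<exists>b. e l = emb b" if "l \<in> I" for l
    proof (cases "l = k")
      case True
      then show ?thesis using nz by (intro exI[of _ 1]) (simp add: e_def)
    qed (use that in \<open>auto intro: frob_fixed\<close>)
    then obtain b where b: "\<forall>l\<in>I. e l = emb (b l)" by metis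
    \<comment> \<open>With rational coefficients the equation for \<open>i = 0\<close> contradicts
      independence, as the coefficient at \<open>k\<close> is 1.\<close>
    have "(\<Sum>l\<in>I. emb (b l) * x l) = 0" using e_sum[of 0] b Suc.hyps(2) by simp
    then have "b k = 0" using Suc.prems unfolding fq_indep_def by blast
    then show False using b Suc.prems nz by (auto simp: e_def)
  qed
qed

text \<open>The right-hand side becomes the column of a further unknown \<open>None\<close>, which
  gives \<open>card I\<close> homogeneous equations in one more unknown. In a nontrivial solution
  this unknown is nonzero, since otherwise Moore's criterion would kill all the others.\<close>

lemma moore_solve:
  assumes "finite I" "fq_indep x I"
  shows "\<exists>c. \<forall>i<card I. (\<Sum>k\<in>I. c k * x k ^ (q ^ i)) = s i"
proof -
  let ?J = "insert None (Some ` I)"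
  have "card ?J = Suc (card I)" using assms by (simp add: card_image)
  then obtain c where c: "\<exists>k\<in>?J. c k \<noteq> 0"
    "\<forall>i<card I. (\<Sum>k\<in>?J. (case k of None \<Rightarrow> - s i | Some k \<Rightarrow> x k ^ (q ^ i)) * c k) = 0"
    using underdetermined_system[of ?J "card I"
        "\<lambda>i k. case k of None \<Rightarrow> - s i | Some k \<Rightarrow> x k ^ (q ^ i)"] assms by auto
  have eq: "(\<Sum>k\<in>I. c (Some k) * x k ^ (q ^ i)) = s i * c None" if "i < card I" for i
    using c(2)[rule_format, OF that] assms by (simp add: sum.reindex mult.commute)
  have "c None \<noteq> 0"
  proof
    assume z: "c None = 0"
    then have "c (Some k) = 0" if "k \<in> I" for k
      using moore[OF assms, of "\<lambda>k. c (Some k)"] eq that by simp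
    then show False using c(1) z by auto
  qed
  moreover have "(\<Sum>k\<in>I. (c (Some k) / c None) * x k ^ (q ^ i)) =
      (\<Sum>k\<in>I. c (Some k) * x k ^ (q ^ i)) / c None" for i
    by (simp add: sum_divide_distrib)
  ultimately show ?thesis using eq by (intro exI[of _ "\<lambda>k. c (Some k) / c None"]) simp
qed

text \<open>With \<open>x\<close> and \<open>y\<close> as the two halves of a point in hyperbolic
  coordinates, this is the bilinear form between the point and its \<open>i\<close>-th Frobenius
  twist; for \<open>i = 0\<close> it is twice the quadratic form.\<close>

definition polar :: "'i set \<Rightarrow> ('i \<Rightarrow> 'k) \<Rightarrow> ('i \<Rightarrow> 'k) \<Rightarrow> nat \<Rightarrow> 'k" where
  "polar I x y i = (\<Sum>k\<in>I. x k * y k ^ (q ^ i) + x k ^ (q ^ i) * y k)"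

lemma polar_shift:
  assumes "polar I x y i = 0"
  shows "(\<Sum>k\<in>I. x k ^ (q ^ j) * y k ^ (q ^ (i + j)) + x k ^ (q ^ (i + j)) * y k ^ (q ^ j)) = 0"
proof -
  have "polar I x y i ^ (q ^ j) = 0" using assms q_pos by simp
  then show ?thesis unfolding polar_def frob_sum frob_add power_mult_distrib frob_frob by simp
qed

text \<open>Inserting \<open>y = C x\<close> and its twists, the form between the twists
  \<open>i\<close> and \<open>i'\<close> of the point becomes the value of the matrix C + C^T on two
  twists of \<open>x\<close>. All these values vanish, and Moore's criterion on both sides leaves C
  + C^T = 0.\<close>

lemma skew_of_polar:
  assumes I: "finite I" "fq_indep x I" and B: "\<forall>i<card I. polar I x y i = 0"
    and c: "\<And>j i. j \<in> I \<Longrightarrow> i < card I \<Longrightarrow> (\<Sum>k\<in>I. c j k * x k ^ (q ^ i)) = y j ^ (q ^ i)"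
    and jk: "j \<in> I" "k \<in> I"
  shows "c j k + c k j = 0"
proof -
  \<comment> \<open>The smaller exponent is pulled out as a Frobenius power; what remains is a
    hypothesis at the difference of the exponents.\<close>
  have polar0: "(\<Sum>l\<in>I. x l ^ (q ^ i) * y l ^ (q ^ i') + x l ^ (q ^ i') * y l ^ (q ^ i)) = 0"
    if "i < card I" "i' < card I" for i i'
  proof (cases "i \<le> i'")
    case True
    then show ?thesis using polar_shift[of I x y "i' - i" i] B that by simp
  next
    case False
    then show ?thesis using polar_shift[of I x y "i - i'" i'] B that by (simp add: add.commute)
  qed
  have "(\<Sum>k\<in>I. (\<Sum>j\<in>I. (c j k + c k j) * x j ^ (q ^ i)) * x k ^ (q ^ i')) = 0"
    if ii: "i < card I" "i' < card I" for i i'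
  proof -
    have "(\<Sum>k\<in>I. (\<Sum>j\<in>I. (c j k + c k j) * x j ^ (q ^ i)) * x k ^ (q ^ i')) =
        (\<Sum>k\<in>I. \<Sum>j\<in>I. c j k * x k ^ (q ^ i') * x j ^ (q ^ i)) +
        (\<Sum>k\<in>I. \<Sum>j\<in>I. c k j * x j ^ (q ^ i) * x k ^ (q ^ i'))"
      by (simp add: sum_distrib_left sum_distrib_right algebra_simps sum.distrib)
    also have "(\<Sum>k\<in>I. \<Sum>j\<in>I. c j k * x k ^ (q ^ i') * x j ^ (q ^ i)) =
        (\<Sum>j\<in>I. (\<Sum>k\<in>I. c j k * x k ^ (q ^ i')) * x j ^ (q ^ i))"
      by (subst sum.swap) (simp add: sum_distrib_right)
    also have "\<dots> = (\<Sum>j\<in>I. y j ^ (q ^ i') * x j ^ (q ^ i))"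
      by (intro sum.cong refl) (simp add: c ii)
    also have "(\<Sum>k\<in>I. \<Sum>j\<in>I. c k j * x j ^ (q ^ i) * x k ^ (q ^ i')) =
        (\<Sum>k\<in>I. (\<Sum>j\<in>I. c k j * x j ^ (q ^ i)) * x k ^ (q ^ i'))"
      by (simp add: sum_distrib_right)
    also have "\<dots> = (\<Sum>k\<in>I. y k ^ (q ^ i) * x k ^ (q ^ i'))"
      by (intro sum.cong refl) (simp add: c ii)
    finally show ?thesis
      using polar0[OF ii] by (simp add: sum.distrib[symmetric] mult.commute)
  qed
  \<comment> \<open>Moore's criterion is used in \<open>k\<close> with \<open>i'\<close> varying,
    and afterwards in \<open>j\<close> with \<open>i\<close> varying.\<close>
  then have "(\<Sum>j\<in>I. (c j k + c k j) * x j ^ (q ^ i)) = 0" if "i < card I" "k \<in> I" for i k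
    using moore[OF I, of "\<lambda>k. \<Sum>j\<in>I. (c j k + c k j) * x j ^ (q ^ i)"] that by blast
  then show ?thesis
    using moore[OF I, of "\<lambda>j. c j k + c k j"] jk by blast
qed

text \<open>
  The matrix \<open>c - c^q\<close> is alternating and kills the vectors \<open>x^(q^i)\<close> for \<open>1 \<le> i < card I\<close>. So
  each of its rows has a zero on the diagonal and \<open>card I - 1\<close> further entries, which vanish by Moore's
  criterion.
\<close>

lemma skew_rational:
  assumes I: "finite I" "fq_indep x I"
    and c: "\<And>j i. j \<in> I \<Longrightarrow> i < card I \<Longrightarrow> (\<Sum>k\<in>I. c j k * x k ^ (q ^ i)) = y j ^ (q ^ i)"
    and skew: "\<And>j k. j \<in> I \<Longrightarrow> k \<in> I \<Longrightarrow> c j k + c k j = 0"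
    and jk: "j \<in> I" "k \<in> I"
  shows "c j k ^ q = c j k"
proof -
  \<comment> \<open>Odd characteristic makes a skew-symmetric matrix alternating.\<close>
  have diag: "c l l = 0" if "l \<in> I" for l
    using skew[OF that that] two_neq_0 by (simp add: mult_2[symmetric])
  let ?J = "I - {j}"
  have "c j l - c j l ^ q = 0" if "l \<in> ?J" for l
  proof (rule moore[of ?J "\<lambda>k. x k ^ q" "\<lambda>l. c j l - c j l ^ q"])
    show "finite ?J" "fq_indep (\<lambda>k. x k ^ q) ?J" "l \<in> ?J"
      using I that by (auto intro!: fq_indep_frob intro: fq_indep_subset)
    show "\<forall>i<card ?J. (\<Sum>k\<in>?J. (c j k - c j k ^ q) * (x k ^ q) ^ (q ^ i)) = 0"
    proof (intro allI impI)
      fix i assume "i < card ?J"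
      then have i: "Suc i < card I" using I jk by simp
      have pw: "(x l ^ q) ^ (q ^ i) = x l ^ (q ^ Suc i)" for l
        by (simp add: power_mult)
      have "(\<Sum>k\<in>?J. (c j k - c j k ^ q) * (x k ^ q) ^ (q ^ i)) =
          (\<Sum>k\<in>I. (c j k - c j k ^ q) * x k ^ (q ^ Suc i))"
        using I diag jk q_pos unfolding pw by (intro sum.mono_neutral_left) auto
      also have "\<dots> = (\<Sum>k\<in>I. c j k * x k ^ (q ^ Suc i)) - (\<Sum>k\<in>I. (c j k * x k ^ (q ^ i)) ^ (q ^ 1))"
        unfolding power_mult_distrib frob_frob by (simp add: algebra_simps sum_subtractf)
      also have "\<dots> = (\<Sum>k\<in>I. c j k * x k ^ (q ^ Suc i)) - (\<Sum>k\<in>I. c j k * x k ^ (q ^ i)) ^ (q ^ 1)"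
        by (simp only: frob_sum)
      also have "\<dots> = 0" using c[OF jk(1), of i] c[OF jk(1), of "Suc i"] i
        by (simp add: power_mult[symmetric] mult.commute)
      finally show "(\<Sum>k\<in>?J. (c j k - c j k ^ q) * (x k ^ q) ^ (q ^ i)) = 0" .
    qed
  qed
  then show ?thesis using jk diag q_pos by (cases "k = j") auto
qed

text \<open>
  If the \<open>x k\<close> are independent over \<open>F\<^sub>q\<close>, then \<open>y\<close> is the image of \<open>x\<close> under an alternating matrix
  over \<open>F\<^sub>q\<close>; otherwise a rational change of coordinates removes one hyperbolic pair. This is where
  the plus type of the form enters.
\<close>

lemma polar_eq_0:
  assumes "finite I" "\<forall>i<card I. polar I x y i = 0"
  shows "polar I x y i = 0"
  using assms
proof (induction "card I" arbitrary: I x y)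
  case 0
  then show ?case by (simp add: polar_def)
next
  case (Suc n)
  show ?case
  proof (cases "fq_indep x I")
    case True
    have "\<exists>c. \<forall>i<card I. (\<Sum>k\<in>I. c k * x k ^ (q ^ i)) = y j ^ (q ^ i)" for j
      by (rule moore_solve) (use Suc.prems True in auto)
    then obtain c where c: "\<And>j i. i < card I \<Longrightarrow> (\<Sum>k\<in>I. c j k * x k ^ (q ^ i)) = y j ^ (q ^ i)"
      by metis
    have skew: "c j k + c k j = 0" if "j \<in> I" "k \<in> I" for j k
      using skew_of_polar[OF Suc.prems(1) True Suc.prems(2)] c that by blast
    have "c j k ^ q = c j k" if "j \<in> I" "k \<in> I" for j k
      using skew_rational[OF Suc.prems(1) True] c skew that by blast
    then have rat: "c j k ^ (q ^ i) = c j k" if "j \<in> I" "k \<in> I" for j k i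
      using that frob_fixed frob_emb by metis
    have y: "y j = (\<Sum>k\<in>I. c j k * x k)" for j
      using c[of 0 j] Suc.hyps(2) by simp
    \<comment> \<open>Rationality of \<open>c\<close> extends the relation between \<open>y\<close>
      and \<open>x\<close> to every Frobenius twist, beyond \<open>i < card I\<close>.\<close>
    have yi: "y j ^ (q ^ i) = (\<Sum>k\<in>I. c j k * x k ^ (q ^ i))" if "j \<in> I" for j
      unfolding y frob_sum power_mult_distrib using rat that by (intro sum.cong) auto
    have "polar I x y i = (\<Sum>j\<in>I. \<Sum>k\<in>I. c j k * x j * x k ^ (q ^ i)) +
        (\<Sum>j\<in>I. \<Sum>k\<in>I. c j k * x j ^ (q ^ i) * x k)"
      unfolding polar_def sum.distrib
      by (intro arg_cong2[of _ _ _ _ "(+)"] sum.cong refl)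
        (simp_all only: yi, simp_all add: y sum_distrib_left mult_ac)
    also have "(\<Sum>j\<in>I. \<Sum>k\<in>I. c j k * x j ^ (q ^ i) * x k) =
        (\<Sum>j\<in>I. \<Sum>k\<in>I. c k j * x j * x k ^ (q ^ i))"
      by (subst sum.swap) (simp add: mult_ac)
    also have "(\<Sum>j\<in>I. \<Sum>k\<in>I. c j k * x j * x k ^ (q ^ i)) + \<dots> =
        (\<Sum>j\<in>I. \<Sum>k\<in>I. (c j k + c k j) * x j * x k ^ (q ^ i))"
      by (simp add: sum.distrib[symmetric] algebra_simps)
    also have "\<dots> = 0" using skew by simp
    finally show ?thesis .
  next
    case False
    then obtain a j where a: "(\<Sum>k\<in>I. emb (a k) * x k) = 0" and j: "j \<in> I" "a j \<noteq> 0"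
      unfolding fq_indep_def by auto
    let ?J = "I - {j}"
    define b where "b k = - a k / a j" for k
    have xj: "x j = (\<Sum>k\<in>?J. emb (b k) * x k)"
    proof -
      have "emb (a j) * x j + (\<Sum>k\<in>?J. emb (a k) * x k) = 0"
        using a j Suc.prems by (simp add: sum.remove)
      moreover have "emb (a j) * emb (b k) = - emb (a k)" for k
        using j by (simp add: b_def hom_mult[symmetric] hom_uminus[symmetric])
      then have "emb (a j) * (\<Sum>k\<in>?J. emb (b k) * x k) = - (\<Sum>k\<in>?J. emb (a k) * x k)"
        by (simp add: sum_distrib_left mult.assoc[symmetric] sum_negf)
      ultimately have "emb (a j) * x j = emb (a j) * (\<Sum>k\<in>?J. emb (b k) * x k)"
        by (metis add_eq_0_iff2)
      then show ?thesis using j by simp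
    qed
    \<comment> \<open>Dual change of coordinates: after the relation for \<open>x j\<close> is
      substituted, each remaining \<open>x k\<close> is paired with \<open>y k\<close> plus its
      share of \<open>y j\<close>.\<close>
    let ?y = "\<lambda>k. y k + emb (b k) * y j"
    have red: "polar I x y i = polar ?J x ?y i" for i
    proof -
      have "polar I x y i = x j * y j ^ (q ^ i) + x j ^ (q ^ i) * y j + polar ?J x y i"
        unfolding polar_def by (rule sum.remove[OF Suc.prems(1) j(1)])
      also have "x j * y j ^ (q ^ i) = (\<Sum>k\<in>?J. x k * (emb (b k) * y j) ^ (q ^ i))"
        unfolding xj sum_distrib_right
        by (intro sum.cong refl) (simp add: power_mult_distrib frob_emb mult_ac)
      also have "x j ^ (q ^ i) * y j = (\<Sum>k\<in>?J. x k ^ (q ^ i) * (emb (b k) * y j))"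
        unfolding xj frob_sum sum_distrib_right
        by (intro sum.cong refl) (simp add: power_mult_distrib frob_emb mult_ac)
      also have "(\<Sum>k\<in>?J. x k * (emb (b k) * y j) ^ (q ^ i)) +
          (\<Sum>k\<in>?J. x k ^ (q ^ i) * (emb (b k) * y j)) + polar ?J x y i = polar ?J x ?y i"
        unfolding polar_def sum.distrib[symmetric] frob_add
        by (intro sum.cong refl) (simp add: algebra_simps)
      finally show ?thesis .
    qed
    have "n = card ?J" using Suc.hyps Suc.prems j by simp
    moreover have "\<forall>i<card ?J. polar ?J x ?y i = 0"
      using Suc.prems Suc.hyps(2) j by (simp add: red[symmetric])
    ultimately show ?thesis unfolding red using Suc.hyps(1)[of ?J x ?y] Suc.prems(1) by simp
  qed
qed

end

section \<open>Counting isotropic covectors\<close>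

text \<open>Coefficient rows are functions on \<open>nat\<close> that vanish off \<open>I\<close>,
  so that equality of rows is equality of functions and, over a finite field, a finite
  \<open>I\<close> leaves finitely many rows.\<close>

definition vecs :: "nat set \<Rightarrow> (nat \<Rightarrow> 'a::zero) set" where
  "vecs I = {c. \<forall>k. k \<notin> I \<longrightarrow> c k = 0}"

text \<open>In the numbering of the basis, y_i and x_i have the indices \<open>m - i\<close> and
  \<open>m + i - 1\<close>, which add up to \<open>2 * m - 1\<close>. This is therefore
  \<open>\<xi>\<^sub>1\<close> at a point; the same formula gives the dual form on coefficient
  rows.\<close>

definition qform :: "nat \<Rightarrow> (nat \<Rightarrow> 'a::comm_ring_1) \<Rightarrow> 'a" where
  "qform m c = (\<Sum>k<m. c k * c (2 * m - 1 - k))"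

definition bform :: "nat \<Rightarrow> (nat \<Rightarrow> 'a::comm_ring_1) \<Rightarrow> (nat \<Rightarrow> 'a) \<Rightarrow> 'a" where
  "bform m c d = (\<Sum>k<2 * m. c k * d (2 * m - 1 - k))"

text \<open>Normal form of a projective point. The leading position also identifies the unipotent
  orbit, since row \<open>k\<close> of an upper unitriangular matrix is monic at
  \<open>k\<close>.\<close>

definition monic_at :: "nat \<Rightarrow> (nat \<Rightarrow> 'a::zero_neq_one) \<Rightarrow> bool" where
  "monic_at k c \<longleftrightarrow> c k = 1 \<and> (\<forall>j<k. c j = 0)"

definition iso_pts :: "nat \<Rightarrow> (nat \<Rightarrow> 'a::comm_ring_1) set" where
  "iso_pts m = {c \<in> vecs {..<2 * m}. qform m c = 0 \<and> (\<exists>k<2 * m. monic_at k c)}"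

lemma sum_lessThan_double:
  fixes f :: "nat \<Rightarrow> 'b::comm_monoid_add"
  shows "(\<Sum>k<2 * m. f k) = (\<Sum>k<m. f k + f (2 * m - 1 - k))"
proof -
  have "{..<2 * m} = {..<m} \<union> {m..<2 * m}" by auto
  then have "(\<Sum>k<2 * m. f k) = (\<Sum>k<m. f k) + (\<Sum>k\<in>{m..<2 * m}. f k)"
    by (simp add: sum.union_disjoint ivl_disj_int)
  also have "(\<Sum>k\<in>{m..<2 * m}. f k) = (\<Sum>k<m. f (2 * m - 1 - k))"
    by (rule sum.reindex_bij_witness[of _ "\<lambda>k. 2 * m - 1 - k" "\<lambda>k. 2 * m - 1 - k"]) auto
  finally show ?thesis by (simp add: sum.distrib)
qed

lemma sum_flip:
  fixes f :: "nat \<Rightarrow> 'b::comm_monoid_add"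
  shows "(\<Sum>k<2 * m. f (2 * m - 1 - k)) = (\<Sum>k<2 * m. f k)"
  by (rule sum.reindex_bij_witness[of _ "\<lambda>k. 2 * m - 1 - k" "\<lambda>k. 2 * m - 1 - k"]) auto

lemma bform_commute: "bform m c d = bform m d c"
proof -
  have "bform m c d = (\<Sum>k<2 * m. c (2 * m - 1 - k) * d (2 * m - 1 - (2 * m - 1 - k)))"
    unfolding bform_def by (rule sum_flip[symmetric])
  also have "\<dots> = bform m d c"
    unfolding bform_def by (intro sum.cong) (auto simp: mult.commute)
  finally show ?thesis .
qed

lemma bform_self: "bform m c c = 2 * qform m c"
  unfolding bform_def qform_def sum_lessThan_double sum_distrib_left
  by (intro sum.cong) (auto simp: algebra_simps)

lemma bform_add_left: "bform m (\<lambda>k. c k + t * d k) e = bform m c e + t * bform m d e"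
  by (simp add: bform_def algebra_simps sum.distrib sum_distrib_left)

lemma qform_add: "qform m (\<lambda>k. c k + t * d k) = qform m c + t * bform m c d + t ^ 2 * qform m d"
  unfolding bform_def qform_def sum_lessThan_double sum_distrib_left sum.distrib[symmetric]
  by (intro sum.cong) (auto simp: algebra_simps power2_eq_square)

lemma qform_scale: "qform m (\<lambda>k. t * c k) = t ^ 2 * qform m c"
  unfolding qform_def sum_distrib_left by (intro sum.cong) (auto simp: algebra_simps power2_eq_square)

lemma card_vecs: "finite I \<Longrightarrow> card (vecs I :: (nat \<Rightarrow> 'a::{zero,finite}) set) = CARD('a) ^ card I"
proof (induction I rule: finite_induct)
  case empty
  have "vecs {} = {\<lambda>_. 0 :: 'a}" by (auto simp: vecs_def)
  then show ?case by simp
next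
  case (insert k I)
  have "bij_betw (\<lambda>(a, c). c(k := a)) (UNIV \<times> vecs I) (vecs (insert k I) :: (nat \<Rightarrow> 'a) set)"
    using insert.hyps
    by (intro bij_betw_byWitness[where f' = "\<lambda>c. (c k, c(k := 0))"]) (auto simp: vecs_def)
  then have "card (vecs (insert k I) :: (nat \<Rightarrow> 'a) set) = card ((UNIV :: 'a set) \<times> (vecs I :: (nat \<Rightarrow> 'a) set))"
    by (rule bij_betw_same_card[symmetric])
  then show ?case using insert by (simp add: card_cartesian_product)
qed

lemma finite_vecs: "finite I \<Longrightarrow> finite (vecs I :: (nat \<Rightarrow> 'a::{zero,finite}) set)"
  using card_vecs[of I, where ?'a = 'a] by (intro card_ge_0_finite) (simp add: card_gt_0_iff)

lemma monic_at_scale_inj: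
  fixes c d :: "nat \<Rightarrow> 'a::field"
  assumes "monic_at k c" "monic_at l d" "t \<noteq> 0" "s \<noteq> 0" "\<And>i. t * c i = s * d i"
  shows "k = l \<and> t = s \<and> c = d"
proof -
  have "k = l"
  proof (rule ccontr)
    assume "k \<noteq> l"
    then consider "k < l" | "l < k" by linarith
    then show False
      using assms(5)[of k] assms(5)[of l] assms(1-4) by cases (auto simp: monic_at_def)
  qed
  moreover from this have "t = s" using assms(5)[of k] assms(1,2) by (simp add: monic_at_def)
  ultimately show ?thesis using assms by auto
qed

lemma ex_monic_scale:
  fixes c :: "nat \<Rightarrow> 'a::field"
  assumes "c k \<noteq> 0"
  shows "\<exists>l\<le>k. \<exists>t. t \<noteq> 0 \<and> monic_at l (\<lambda>i. c i / t)"
proof -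
  define l where "l = (LEAST i. c i \<noteq> 0)"
  have "c l \<noteq> 0" unfolding l_def using assms by (rule LeastI)
  moreover have "l \<le> k" unfolding l_def using assms by (rule Least_le)
  moreover have "c i = 0" if "i < l" for i using not_less_Least that unfolding l_def by blast
  ultimately show ?thesis by (auto simp: monic_at_def intro!: exI[of _ l] exI[of _ "c l"])
qed

text \<open>Every isotropic line has one monic representative and \<open>CARD('a) - 1\<close>
  nonzero vectors. The set \<open>V\<close> stands for a condition on lines, later that of not
  vanishing at a point.\<close>

lemma card_scaled_iso_pts:
  fixes V :: "(nat \<Rightarrow> 'a::{field,finite}) set"
  assumes V: "\<And>c t. t \<noteq> 0 \<Longrightarrow> (\<lambda>k. t * c k) \<in> V \<longleftrightarrow> c \<in> V"
  shows "card {c \<in> vecs {..<2 * m}. qform m c = 0 \<and> c \<noteq> (\<lambda>_. 0) \<and> c \<in> V} =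
    card {c \<in> iso_pts m. c \<in> V} * (CARD('a) - 1)"
proof -
  let ?A = "{c \<in> iso_pts m. c \<in> V} \<times> (UNIV - {0 :: 'a})"
  let ?B = "{c \<in> vecs {..<2 * m}. qform m c = 0 \<and> c \<noteq> (\<lambda>_. 0) \<and> c \<in> V}"
  let ?f = "\<lambda>(c, t) k. t * c k :: 'a"
  have inj: "inj_on ?f ?A"
  proof (rule inj_onI)
    fix x y assume xy: "x \<in> ?A" "y \<in> ?A" "?f x = ?f y"
    obtain c t d s where x: "x = (c, t)" and y: "y = (d, s)" by (cases x, cases y)
    obtain k l where kl: "monic_at k c" "monic_at l d" using xy by (auto simp: x y iso_pts_def)
    have "t * c i = s * d i" for i using fun_cong[OF xy(3), of i] by (simp add: x y)
    then show "x = y"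
      using monic_at_scale_inj[OF kl, of t s] xy(1,2) by (simp add: x y)
  qed
  have img: "?f ` ?A = ?B"
  proof
    show "?f ` ?A \<subseteq> ?B"
    proof
      fix d assume "d \<in> ?f ` ?A"
      then obtain c t where c: "c \<in> iso_pts m" "c \<in> V" "t \<noteq> 0" and d: "d = (\<lambda>k. t * c k)" by auto
      then obtain k where k: "c k = 1" by (auto simp: iso_pts_def monic_at_def)
      then have "d k \<noteq> 0" using c d by simp
      then have "d \<noteq> (\<lambda>_. 0)" by auto
      moreover have "d \<in> V" using V c d by simp
      ultimately show "d \<in> ?B" using c by (auto simp: d iso_pts_def vecs_def qform_scale)
    qed
    show "?B \<subseteq> ?f ` ?A"
    proof
      fix d assume d: "d \<in> ?B"
      then obtain k where k: "d k \<noteq> 0" by auto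
      with d have "k < 2 * m" by (metis (mono_tags, lifting) lessThan_iff mem_Collect_eq vecs_def)
      with ex_monic_scale[of d k, OF k] obtain l t where l: "l < 2 * m" "t \<noteq> 0" "monic_at l (\<lambda>i. d i / t)"
        by (meson le_less_trans)
      let ?c = "\<lambda>i. d i / t"
      have dc: "d = (\<lambda>k. t * ?c k)" using l by auto
      have "qform m d = t ^ 2 * qform m ?c" by (subst dc) (rule qform_scale)
      then have "qform m ?c = 0" using d l by auto
      moreover have "?c \<in> V" using V[of t ?c] dc d l by simp
      ultimately have "?c \<in> iso_pts m" "?c \<in> V" using d l by (auto simp: iso_pts_def vecs_def)
      then show "d \<in> ?f ` ?A" using l by (intro image_eqI[of _ _ "(?c, t)"]) auto
    qed
  qed
  have "card ?B = card ?A" unfolding img[symmetric] by (rule card_image[OF inj])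
  then show ?thesis by (simp add: card_cartesian_product card_Diff_singleton)
qed

text \<open>Multiplying by \<open>q - 1\<close> telescopes the geometric sum, and the further factor
  \<open>q\<close> avoids a division in the count of isotropic points. The bound on \<open>e\<close>
  keeps the truncated exponents exact.\<close>

lemma e_exp_mult:
  assumes "e < 2 * m" "0 < q"
  shows "e_exp q e m * (q - 1) * q = q ^ (2 * m) - q ^ (2 * m - e)"
  using assms(1)
proof (induction e)
  case 0
  then show ?case by (simp add: e_exp_def)
next
  case (Suc e)
  let ?n = "2 * m - Suc e"
  have n: "2 * m - e = Suc ?n" "2 * m - 1 - Suc e = ?n - 1" "q ^ ?n = q ^ (?n - 1) * q"
    using Suc.prems by (auto simp: power_eq_if)
  have "e_exp q (Suc e) m = e_exp q e m + q ^ (?n - 1)"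
    by (simp add: e_exp_def)
  then have "e_exp q (Suc e) m * (q - 1) * q = q ^ (2 * m) - q ^ Suc ?n + q ^ ?n * (q - 1)"
    using Suc n by (simp add: algebra_simps)
  also have "q ^ ?n * (q - 1) = q ^ Suc ?n - q ^ ?n" by (simp add: algebra_simps)
  also have "q ^ (2 * m) - q ^ Suc ?n + (q ^ Suc ?n - q ^ ?n) = q ^ (2 * m) - q ^ ?n"
  proof -
    have "q ^ Suc ?n \<le> q ^ (2 * m)" using Suc.prems assms(2) by (intro power_increasing) auto
    moreover have "q ^ ?n \<le> q ^ Suc ?n" using assms(2) by (intro power_increasing) auto
    ultimately show ?thesis by simp
  qed
  finally show ?case .
qed

section \<open>Linear forms at a point, and the span of its coordinates\<close>

context fq_algebra
begin

definition val :: "nat \<Rightarrow> (nat \<Rightarrow> 'k) \<Rightarrow> (nat \<Rightarrow> 'a) \<Rightarrow> 'k" where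
  "val m v c = (\<Sum>k<2 * m. emb (c k) * v k)"

text \<open>Coordinates are added greedily. A basis taken from the coordinates themselves makes the
  coefficient matrix the identity on \<open>J\<close>, which \<open>u_J\<close> exploits.\<close>

lemma ex_fq_basis:
  assumes "finite I"
  shows "\<exists>J\<subseteq>I. fq_indep v J \<and> (\<forall>k\<in>I. \<exists>a. v k = (\<Sum>j\<in>J. emb (a j) * v j))"
  using assms
proof (induction I rule: finite_induct)
  case empty
  then show ?case by (auto simp: fq_indep_def)
next
  case (insert k I)
  then obtain J where J: "J \<subseteq> I" "fq_indep v J" "\<forall>k\<in>I. \<exists>a. v k = (\<Sum>j\<in>J. emb (a j) * v j)"
    by auto
  show ?case
  proof (cases "\<exists>a. v k = (\<Sum>j\<in>J. emb (a j) * v j)")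
    case True
    then show ?thesis using J by (intro exI[of _ J]) auto
  next
    case False
    have fin: "finite J" and nJ: "k \<notin> J" using J insert.hyps finite_subset by auto
    have "fq_indep v (insert k J)"
      unfolding fq_indep_def
    proof (intro allI impI)
      fix a assume "(\<Sum>l\<in>insert k J. emb (a l) * v l) = 0"
      then have eq: "emb (a k) * v k = - (\<Sum>l\<in>J. emb (a l) * v l)"
        using fin nJ by (simp add: add_eq_0_iff2)
      have "a k = 0"
      proof (rule ccontr)
        assume nz: "a k \<noteq> 0"
        have "v k = emb (inverse (a k)) * (emb (a k) * v k)"
          using nz by (simp add: mult.assoc[symmetric] hom_mult[symmetric])
        also have "\<dots> = (\<Sum>l\<in>J. emb (- inverse (a k) * a l) * v l)"
          unfolding eq by (simp add: sum_distrib_left hom_distribs sum_negf mult_ac)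
        finally have "\<exists>a. v k = (\<Sum>j\<in>J. emb (a j) * v j)"
          by (rule exI[of _ "\<lambda>l. - inverse (a k) * a l"])
        then show False using False by simp
      qed
      moreover from this have "\<forall>l\<in>J. a l = 0"
        using eq J(2) unfolding fq_indep_def by simp
      ultimately show "\<forall>l\<in>insert k J. a l = 0" by simp
    qed
    moreover have "\<exists>a. v l = (\<Sum>j\<in>insert k J. emb (a j) * v j)" if l: "l \<in> insert k I" for l
    proof (cases "l = k")
      case True
      have "(\<Sum>j\<in>J. emb (if j = k then 1 else 0) * v j) = 0"
        using nJ by (intro sum.neutral) auto
      then show ?thesis
        using fin nJ True by (intro exI[of _ "\<lambda>j. if j = k then 1 else 0"]) simp
    next
      case False
      then obtain a where a: "v l = (\<Sum>j\<in>J. emb (a j) * v j)" using J(3) l by auto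
      have "(\<Sum>j\<in>J. emb ((a(k := 0)) j) * v j) = (\<Sum>j\<in>J. emb (a j) * v j)"
        using nJ by (intro sum.cong) auto
      then show ?thesis using fin nJ a by (intro exI[of _ "a(k := 0)"]) simp
    qed
    ultimately show ?thesis using J(1) by (intro exI[of _ "insert k J"]) blast
  qed
qed

end

text \<open>Records \<open>v\<close> as a combination of rational vectors \<open>u j\<close> with
  independent coefficients \<open>v j\<close>, for \<open>j \<in> J\<close>. Orthogonality to all
  Frobenius twists makes the span of the \<open>u j\<close> totally isotropic.\<close>

locale isotropic_point = fq_field emb p r q for emb :: "'a::{field,finite} \<Rightarrow> 'k::field" and p r q +
  fixes m :: nat and v :: "nat \<Rightarrow> 'k" and J :: "nat set" and u :: "nat \<Rightarrow> nat \<Rightarrow> 'a"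
  assumes iso: "\<And>i. bform m v (\<lambda>k. v k ^ (q ^ i)) = 0"
    and J: "J \<subseteq> {..<2 * m}" "fq_indep v J"
    and u: "\<And>k. k < 2 * m \<Longrightarrow> v k = (\<Sum>j\<in>J. emb (u j k) * v j)"
begin

lemma finite_J: "finite J"
  using J(1) finite_subset by blast

text \<open>The vector \<open>u j\<close> with its entries reversed: paired by \<open>bform\<close>
  with a coefficient row, it evaluates that row at \<open>u j\<close>.\<close>

definition w :: "nat \<Rightarrow> nat \<Rightarrow> 'a" where
  "w j k = (if k < 2 * m then u j (2 * m - 1 - k) else 0)"

lemma indep_coeffs_eq:
  assumes "(\<Sum>j\<in>J. emb (a j) * v j) = (\<Sum>j\<in>J. emb (b j) * v j)" "j \<in> J"
  shows "a j = b j"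
proof -
  have "(\<Sum>j\<in>J. emb (a j - b j) * v j) = 0"
    using assms(1) by (simp add: hom_distribs left_diff_distrib sum_subtractf)
  then have "\<forall>j\<in>J. a j - b j = 0"
    using J(2)[unfolded fq_indep_def, rule_format, of "\<lambda>j. a j - b j"] by blast
  then show ?thesis using assms(2) by auto
qed

lemma u_J: "j \<in> J \<Longrightarrow> l \<in> J \<Longrightarrow> u j l = (if j = l then 1 else 0)"
proof (rule indep_coeffs_eq[of "\<lambda>j. u j l" "\<lambda>j. if j = l then 1 else 0"])
  assume "l \<in> J"
  have "(\<Sum>j\<in>J. emb (if j = l then 1 else 0) * v j) = (\<Sum>j\<in>J. if j = l then v j else 0)"
    by (intro sum.cong) auto
  also have "\<dots> = v l" using \<open>l \<in> J\<close> finite_J by simp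
  finally show "(\<Sum>j\<in>J. emb (u j l) * v j) = (\<Sum>j\<in>J. emb (if j = l then 1 else 0) * v j)"
    using u[of l] \<open>l \<in> J\<close> J(1) by auto
qed

lemma bform_w: "bform m c (w j) = (\<Sum>k<2 * m. c k * u j k)"
  unfolding bform_def w_def by (intro sum.cong) auto

lemma val_eq: "val m v c = (\<Sum>j\<in>J. emb (bform m c (w j)) * v j)"
proof -
  have "val m v c = (\<Sum>k<2 * m. \<Sum>j\<in>J. emb (c k * u j k) * v j)"
    unfolding val_def by (intro sum.cong refl, subst u) (auto simp: sum_distrib_left hom_distribs mult_ac)
  also have "\<dots> = (\<Sum>j\<in>J. \<Sum>k<2 * m. emb (c k * u j k) * v j)" by (rule sum.swap)
  also have "\<dots> = (\<Sum>j\<in>J. emb (bform m c (w j)) * v j)"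
    unfolding bform_w hom_sum sum_distrib_right ..
  finally show ?thesis .
qed

lemma val_eq_0_iff: "val m v c = 0 \<longleftrightarrow> (\<forall>j\<in>J. bform m c (w j) = 0)"
proof
  assume "val m v c = 0"
  then show "\<forall>j\<in>J. bform m c (w j) = 0"
    using J(2)[unfolded fq_indep_def, rule_format, of "\<lambda>j. bform m c (w j)"] val_eq by metis
qed (simp add: val_eq)

text \<open>Expanding the orthogonality to twist \<open>i\<close> gives the sum of the terms
  \<open>emb (s j l) * v j * v l ^ (q ^ i)\<close>, with \<open>s\<close> the transposed Gram matrix
  of the \<open>w j\<close>. Moore's criterion removes the twisted factors, independence the
  others.\<close>

lemma bform_w_w: "j \<in> J \<Longrightarrow> l \<in> J \<Longrightarrow> bform m (w j) (w l) = 0"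
proof -
  assume jl: "j \<in> J" "l \<in> J"
  define s where "s j l = (\<Sum>k<2 * m. u j k * u l (2 * m - 1 - k))" for j l
  have s: "bform m (w j) (w l) = s l j" for j l
    unfolding bform_w s_def w_def by (intro sum.cong) (auto simp: mult.commute)
  have "(\<Sum>l\<in>J. (\<Sum>j\<in>J. emb (s j l) * v j) * v l ^ (q ^ i)) = 0" for i
  proof -
    have "0 = (\<Sum>k<2 * m. v k * v (2 * m - 1 - k) ^ (q ^ i))" using iso[of i] by (simp add: bform_def)
    also have "\<dots> = (\<Sum>k<2 * m. (\<Sum>j\<in>J. emb (u j k) * v j) *
        (\<Sum>l\<in>J. emb (u l (2 * m - 1 - k)) * v l ^ (q ^ i)))"
    proof (intro sum.cong refl)
      fix k assume k: "k \<in> {..<2 * m}"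
      then have k': "2 * m - 1 - k < 2 * m" by auto
      have "v (2 * m - 1 - k) ^ (q ^ i) = (\<Sum>l\<in>J. emb (u l (2 * m - 1 - k)) * v l ^ (q ^ i))"
        by (subst u[OF k']) (simp add: frob_sum power_mult_distrib frob_emb)
      then show "v k * v (2 * m - 1 - k) ^ (q ^ i) = (\<Sum>j\<in>J. emb (u j k) * v j) *
        (\<Sum>l\<in>J. emb (u l (2 * m - 1 - k)) * v l ^ (q ^ i))"
        using u[of k] k by simp
    qed
    also have "\<dots> = (\<Sum>k<2 * m. \<Sum>l\<in>J. \<Sum>j\<in>J. emb (u j k * u l (2 * m - 1 - k)) * v j * v l ^ (q ^ i))"
      by (intro sum.cong refl, subst sum.swap, unfold sum_product) (simp add: hom_distribs mult_ac)
    also have "\<dots> = (\<Sum>l\<in>J. \<Sum>j\<in>J. \<Sum>k<2 * m. emb (u j k * u l (2 * m - 1 - k)) * v j * v l ^ (q ^ i))"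
      by (subst sum.swap) (intro sum.cong refl sum.swap)
    also have "\<dots> = (\<Sum>l\<in>J. (\<Sum>j\<in>J. emb (s j l) * v j) * v l ^ (q ^ i))"
      unfolding s_def hom_sum sum_distrib_right ..
    finally show ?thesis by simp
  qed
  then have "(\<Sum>i\<in>J. emb (s i j) * v i) = 0"
    using moore[OF finite_J J(2), of "\<lambda>l. \<Sum>j\<in>J. emb (s j l) * v j"] jl by blast
  then have "s l j = 0"
    using J(2)[unfolded fq_indep_def, rule_format, of "\<lambda>i. s i j"] jl by blast
  then show ?thesis by (simp add: s)
qed

lemma qform_w: "j \<in> J \<Longrightarrow> qform m (w j) = 0"
proof -
  assume "j \<in> J"
  then have "emb (2 * qform m (w j)) = 0" using bform_w_w[of j j] by (simp add: bform_self)
  then show ?thesis using two_neq_0 by (simp add: hom_distribs)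
qed

text \<open>The equations are in reduced form: each \<open>j \<in> J\<close> occurs with coefficient
  1 in its own equation and in no other. The entries outside \<open>J\<close> are thus free and
  determine the rest.\<close>

lemma card_kernel: "card {c \<in> vecs {..<2 * m}. val m v c = 0} = q ^ (2 * m - card J)"
proof -
  let ?I = "{..<2 * m} - J"
  let ?L = "{c \<in> vecs {..<2 * m}. val m v c = 0}"
  have split: "bform m c (w j) = c j + (\<Sum>k\<in>?I. c k * u j k)" if "j \<in> J" for c j
  proof -
    have "bform m c (w j) = (\<Sum>k\<in>J. c k * u j k) + (\<Sum>k\<in>?I. c k * u j k)"
      unfolding bform_w using J(1) by (simp add: sum.subset_diff[of J "{..<2 * m}"] add.commute)
    also have "(\<Sum>k\<in>J. c k * u j k) = (\<Sum>k\<in>J. if j = k then c k else 0)"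
      by (intro sum.cong refl) (auto simp: u_J that)
    also have "\<dots> = c j" using that finite_J by simp
    finally show ?thesis .
  qed
  let ?f = "\<lambda>c k. if k \<in> J then 0 else c k :: 'a"
  let ?g = "\<lambda>c k. if k \<in> J then - (\<Sum>l\<in>?I. c l * u k l) else c k :: 'a"
  have L: "?L = {c \<in> vecs {..<2 * m}. \<forall>j\<in>J. c j = - (\<Sum>k\<in>?I. c k * u j k)}"
    using split by (auto simp: val_eq_0_iff add_eq_0_iff2)
  have "bij_betw ?f ?L (vecs ?I)"
  proof (rule bij_betw_byWitness[where f' = ?g])
    show "\<forall>c\<in>?L. ?g (?f c) = c"
      unfolding L by (auto simp: fun_eq_iff)
    show "\<forall>c\<in>vecs ?I. ?f (?g c) = c" by (auto simp: fun_eq_iff vecs_def)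
    show "?f ` ?L \<subseteq> vecs ?I" by (auto simp: vecs_def)
    show "?g ` vecs ?I \<subseteq> ?L" using J(1) unfolding L by (auto simp: vecs_def)
  qed
  then have "card ?L = card (vecs ?I :: (nat \<Rightarrow> 'a) set)" by (rule bij_betw_same_card)
  also have "\<dots> = q ^ (2 * m - card J)"
    using J(1) finite_J by (simp add: card_vecs q_card card_Diff_subset)
  finally show ?thesis .
qed

text \<open>The \<open>w j\<close> span \<open>q ^ card J\<close> rows, all contained in the
  orthogonal complement of that span, which is the kernel counted before.\<close>

lemma card_J_le: "card J \<le> m"
proof -
  let ?L = "{c \<in> vecs {..<2 * m}. val m v c = 0}"
  let ?f = "\<lambda>d k. \<Sum>j\<in>J. d j * w j k :: 'a"
  have f_w: "bform m (?f d) (w l) = 0" if "l \<in> J" for d l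
  proof -
    have "bform m (?f d) (w l) = (\<Sum>j\<in>J. d j * bform m (w j) (w l))"
      unfolding bform_def sum_distrib_left sum_distrib_right by (subst sum.swap) (simp add: mult_ac)
    then show ?thesis using bform_w_w that by simp
  qed
  have "inj_on ?f (vecs J)"
  proof (rule inj_onI)
    fix d e assume d: "d \<in> vecs J" "e \<in> vecs J" "?f d = ?f e"
    \<comment> \<open>The reversed position undoes the reversal in \<open>w\<close> and meets the
      identity block of \<open>u\<close>.\<close>
    have f_j: "?f d (2 * m - 1 - j) = d j" if j: "j \<in> J" for d j
    proof -
      have jm: "j < 2 * m" using j J(1) by auto
      then have "?f d (2 * m - 1 - j) = (\<Sum>l\<in>J. d l * u l j)"
        by (intro sum.cong refl) (auto simp: w_def)
      also have "\<dots> = (\<Sum>l\<in>J. if l = j then d l else 0)"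
        by (intro sum.cong refl) (auto simp: u_J j)
      also have "\<dots> = d j" using j finite_J by simp
      finally show ?thesis .
    qed
    show "d = e"
    proof
      fix j show "d j = e j"
        using d(1,2) f_j[of j d] f_j[of j e] fun_cong[OF d(3), of "2 * m - 1 - j"]
        by (cases "j \<in> J") (simp_all add: vecs_def)
    qed
  qed
  moreover have "?f ` vecs J \<subseteq> ?L"
    using f_w by (auto simp: val_eq_0_iff vecs_def w_def)
  ultimately have "card (vecs J :: (nat \<Rightarrow> 'a) set) \<le> card ?L"
    by (intro card_inj_on_le[of ?f]) (auto intro: finite_subset[OF _ finite_vecs[of "{..<2 * m}"]])
  then have "q ^ card J \<le> q ^ (2 * m - card J)"
    by (simp add: card_kernel card_vecs finite_J q_card)
  then have "card J \<le> 2 * m - card J" using q_gt_1 by simp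
  then show ?thesis by linarith
qed

text \<open>
  Off the kernel of evaluation at \<open>v\<close>, moving along some \<open>w j\<close> changes the quadratic form at a
  constant nonzero rate, so exactly one covector in \<open>q\<close> is isotropic there.
\<close>

lemma card_isotropic_off_kernel:
  "card {c \<in> vecs {..<2 * m}. val m v c \<noteq> 0} =
    card {c \<in> vecs {..<2 * m}. val m v c \<noteq> 0 \<and> qform m c = 0} * q"
proof -
  let ?X = "{c \<in> vecs {..<2 * m}. val m v c \<noteq> 0}"
  let ?Y = "{c \<in> vecs {..<2 * m}. val m v c \<noteq> 0 \<and> qform m c = 0}"
  \<comment> \<open>The least index depends on \<open>c\<close> only through the values
    \<open>bform m c (w l)\<close>. Shifts by the \<open>w j\<close> leave these unchanged, so the
    direction is constant along each line.\<close>
  define j where "j c = (LEAST j. j \<in> J \<and> bform m c (w j) \<noteq> 0)" for c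
  define b where "b c = bform m c (w (j c))" for c
  have j: "j c \<in> J \<and> b c \<noteq> 0" if "c \<in> ?X" for c
    using that LeastI_ex[of "\<lambda>j. j \<in> J \<and> bform m c (w j) \<noteq> 0"]
    by (auto simp: j_def b_def val_eq_0_iff)
  let ?s = "\<lambda>c t k. c k + t * w (j c) k"
  have inv: "bform m (?s c t) (w l) = bform m c (w l)" if "c \<in> ?X" "l \<in> J" for c t l
    using j[OF that(1)] that(2) by (simp add: bform_add_left bform_w_w)
  have sX: "?s c t \<in> ?X" if "c \<in> ?X" for c t
    using that inv[OF that] by (auto simp: val_eq_0_iff vecs_def w_def)
  have js: "j (?s c t) = j c" if "c \<in> ?X" for c t
  proof -
    have "(\<lambda>i. i \<in> J \<and> bform m (?s c t) (w i) \<noteq> 0) = (\<lambda>i. i \<in> J \<and> bform m c (w i) \<noteq> 0)"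
      by (intro ext conj_cong refl) (simp only: inv[OF that])
    then show ?thesis unfolding j_def by (rule arg_cong)
  qed
  have bs: "b (?s c t) = b c" if "c \<in> ?X" for c t
    using inv[OF that, of "j c" t] j[OF that] by (simp only: b_def js[OF that])
  have Qs: "qform m (?s c t) = qform m c + t * b c" if "c \<in> ?X" for c t
    using j[OF that] by (simp add: qform_add qform_w b_def)
  have "bij_betw (\<lambda>(c, t). ?s c t) (?Y \<times> UNIV) ?X"
  \<comment> \<open>Along the line the form is \<open>qform m c + t * b c\<close>, and
    \<open>t = - qform m c / b c\<close> is its only zero.\<close>
  proof (rule bij_betw_byWitness[where f' = "\<lambda>c. (?s c (- qform m c / b c), qform m c / b c)"])
    show "\<forall>x\<in>?Y \<times> UNIV. (\<lambda>c. (?s c (- qform m c / b c), qform m c / b c)) ((\<lambda>(c, t). ?s c t) x) = x"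
    proof
      fix x assume "x \<in> ?Y \<times> (UNIV :: 'a set)"
      then obtain c t where x: "x = (c, t)" and c: "c \<in> ?X" "qform m c = 0" by auto
      have "qform m (?s c t) / b (?s c t) = t"
        using j[OF c(1)] by (simp add: Qs[OF c(1)] bs[OF c(1)] c(2))
      then show "(\<lambda>c. (?s c (- qform m c / b c), qform m c / b c)) ((\<lambda>(c, t). ?s c t) x) = x"
        by (simp add: x js[OF c(1)])
    qed
    show "\<forall>c\<in>?X. (\<lambda>(c, t). ?s c t) (?s c (- qform m c / b c), qform m c / b c) = c"
    proof
      fix c assume c: "c \<in> ?X"
      show "(\<lambda>(c, t). ?s c t) (?s c (- qform m c / b c), qform m c / b c) = c"
        by (simp only: prod.case js[OF c]) simp
    qed
    show "(\<lambda>(c, t). ?s c t) ` (?Y \<times> UNIV) \<subseteq> ?X" using sX by auto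
    show "(\<lambda>c. (?s c (- qform m c / b c), qform m c / b c)) ` ?X \<subseteq> ?Y \<times> UNIV"
    proof
      fix y assume "y \<in> (\<lambda>c. (?s c (- qform m c / b c), qform m c / b c)) ` ?X"
      then obtain c where c: "c \<in> ?X" and y: "y = (?s c (- qform m c / b c), qform m c / b c)" by blast
      have "qform m (?s c (- qform m c / b c)) = 0"
        using j[OF c] by (simp only: Qs[OF c]) simp
      then show "y \<in> ?Y \<times> UNIV" using sX[OF c] y by blast
    qed
  qed
  then have "card ?X = card (?Y \<times> (UNIV :: 'a set))" by (rule bij_betw_same_card[symmetric])
  then show ?thesis by (simp add: card_cartesian_product q_card)
qed

lemma val_scale: "val m v (\<lambda>k. t * c k) = emb t * val m v c"
  by (simp add: val_def sum_distrib_left hom_distribs mult.assoc)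

lemma card_iso_pts_nonzero:
  assumes "m \<ge> 1"
  shows "card {c \<in> iso_pts m. val m v c \<noteq> 0} = e_exp q (card J) m"
proof -
  let ?Y = "{c \<in> vecs {..<2 * m}. val m v c \<noteq> 0 \<and> qform m c = 0}"
  let ?N = "{c \<in> iso_pts m. val m v c \<noteq> 0}"
  have "?Y = {c \<in> vecs {..<2 * m}. qform m c = 0 \<and> c \<noteq> (\<lambda>_. 0) \<and> c \<in> {c. val m v c \<noteq> 0}}"
    by (auto simp: val_def)
  then have "card ?Y = card ?N * (q - 1)"
    using card_scaled_iso_pts[of "{c. val m v c \<noteq> 0}" m] by (simp add: val_scale q_card)
  then have "card ?N * (q - 1) * q = card {c \<in> vecs {..<2 * m}. val m v c \<noteq> 0}"
    by (simp add: card_isotropic_off_kernel)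
  also have "\<dots> = card (vecs {..<2 * m} - {c \<in> vecs {..<2 * m}. val m v c = 0} :: (nat \<Rightarrow> 'a) set)"
    by (rule arg_cong[of _ _ card]) auto
  also have "\<dots> = q ^ (2 * m) - q ^ (2 * m - card J)"
    by (subst card_Diff_subset)
      (auto simp: card_kernel card_vecs q_card intro: finite_subset[OF _ finite_vecs[of "{..<2 * m}"]])
  also have "\<dots> = e_exp q (card J) m * (q - 1) * q"
    using card_J_le assms q_pos by (intro e_exp_mult[symmetric]) auto
  finally show ?thesis using q_gt_1 by simp
qed

end

section \<open>Orthogonal group and unipotent orbits\<close>

interpretation Const: comm_ring_hom "Const :: 'a::comm_ring_1 \<Rightarrow> 'a mpoly"
  by (rule Const_hom)

definition lin :: "nat \<Rightarrow> (nat \<Rightarrow> 'a::comm_ring_1) \<Rightarrow> 'a mpoly" where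
  "lin m c = (\<Sum>j<2 * m. Const (c j) * Var j)"

lemma Const_mult_Var: "Const a * Var j = (Poly_Mapping.single (Poly_Mapping.single j 1) a :: 'a::comm_ring_1 mpoly)"
  by (simp add: Const_def Var_def mult_single)

lemma single_1_eq_iff: "Poly_Mapping.single j (1::nat) = Poly_Mapping.single i 1 \<longleftrightarrow> j = i"
  by (metis lookup_single_eq lookup_single_not_eq zero_neq_one)

lemma lookup_lin: "j < 2 * m \<Longrightarrow> Poly_Mapping.lookup (lin m c) (Poly_Mapping.single j 1) = c j"
  unfolding lin_def Const_mult_Var lookup_sum lookup_single single_1_eq_iff by (simp add: when_def)

lemma lin_inj: "inj_on (lin m) (vecs {..<2 * m})"
proof (rule inj_onI)
  fix c d :: "nat \<Rightarrow> 'a" assume cd: "c \<in> vecs {..<2 * m}" "d \<in> vecs {..<2 * m}" "lin m c = lin m d"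
  show "c = d"
  proof
    fix j show "c j = d j"
      using cd lookup_lin[of j m c] lookup_lin[of j m d] by (cases "j < 2 * m") (auto simp: vecs_def)
  qed
qed

lemma lin_0: "lin m (\<lambda>_. 0) = 0"
  by (simp add: lin_def)

lemma lin_scale: "lin m (\<lambda>j. t * c j) = Const t * lin m c"
  by (simp add: lin_def sum_distrib_left hom_distribs mult.assoc)

lemma lin_eq_0_iff: "c \<in> vecs {..<2 * m} \<Longrightarrow> lin m c = 0 \<longleftrightarrow> c = (\<lambda>_. 0)"
  using inj_onD[OF lin_inj, of m c "\<lambda>_. 0"] lin_0 by (auto simp: vecs_def)

lemma act_Const [simp]: "act m g (Const a) = Const a"
  by (simp add: act_def)

lemma act_Var: "act m g (Var k) = lin m (\<lambda>j. g $$ (k, j))"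
  by (simp add: act_def lin_def)

lemma act_lin: "act m g (lin m c) = lin m (\<lambda>j. \<Sum>k<2 * m. c k * g $$ (k, j))"
proof -
  interpret act: comm_ring_hom "act m g" by (rule act_hom)
  have "act m g (lin m c) = (\<Sum>k<2 * m. \<Sum>j<2 * m. Const (c k) * (Const (g $$ (k, j)) * Var j))"
    unfolding lin_def act.hom_sum act.hom_mult act_Const act_Var[unfolded lin_def] sum_distrib_left ..
  also have "\<dots> = lin m (\<lambda>j. \<Sum>k<2 * m. c k * g $$ (k, j))"
    unfolding lin_def by (subst sum.swap) (simp add: sum_distrib_right hom_distribs mult.assoc)
  finally show ?thesis .
qed

text \<open>The hypothesis is G^T S G = S for the antidiagonal Gram matrix S. The ring is arbitrary
  so that \<open>z\<close> and \<open>w\<close> can also be the variables and their Frobenius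
  powers.\<close>

lemma bform_mult_preserved:
  assumes G: "\<And>i j. i < 2 * m \<Longrightarrow> j < 2 * m \<Longrightarrow>
    (\<Sum>l<2 * m. G l i * G (2 * m - 1 - l) j) = (if i = 2 * m - 1 - j then 1 else 0)"
  shows "bform m (\<lambda>l. \<Sum>i<2 * m. G l i * z i) (\<lambda>l. \<Sum>j<2 * m. G l j * w j) = bform m z w"
proof -
  let ?s = "\<lambda>k. 2 * m - 1 - k"
  have "bform m (\<lambda>l. \<Sum>i<2 * m. G l i * z i) (\<lambda>l. \<Sum>j<2 * m. G l j * w j) =
      (\<Sum>l<2 * m. \<Sum>i<2 * m. \<Sum>j<2 * m. G l i * G (?s l) j * (z i * w j))"
    unfolding bform_def sum_product by (simp add: mult_ac)
  also have "\<dots> = (\<Sum>i<2 * m. \<Sum>l<2 * m. \<Sum>j<2 * m. G l i * G (?s l) j * (z i * w j))"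
    by (rule sum.swap)
  also have "\<dots> = (\<Sum>i<2 * m. \<Sum>j<2 * m. \<Sum>l<2 * m. G l i * G (?s l) j * (z i * w j))"
    by (intro sum.cong refl sum.swap)
  also have "\<dots> = (\<Sum>i<2 * m. \<Sum>j<2 * m. if j = ?s i then z i * w j else 0)"
  proof (intro sum.cong refl)
    fix i j assume "i \<in> {..<2 * m}" "j \<in> {..<2 * m}"
    then have "(\<Sum>l<2 * m. G l i * G (?s l) j * (z i * w j)) = (if i = ?s j then z i * w j else 0)"
      using G[of i j] by (simp add: sum_distrib_right[symmetric])
    moreover have "i = ?s j \<longleftrightarrow> j = ?s i" using \<open>i \<in> _\<close> \<open>j \<in> _\<close> by auto
    ultimately show "(\<Sum>l<2 * m. G l i * G (?s l) j * (z i * w j)) = (if j = ?s i then z i * w j else 0)"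
      by simp
  qed
  also have "\<dots> = bform m z w" unfolding bform_def by (intro sum.cong refl) auto
  finally show ?thesis .
qed

lemma qform_Var: "qform m Var = xi m 1"
  unfolding qform_def xi_def yvar_def xvar_def
  by (simp, rule sum.reindex_bij_witness[of _ "\<lambda>k. m - k" "\<lambda>k. m - k"]) (auto simp: mult_2)

text \<open>Presents \<open>\<xi>\<^sub>i\<close> as the form between the generic point and a
  Frobenius twist of it. The index 1 is set apart because there the form yields twice
  \<open>\<xi>\<^sub>1\<close>.\<close>

lemma bform_Var:
  assumes "i \<noteq> 1"
  shows "bform m Var (\<lambda>k. Var k ^ (CARD('a) ^ (i - 1))) = (xi m i :: 'a::{field,finite} mpoly)"
proof -
  let ?Q = "CARD('a) ^ (i - 1)"
  have "bform m Var (\<lambda>k. Var k ^ ?Q) =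
      (\<Sum>k<m. Var k * Var (2 * m - 1 - k) ^ ?Q + Var (2 * m - 1 - k) * Var k ^ ?Q :: 'a mpoly)"
    unfolding bform_def sum_lessThan_double by (intro sum.cong refl) auto
  also have "\<dots> = (\<Sum>k = 1..m. Var (m - k) * Var (m + k - 1) ^ ?Q + Var (m + k - 1) * Var (m - k) ^ ?Q)"
    by (rule sum.reindex_bij_witness[of _ "\<lambda>k. m - k" "\<lambda>k. m - k"]) (auto simp: mult_2)
  also have "\<dots> = xi m i"
    using assms unfolding xi_def yvar_def xvar_def by (simp add: algebra_simps)
  finally show ?thesis .
qed

lemma (in comm_ring_hom) hom_qform: "hom (qform m c) = qform m (\<lambda>k. hom (c k))"
  by (simp add: qform_def hom_distribs)

lemma (in comm_ring_hom) hom_bform: "hom (bform m c d) = bform m (\<lambda>k. hom (c k)) (\<lambda>k. hom (d k))"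
  by (simp add: bform_def hom_distribs)

definition unit :: "nat \<Rightarrow> nat \<Rightarrow> 'a::zero_neq_one" where
  "unit i k = (if k = i then 1 else 0)"

lemma bform_unit_right: "j < 2 * m \<Longrightarrow> bform m c (unit j) = c (2 * m - 1 - j)"
proof -
  assume j: "j < 2 * m"
  have "bform m c (unit j) = (\<Sum>k<2 * m. if k = 2 * m - 1 - j then c k else 0)"
    unfolding bform_def unit_def using j by (intro sum.cong refl) auto
  then show ?thesis using j by simp
qed

lemma bform_unit_left: "j < 2 * m \<Longrightarrow> bform m (unit j) c = c (2 * m - 1 - j)"
  by (simp add: bform_commute[of m "unit j"] bform_unit_right)

lemma bform_add_right: "bform m e (\<lambda>k. c k + t * d k) = bform m e c + t * bform m e d"
  by (simp add: bform_commute[of m e] bform_add_left)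

locale odd_field =
  fixes field_type :: "'a::{field,finite} itself"
  assumes two: "(2 :: 'a) \<noteq> 0"
begin

text \<open>The cross term of \<open>qform_add\<close> at \<open>t = 1\<close> recovers the bilinear
  form; the factor 1 is written out to match the shape of that lemma.\<close>

lemma polarization:
  assumes "\<And>c. qform m (h c) = qform m (c :: nat \<Rightarrow> 'a)"
    and "\<And>c d. h (\<lambda>k. c k + 1 * d k) = (\<lambda>k. h c k + 1 * h d k)"
  shows "bform m (h c) (h d) = bform m c d"
proof -
  have "qform m (h (\<lambda>k. c k + 1 * d k)) = qform m (\<lambda>k. c k + 1 * d k)" by (rule assms(1))
  then show ?thesis unfolding assms(2) qform_add assms(1) by simp
qed

text \<open>Invariance of the polynomial \<open>\<xi>\<^sub>1\<close>, evaluated at all points over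
  the ground field, says that \<open>g\<close> is an isometry there; polarized on unit vectors this
  becomes a relation between columns.\<close>

lemma orth_columns:
  assumes "g \<in> (orth_group m :: 'a mat set)" "i < 2 * m" "j < 2 * m"
  shows "(\<Sum>l<2 * m. g $$ (l, i) * g $$ (2 * m - 1 - l, j)) = (if i = 2 * m - 1 - j then 1 else 0)"
proof -
  have id: "comm_ring_hom (\<lambda>x :: 'a. x)" by unfold_locales auto
  let ?h = "\<lambda>c l. \<Sum>j<2 * m. g $$ (l, j) * c j"
  have "qform m (?h c) = qform m c" for c
  proof -
    interpret ev: comm_ring_hom "mpoly_eval (\<lambda>x. x) c" by (rule comm_ring_hom.mpoly_eval_hom[OF id])
    have "mpoly_eval (\<lambda>x. x) c (act m g (xi m 1)) = mpoly_eval (\<lambda>x. x) c (xi m 1)"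
      using assms by (simp add: orth_group_def)
    moreover have "mpoly_eval (\<lambda>x. x) c (act m g (xi m 1)) = qform m (?h c)"
    proof -
      interpret act: comm_ring_hom "act m g" by (rule act_hom)
      show ?thesis
        unfolding qform_Var[symmetric] act.hom_qform ev.hom_qform
        by (simp add: act_Var lin_def ev.hom_sum ev.hom_mult comm_ring_hom.mpoly_eval_Const[OF id]
            comm_ring_hom.mpoly_eval_Var[OF id])
    qed
    moreover have "mpoly_eval (\<lambda>x. x) c (xi m 1) = qform m c"
      unfolding qform_Var[symmetric] ev.hom_qform by (simp add: comm_ring_hom.mpoly_eval_Var[OF id])
    ultimately show ?thesis by simp
  qed
  moreover have "?h (\<lambda>k. c k + 1 * d k) = (\<lambda>k. ?h c k + 1 * ?h d k)" for c d
    by (simp add: distrib_left sum.distrib)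
  ultimately have "bform m (?h (unit i)) (?h (unit j)) = bform m (unit i) (unit j)"
    using polarization[where h = ?h and m = m and c = "unit i" and d = "unit j"] by blast
  moreover have "?h (unit i) = (\<lambda>l. g $$ (l, i))" if "i < 2 * m" for i
    using that by (simp add: unit_def fun_eq_iff if_distrib cong: if_cong)
  ultimately show ?thesis
    using assms by (simp add: bform_unit_right) (auto simp: bform_def unit_def)
qed

text \<open>This is S g^T S for the antidiagonal matrix S, the adjoint of \<open>g\<close> for
  \<open>bform\<close>; \<open>g\<close> preserves the form exactly when it is the inverse of
  \<open>g\<close>.\<close>

definition adj :: "nat \<Rightarrow> 'a mat \<Rightarrow> 'a mat" where
  "adj m g = mat (2 * m) (2 * m) (\<lambda>(i, j). g $$ (2 * m - 1 - j, 2 * m - 1 - i))"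

lemma mult_adj_iff:
  assumes "g \<in> carrier_mat (2 * m) (2 * m)"
  shows "g * adj m g = 1\<^sub>m (2 * m) \<longleftrightarrow>
    (\<forall>i<2 * m. \<forall>j<2 * m. (\<Sum>l<2 * m. g $$ (i, l) * g $$ (j, 2 * m - 1 - l)) = (if i = 2 * m - 1 - j then 1 else 0))"
    (is "_ \<longleftrightarrow> ?R")
proof -
  have "g * adj m g = 1\<^sub>m (2 * m) \<longleftrightarrow> (\<forall>i<2 * m. \<forall>j<2 * m.
      (\<Sum>l<2 * m. g $$ (i, l) * g $$ (2 * m - 1 - j, 2 * m - 1 - l)) = (if i = j then 1 else 0))"
    using assms by (auto simp: mat_eq_iff adj_def scalar_prod_def atLeast0LessThan)
  also have "\<dots> \<longleftrightarrow> ?R"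
  proof (intro iffI allI impI)
    fix i j assume a: "\<forall>i<2 * m. \<forall>j<2 * m.
      (\<Sum>l<2 * m. g $$ (i, l) * g $$ (2 * m - 1 - j, 2 * m - 1 - l)) = (if i = j then 1 else 0)"
      and ij: "i < 2 * m" "j < 2 * m"
    show "(\<Sum>l<2 * m. g $$ (i, l) * g $$ (j, 2 * m - 1 - l)) = (if i = 2 * m - 1 - j then 1 else 0)"
      using a[rule_format, of i "2 * m - 1 - j"] ij by simp
  next
    fix i j assume a: ?R and ij: "i < 2 * m" "j < 2 * m"
    show "(\<Sum>l<2 * m. g $$ (i, l) * g $$ (2 * m - 1 - j, 2 * m - 1 - l)) = (if i = j then 1 else 0)"
      using a[rule_format, of i "2 * m - 1 - j"] ij by simp
  qed
  finally show ?thesis .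
qed

lemma adj_mult_iff:
  assumes "g \<in> carrier_mat (2 * m) (2 * m)"
  shows "adj m g * g = 1\<^sub>m (2 * m) \<longleftrightarrow>
    (\<forall>i<2 * m. \<forall>j<2 * m. (\<Sum>l<2 * m. g $$ (l, i) * g $$ (2 * m - 1 - l, j)) = (if i = 2 * m - 1 - j then 1 else 0))"
    (is "_ \<longleftrightarrow> ?R")
proof -
  have "adj m g * g = 1\<^sub>m (2 * m) \<longleftrightarrow> (\<forall>i<2 * m. \<forall>j<2 * m.
      (\<Sum>l<2 * m. g $$ (2 * m - 1 - l, 2 * m - 1 - i) * g $$ (l, j)) = (if i = j then 1 else 0))"
    using assms by (auto simp: mat_eq_iff adj_def scalar_prod_def atLeast0LessThan)
  also have "\<dots> \<longleftrightarrow> ?R"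
  proof -
    have flip: "(\<Sum>l<2 * m. g $$ (2 * m - 1 - l, i) * g $$ (l, j)) =
        (\<Sum>l<2 * m. g $$ (l, i) * g $$ (2 * m - 1 - l, j))" for i j
      by (subst sum_flip[symmetric]) (intro sum.cong refl, simp)
    show ?thesis
      unfolding flip
    proof (intro iffI allI impI)
      fix i j assume a: "\<forall>i<2 * m. \<forall>j<2 * m. (\<Sum>l<2 * m. g $$ (l, 2 * m - 1 - i) *
          g $$ (2 * m - 1 - l, j)) = (if i = j then 1 else 0)"
        and ij: "i < 2 * m" "j < 2 * m"
      have "(2 * m - 1 - i = j) = (i = 2 * m - 1 - j)" using ij by auto
      then show "(\<Sum>l<2 * m. g $$ (l, i) * g $$ (2 * m - 1 - l, j)) = (if i = 2 * m - 1 - j then 1 else 0)"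
        using a[rule_format, of "2 * m - 1 - i" j] ij by simp
    next
      fix i j assume a: ?R and ij: "i < 2 * m" "j < 2 * m"
      have "(2 * m - 1 - i = 2 * m - 1 - j) = (i = j)" using ij by auto
      then show "(\<Sum>l<2 * m. g $$ (l, 2 * m - 1 - i) * g $$ (2 * m - 1 - l, j)) = (if i = j then 1 else 0)"
        using a[rule_format, of "2 * m - 1 - i" j] ij by simp
    qed
  qed
  finally show ?thesis .
qed

text \<open>A left inverse of a square matrix is a right inverse, which passes from columns to rows.
  Rows matter because group elements act on linear forms as row vectors.\<close>

lemma orth_rows:
  assumes "g \<in> (orth_group m :: 'a mat set)" "i < 2 * m" "j < 2 * m"
  shows "(\<Sum>l<2 * m. g $$ (i, l) * g $$ (j, 2 * m - 1 - l)) = (if i = 2 * m - 1 - j then 1 else 0)"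
proof -
  have g: "g \<in> carrier_mat (2 * m) (2 * m)" using assms by (simp add: orth_group_def)
  have a: "adj m g \<in> carrier_mat (2 * m) (2 * m)" by (simp add: adj_def)
  have "adj m g * g = 1\<^sub>m (2 * m)" using adj_mult_iff[OF g] orth_columns[OF assms(1)] by blast
  then have "g * adj m g = 1\<^sub>m (2 * m)" by (rule mat_mult_left_right_inverse[OF a g])
  then show ?thesis using mult_adj_iff[OF g] assms by blast
qed

lemma two_mpoly: "(2 :: 'a mpoly) \<noteq> 0"
proof
  assume "(2 :: 'a mpoly) = 0"
  then have "Const (2 :: 'a) = Const 0" by (simp add: hom_distribs)
  then show False using two inj_Const[THEN injD] by blast
qed

lemma orth_groupI:
  assumes g: "(g :: 'a mat) \<in> carrier_mat (2 * m) (2 * m)"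
    and rows: "\<And>i j. i < 2 * m \<Longrightarrow> j < 2 * m \<Longrightarrow>
      (\<Sum>l<2 * m. g $$ (i, l) * g $$ (j, 2 * m - 1 - l)) = (if i = 2 * m - 1 - j then 1 else 0)"
  shows "g \<in> orth_group m"
proof -
  have a: "adj m g \<in> carrier_mat (2 * m) (2 * m)" by (simp add: adj_def)
  have 1: "g * adj m g = 1\<^sub>m (2 * m)" using mult_adj_iff[OF g] rows by blast
  then have 2: "adj m g * g = 1\<^sub>m (2 * m)" by (rule mat_mult_left_right_inverse[OF g a])
  have "invertible_mat g"
    unfolding invertible_mat_def inverts_mat_def using 1 2 g a by (auto intro!: exI[of _ "adj m g"])
  moreover have "act m g (xi m 1) = xi m 1"
  proof -
    interpret act: comm_ring_hom "act m g" by (rule act_hom)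
    have "(\<Sum>l<2 * m. Const (g $$ (l, i)) * Const (g $$ (2 * m - 1 - l, j))) = (if i = 2 * m - 1 - j then 1 else 0)"
      if "i < 2 * m" "j < 2 * m" for i j
    proof -
      have "(\<Sum>l<2 * m. g $$ (l, i) * g $$ (2 * m - 1 - l, j)) = (if i = 2 * m - 1 - j then 1 else 0)"
        using adj_mult_iff[OF g] 2 that by blast
      then show ?thesis by (simp add: hom_distribs[symmetric])
    qed
    then have "bform m (\<lambda>k. lin m (\<lambda>j. g $$ (k, j))) (\<lambda>k. lin m (\<lambda>j. g $$ (k, j))) = bform m Var Var"
      unfolding lin_def by (rule bform_mult_preserved)
    then have "2 * act m g (xi m 1) = 2 * xi m 1"
      unfolding qform_Var[symmetric] act.hom_qform by (simp add: bform_self act_Var)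
    then show ?thesis using two_mpoly by simp
  qed
  ultimately show ?thesis using g by (simp add: orth_group_def)
qed

text \<open>
  The Siegel transformation \<open>z \<mapsto> z + B(z, f) a - B(z, a) f - Q(a) B(z, f) f\<close> for the isotropic
  covector \<open>f\<close> dual to \<open>z\<^sub>k\<close>; it sends \<open>z\<^sub>k\<close> to \<open>z\<^sub>k + a - Q(a) f\<close>.
\<close>

definition siegel :: "nat \<Rightarrow> nat \<Rightarrow> (nat \<Rightarrow> 'a) \<Rightarrow> nat \<Rightarrow> nat \<Rightarrow> 'a" where
  "siegel m k a i = (\<lambda>l. (unit i l + (if i = k then 1 else 0) * a l) +
     (- a (2 * m - 1 - i) - qform m a * (if i = k then 1 else 0)) * unit (2 * m - 1 - k) l)"

lemma qform_unit: "i < 2 * m \<Longrightarrow> qform m (unit i) = (0 :: 'a)"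
proof -
  assume i: "i < 2 * m"
  then have "i \<noteq> 2 * m - 1 - i" by presburger
  then have "2 * qform m (unit i) = (0 :: 'a)"
    using bform_unit_right[OF i, of "unit i"] by (simp add: bform_self[symmetric] unit_def)
  then show ?thesis using two by simp
qed

text \<open>The two conditions on \<open>a\<close> say that it is orthogonal to z_k and to the dual
  covector f, so that only the cancellations built into the Siegel formula remain.\<close>

lemma siegel_isometry:
  assumes "k < 2 * m" "i < 2 * m" "j < 2 * m" "a k = 0" "a (2 * m - 1 - k) = 0"
  shows "bform m (siegel m k a i) (siegel m k a j) = (if i = 2 * m - 1 - j then 1 else 0)"
proof -
  have e: "2 * m - 1 - k < 2 * m" "2 * m - 1 - (2 * m - 1 - k) = k" "k \<noteq> 2 * m - 1 - k"
    using assms by presburger+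
  have eqs: "(2 * m - 1 - i = j) = (i = 2 * m - 1 - j)" "(k = i) = (i = k)" "(k = j) = (j = k)"
     "(2 * m - 1 - j = i) = (i = 2 * m - 1 - j)"
    using assms by auto
  have u: "unit i (2 * m - 1 - j) = (if i = 2 * m - 1 - j then 1 else 0 :: 'a)"
    "unit i k = (if i = k then 1 else 0 :: 'a)" "unit j k = (if j = k then 1 else 0 :: 'a)"
    "unit (2 * m - 1 - k) k = (0 :: 'a)"
    "unit (2 * m - 1 - k) (2 * m - 1 - j) = (if j = k then 1 else 0 :: 'a)"
    "unit (2 * m - 1 - k) (2 * m - 1 - i) = (if i = k then 1 else 0 :: 'a)"
    using e assms(1-3) by (auto simp: unit_def)
  show ?thesis
    unfolding siegel_def bform_add_left bform_add_right bform_unit_left[OF assms(2)]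
      bform_unit_right[OF assms(3)] bform_unit_left[OF e(1)] bform_unit_right[OF e(1)] bform_self e(2)
      u assms(4,5) qform_unit[OF e(1)]
    by (auto simp: algebra_simps)
qed

text \<open>An isotropic row that is monic at \<open>k\<close> has the form z_k + a + s f, and
  isotropy forces s = -Q(a). It is therefore row \<open>k\<close> of a Siegel transformation, which
  is triangular because \<open>c\<close> has zeros before \<open>k\<close>.\<close>

lemma ex_unipotent:
  assumes c: "c \<in> (iso_pts m :: (nat \<Rightarrow> 'a) set)" and k: "monic_at k c" "k < 2 * m"
  shows "\<exists>g\<in>unipotent_group m. \<forall>j<2 * m. g $$ (k, j) = c j"
proof -
  let ?k = "2 * m - 1 - k"
  have kk: "k \<noteq> ?k" "?k < 2 * m" "2 * m - 1 - ?k = k" using k by presburger+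
  define a where "a l = (if l = k \<or> l = ?k then 0 else c l)" for l
  have a0: "a k = 0" "a ?k = 0" by (auto simp: a_def)
  have c_eq: "c = (\<lambda>l. (unit k l + 1 * a l) + c ?k * unit ?k l)"
    using k kk by (auto simp: fun_eq_iff a_def unit_def monic_at_def)
  have "qform m c = qform m a + c ?k"
  proof -
    have u: "unit k k = (1 :: 'a)" by (simp add: unit_def)
    show ?thesis
      by (subst c_eq)
        (simp only: qform_add bform_add_left qform_unit[OF k(2)] qform_unit[OF kk(2)]
          bform_unit_right[OF kk(2)] bform_unit_left[OF k(2)] kk(3) a0 u, simp)
  qed
  then have ck: "c ?k = - qform m a" using c by (simp add: iso_pts_def add_eq_0_iff)
  define g where "g = mat (2 * m) (2 * m) (\<lambda>(i, j). siegel m k a i j)"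
  have g: "g \<in> carrier_mat (2 * m) (2 * m)" by (simp add: g_def)
  have "g \<in> orth_group m"
  proof (rule orth_groupI[OF g])
    fix i j assume ij: "i < 2 * m" "j < 2 * m"
    have "(\<Sum>l<2 * m. g $$ (i, l) * g $$ (j, 2 * m - 1 - l)) = bform m (siegel m k a i) (siegel m k a j)"
      unfolding bform_def g_def using ij by (intro sum.cong refl) auto
    then show "(\<Sum>l<2 * m. g $$ (i, l) * g $$ (j, 2 * m - 1 - l)) = (if i = 2 * m - 1 - j then 1 else 0)"
      using siegel_isometry[of k m i j a] ij k a0 by simp
  qed
  \<comment> \<open>Outside column \<open>?k\<close> the zeros of \<open>a\<close> before
    \<open>k\<close> suffice. In column \<open>?k\<close> the index \<open>2 * m - 1 - i\<close>
    lies below \<open>k\<close>, where \<open>a\<close> vanishes; in row \<open>k\<close> also Q(a)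
    appears, which is \<open>- c ?k\<close> and zero as \<open>?k < k\<close>.\<close>
  moreover have "siegel m k a i l = 0" if il: "l < i" "i < 2 * m" for i l
  proof -
    have "a l = 0" if "i = k" using that il k by (auto simp: a_def monic_at_def)
    moreover have "(- a (2 * m - 1 - i) - qform m a * (if i = k then 1 else 0)) * unit ?k l = 0"
    proof (cases "l = ?k")
      case True
      then have "2 * m - 1 - i < k" using il k by auto
      then have "a (2 * m - 1 - i) = 0" using k by (auto simp: a_def monic_at_def)
      moreover have "qform m a = 0" if "i = k"
        using ck k that True il by (simp add: monic_at_def)
      ultimately show ?thesis by simp
    qed (simp add: unit_def)
    ultimately show ?thesis using il by (auto simp: siegel_def unit_def)
  qed
  moreover have "siegel m k a i i = 1" if "i < 2 * m" for i
    using that a0 kk by (auto simp: siegel_def unit_def)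
  moreover have "siegel m k a k j = c j" for j
    using fun_cong[OF c_eq, of j] a0 ck by (simp add: siegel_def)
  ultimately have "g \<in> unipotent_group m" "\<forall>j<2 * m. g $$ (k, j) = c j"
    using g k by (auto simp: unipotent_group_def g_def)
  then show ?thesis by blast
qed

text \<open>A row of an isometry is isotropic, and unitriangularity makes row \<open>k\<close> monic
  at \<open>k\<close>; conversely, \<open>ex_unipotent\<close> realises every such row.\<close>

lemma orbit_eq:
  assumes k: "k < 2 * m"
  shows "(\<lambda>g. act m g (Var k)) ` (unipotent_group m :: 'a mat set) = lin m ` {c \<in> iso_pts m. monic_at k c}"
proof (intro equalityI subsetI)
  fix f assume "f \<in> (\<lambda>g. act m g (Var k)) ` (unipotent_group m :: 'a mat set)"
  then obtain g where g: "g \<in> (unipotent_group m :: 'a mat set)" and f: "f = lin m (\<lambda>j. g $$ (k, j))"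
    by (auto simp: act_Var)
  let ?c = "\<lambda>j. if j < 2 * m then g $$ (k, j) else 0"
  have go: "g \<in> orth_group m" using g by (simp add: unipotent_group_def)
  have "2 * qform m ?c = (\<Sum>l<2 * m. g $$ (k, l) * g $$ (k, 2 * m - 1 - l))"
    unfolding bform_self[symmetric] bform_def by (intro sum.cong refl) auto
  also have "\<dots> = 0"
  proof -
    have "k \<noteq> 2 * m - 1 - k" using k by presburger
    then show ?thesis using orth_rows[OF go k k] by simp
  qed
  finally have "qform m ?c = 0" using two by simp
  moreover have "monic_at k ?c"
    using g k by (auto simp: unipotent_group_def monic_at_def orth_group_def upper_triangular_def)
  ultimately have "?c \<in> {c \<in> iso_pts m. monic_at k c}" using k by (auto simp: iso_pts_def vecs_def)
  moreover have "f = lin m ?c" unfolding f lin_def by (intro sum.cong) auto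
  ultimately show "f \<in> lin m ` {c \<in> iso_pts m. monic_at k c}" by blast
next
  fix f assume "f \<in> lin m ` {c \<in> iso_pts m. monic_at k (c :: nat \<Rightarrow> 'a)}"
  then obtain c where c: "c \<in> iso_pts m" "monic_at k c" "f = lin m c" by auto
  then obtain g where g: "g \<in> unipotent_group m" "\<forall>j<2 * m. g $$ (k, j) = c j"
    using ex_unipotent k by blast
  have "act m g (Var k) = f" using g(2) c(3) by (simp add: act_Var lin_def)
  then show "f \<in> (\<lambda>g. act m g (Var k)) ` unipotent_group m" using g(1) by blast
qed

lemma finite_iso_pts: "finite (iso_pts m :: (nat \<Rightarrow> 'a) set)"
  by (rule finite_subset[OF _ finite_vecs[of "{..<2 * m}"]]) (auto simp: iso_pts_def)

text \<open>The leading position separates the orbits, so together they list each isotropic point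
  once; the y_i account for the positions below \<open>m\<close>, the x_i for the others.\<close>

lemma u_poly_eq: "u_poly m = (\<Prod>c\<in>iso_pts m. lin m (c :: nat \<Rightarrow> 'a))"
proof -
  let ?N = "\<lambda>k. {c \<in> iso_pts m. monic_at k (c :: nat \<Rightarrow> 'a)}"
  have orb: "orbit_prod m (Var k) = (\<Prod>c\<in>?N k. lin m c)" if "k < 2 * m" for k
    unfolding orbit_prod_def orbit_eq[OF that]
    by (subst prod.reindex) (auto intro: inj_on_subset[OF lin_inj] simp: iso_pts_def)
  have "u_poly m = (\<Prod>i=1..m. \<Prod>c\<in>?N (m - i). lin m c) * (\<Prod>i=1..m. \<Prod>c\<in>?N (m + i - 1). lin m c)"
    unfolding u_poly_def yvar_def xvar_def prod.distrib
    by (intro arg_cong2[of _ _ _ _ "(*)"] prod.cong refl orb) auto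
  also have "(\<Prod>i=1..m. \<Prod>c\<in>?N (m - i). lin m c) = (\<Prod>k\<in>{..<m}. \<Prod>c\<in>?N k. lin m c)"
    by (rule prod.reindex_bij_witness[of _ "\<lambda>k. m - k" "\<lambda>k. m - k"]) auto
  also have "(\<Prod>i=1..m. \<Prod>c\<in>?N (m + i - 1). lin m c) = (\<Prod>k\<in>{m..<2 * m}. \<Prod>c\<in>?N k. lin m c)"
    by (rule prod.reindex_bij_witness[of _ "\<lambda>k. k + 1 - m" "\<lambda>k. m + k - 1"]) auto
  also have "(\<Prod>k\<in>{..<m}. \<Prod>c\<in>?N k. lin m c) * \<dots> = (\<Prod>k\<in>{..<m} \<union> {m..<2 * m}. \<Prod>c\<in>?N k. lin m c)"
    by (rule prod.union_disjoint[symmetric]) auto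
  also have "{..<m} \<union> {m..<2 * m} = {..<2 * m}" by auto
  also have "(\<Prod>k\<in>{..<2 * m}. \<Prod>c\<in>?N k. lin m c) = (\<Prod>c\<in>(\<Union>k\<in>{..<2 * m}. ?N k). lin m c)"
  proof (rule prod.UNION_disjoint[symmetric])
    show "\<forall>i\<in>{..<2 * m}. \<forall>j\<in>{..<2 * m}. i \<noteq> j \<longrightarrow> ?N i \<inter> ?N j = {}"
    proof (intro ballI impI equals0I)
      fix i j c assume "i \<noteq> j" "c \<in> ?N i \<inter> ?N j"
      then show False using monic_at_scale_inj[of i c j c 1 1] by auto
    qed
  qed (auto simp: finite_iso_pts)
  also have "(\<Union>k\<in>{..<2 * m}. ?N k) = iso_pts m" by (auto simp: iso_pts_def)
  finally show ?thesis .
qed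

end

section \<open>Steenrod operations and invariance\<close>

lemma polyring_Const: "Const a \<in> polyring m"
  by (auto simp: polyring_def Const_def)

lemma polyring_Var: "k < 2 * m \<Longrightarrow> Var k \<in> polyring m"
  by (auto simp: polyring_def Var_def)

lemma polyring_add: "f \<in> polyring m \<Longrightarrow> g \<in> polyring m \<Longrightarrow> f + g \<in> polyring m"
  using keys_add[of f g] unfolding polyring_def by blast

lemma polyring_mult: "f \<in> polyring m \<Longrightarrow> g \<in> polyring m \<Longrightarrow> f * g \<in> polyring m"
proof -
  assume f: "f \<in> polyring m" and g: "g \<in> polyring m"
  show "f * g \<in> polyring m"
    unfolding polyring_def
  proof (intro CollectI ballI)
    fix \<mu> assume "\<mu> \<in> Poly_Mapping.keys (f * g)"
    then obtain a b where "\<mu> = a + b" "a \<in> Poly_Mapping.keys f" "b \<in> Poly_Mapping.keys g"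
      using keys_mult[of f g] by blast
    then show "Poly_Mapping.keys \<mu> \<subseteq> {..<2 * m}"
      using keys_add[of a b] f g unfolding polyring_def by blast
  qed
qed

lemma polyring_0: "0 \<in> polyring m"
  by (simp add: polyring_def)

lemma polyring_1: "(1 :: 'a::comm_ring_1 mpoly) \<in> polyring m"
  using polyring_Const[of "1 :: 'a" m] by simp

lemma polyring_sum: "(\<And>x. x \<in> S \<Longrightarrow> f x \<in> polyring m) \<Longrightarrow> sum f S \<in> polyring m"
  by (induction S rule: infinite_finite_induct) (auto simp: polyring_add polyring_0)

lemma polyring_power: "(f :: 'a::comm_ring_1 mpoly) \<in> polyring m \<Longrightarrow> f ^ n \<in> polyring m"
  by (induction n) (auto simp: polyring_mult polyring_1)

lemma polyring_lin: "lin m c \<in> polyring m"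
  unfolding lin_def by (intro polyring_sum polyring_mult polyring_Const polyring_Var) auto

lemma polyring_xi: "xi m i \<in> polyring m"
  unfolding xi_def yvar_def xvar_def
  by (auto intro!: polyring_sum polyring_add polyring_mult polyring_power polyring_Var)

section \<open>Degrees and homogeneous polynomials\<close>

definition mdeg :: "(nat \<Rightarrow>\<^sub>0 nat) \<Rightarrow> nat" where
  "mdeg \<mu> = (\<Sum>v\<in>Poly_Mapping.keys \<mu>. Poly_Mapping.lookup \<mu> v)"

lemma mdeg_add: "mdeg (\<mu> + \<nu>) = mdeg \<mu> + mdeg \<nu>"
  unfolding mdeg_def by (rule setsum_keys_plus_distrib) auto

lemma mdeg_0 [simp]: "mdeg 0 = 0"
  by (simp add: mdeg_def)

lemma mdeg_single [simp]: "mdeg (Poly_Mapping.single k n) = n"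
  by (cases "n = 0") (auto simp: mdeg_def)

lemma homogeneous_iff: "homogeneous k f \<longleftrightarrow> (\<forall>\<mu>\<in>Poly_Mapping.keys f. mdeg \<mu> = k)"
  by (simp add: homogeneous_def mdeg_def)

lemma homogeneous_0: "homogeneous k 0"
  by (simp add: homogeneous_iff)

lemma homogeneous_Const: "homogeneous 0 (Const a)"
  by (auto simp: homogeneous_iff Const_def)

lemma homogeneous_Var: "homogeneous 1 (Var k)"
  by (auto simp: homogeneous_iff Var_def)

lemma homogeneous_add: "homogeneous k f \<Longrightarrow> homogeneous k g \<Longrightarrow> homogeneous k (f + g)"
  using keys_add[of f g] unfolding homogeneous_iff by blast

lemma homogeneous_mult: "homogeneous k f \<Longrightarrow> homogeneous l g \<Longrightarrow> homogeneous (k + l) (f * g)"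
proof -
  assume f: "homogeneous k f" and g: "homogeneous l g"
  show "homogeneous (k + l) (f * g)"
    unfolding homogeneous_iff
  proof
    fix \<mu> assume "\<mu> \<in> Poly_Mapping.keys (f * g)"
    then obtain a b where "\<mu> = a + b" "a \<in> Poly_Mapping.keys f" "b \<in> Poly_Mapping.keys g"
      using keys_mult[of f g] by blast
    then show "mdeg \<mu> = k + l" using f g by (auto simp: homogeneous_iff mdeg_add)
  qed
qed

lemma homogeneous_sum: "(\<And>x. x \<in> S \<Longrightarrow> homogeneous k (f x)) \<Longrightarrow> homogeneous k (sum f S)"
  by (induction S rule: infinite_finite_induct) (auto simp: homogeneous_add homogeneous_0)

lemma homogeneous_power: "homogeneous k (f :: 'a::comm_ring_1 mpoly) \<Longrightarrow> homogeneous (n * k) (f ^ n)"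
  using homogeneous_Const[of "1 :: 'a"] by (induction n) (auto simp: homogeneous_mult)

lemma homogeneous_lin: "homogeneous 1 (lin m c)"
  unfolding lin_def
  by (rule homogeneous_sum, rule homogeneous_mult[of 0 _ 1, unfolded add_0], rule homogeneous_Const,
      rule homogeneous_Var)

lemma homogeneous_xi:
  assumes "i \<ge> 1" shows "homogeneous (CARD('a) ^ (i - 1) + 1) (xi m i :: 'a::{field,finite} mpoly)"
proof (cases "i = 1")
  case True
  then show ?thesis
    using homogeneous_mult[OF homogeneous_Var homogeneous_Var]
    by (auto simp: xi_def yvar_def xvar_def intro!: homogeneous_sum)
next
  case False
  let ?Q = "CARD('a) ^ (i - 1)"
  have "homogeneous (?Q + 1) (Var k ^ ?Q * Var l :: 'a mpoly)" for k l
    using homogeneous_mult[OF homogeneous_power[OF homogeneous_Var] homogeneous_Var, of ?Q k l] by simp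
  moreover from this have "homogeneous (?Q + 1) (Var k * Var l ^ ?Q :: 'a mpoly)" for k l
    by (simp add: mult.commute)
  ultimately show ?thesis
    using False unfolding xi_def yvar_def xvar_def
    by (auto intro!: homogeneous_sum homogeneous_add)
qed

lemma homogeneous_unique: "homogeneous k f \<Longrightarrow> homogeneous l f \<Longrightarrow> f \<noteq> 0 \<Longrightarrow> k = l"
  unfolding homogeneous_iff by (metis keys_eq_empty equals0I)

text \<open>Elementary symmetric function of the values \<open>a c\<close>, taken as a coefficient
  of the product of the factors 1 + (a c) t, the shape in which the total Steenrod operation
  delivers it.\<close>

definition esum :: "('i \<Rightarrow> 'b::comm_ring_1) \<Rightarrow> 'i set \<Rightarrow> nat \<Rightarrow> 'b" where
  "esum a N i = coeff (\<Prod>c\<in>N. [:1, a c:]) i"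

lemma esum_empty: "esum a {} i = (if i = 0 then 1 else 0)"
  by (simp add: esum_def)

lemma esum_insert:
  "finite N \<Longrightarrow> c \<notin> N \<Longrightarrow>
    esum a (insert c N) i = esum a N i + (if i = 0 then 0 else a c * esum a N (i - 1))"
  by (cases i) (auto simp: esum_def)

lemma esum_cong: "(\<And>c. c \<in> N \<Longrightarrow> a c = b c) \<Longrightarrow> esum a N i = esum b N i"
  unfolding esum_def by (intro arg_cong[of _ _ "\<lambda>p. coeff p i"] prod.cong) auto

lemma esum_reindex: "bij_betw h N M \<Longrightarrow> esum (\<lambda>c. a (h c)) N i = esum a M i"
  unfolding esum_def using prod.reindex_bij_betw[of h N M "\<lambda>c. [:1, a c:]"] by simp

lemma (in comm_ring_hom) hom_esum: "finite N \<Longrightarrow> hom (esum a N i) = esum (\<lambda>c. hom (a c)) N i"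
  by (induction N arbitrary: i rule: finite_induct) (simp_all add: esum_empty esum_insert hom_distribs)

text \<open>Factors with \<open>a c = 0\<close> are 1, and the top coefficient of the remaining
  product is the product of the nonzero values.\<close>

lemma esum_top:
  fixes a :: "'i \<Rightarrow> 'b::idom"
  assumes "finite N"
  shows "esum a N (card {c \<in> N. a c \<noteq> 0}) \<noteq> 0"
proof -
  let ?M = "{c \<in> N. a c \<noteq> 0}"
  have top: "finite M \<Longrightarrow> esum a M (card M) = prod a M \<and> (\<forall>j>card M. esum a M j = 0)" for M
    by (induction M rule: finite_induct) (auto simp: esum_empty esum_insert)
  have "(\<Prod>c\<in>N. [:1, a c:]) = (\<Prod>c\<in>?M. [:1, a c:])"
    by (rule prod.mono_neutral_right[OF assms]) auto
  then have "esum a N i = esum a ?M i" for i by (simp add: esum_def)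
  then show ?thesis using top[of ?M] assms by simp
qed

lemma polyring_esum:
  "finite N \<Longrightarrow> (\<And>c. c \<in> N \<Longrightarrow> a c \<in> polyring m) \<Longrightarrow> esum a N i \<in> polyring m"
  by (induction N arbitrary: i rule: finite_induct)
    (auto simp: esum_empty esum_insert polyring_0 polyring_1 intro!: polyring_add polyring_mult)

lemma homogeneous_esum:
  fixes a :: "'i \<Rightarrow> 'a::comm_ring_1 mpoly"
  shows "finite N \<Longrightarrow> (\<And>c. c \<in> N \<Longrightarrow> homogeneous d (a c)) \<Longrightarrow> homogeneous (d * i) (esum a N i)"
proof (induction N arbitrary: i rule: finite_induct)
  case empty
  then show ?case using homogeneous_Const[of "1 :: 'a"] by (simp add: esum_empty homogeneous_0)
next
  case (insert c N)
  then have h: "homogeneous (d * i) (esum a N i)" for i by auto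
  have "homogeneous (d * i) (a c * esum a N (i - 1))" if "i > 0"
  proof -
    have "d * i = d + d * (i - 1)" using that by (cases i) auto
    then show ?thesis using homogeneous_mult[of d "a c" "d * (i - 1)"] insert.prems h by simp
  qed
  then show ?case using insert.hyps h[of i] by (cases "i = 0") (auto simp: esum_insert intro: homogeneous_add)
qed

section \<open>Steenrod quotients and their invariance\<close>

locale orth_setting =
  fixes p r m :: nat and field_type :: "'a::{field,finite} itself"
  assumes prime_p: "prime p" and odd_p: "odd p" and card_a: "CARD('a) = p ^ r" and m_pos: "m \<ge> 1"
begin

lemma fq_algebraI:
  "comm_ring_hom (emb :: 'a \<Rightarrow> 'k::idom) \<Longrightarrow> fq_algebra emb p r CARD('a)"
  by (simp add: fq_algebra_def fq_algebra_axioms_def prime_p odd_p card_a)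

lemma two: "(2 :: 'a) \<noteq> 0"
proof
  assume "(2 :: 'a) = 0"
  then have "(2 :: 'a mpoly) = 0" using Const.hom_numeral[of "num.Bit0 num.One", where ?'a = 'a] by simp
  then show False using fq_algebra.two_neq_0[OF fq_algebraI[OF Const_hom]] by blast
qed

sublocale odd_field field_type
  by unfold_locales (rule two)

sublocale F: fq_algebra "Const :: 'a \<Rightarrow> 'a mpoly" p r "CARD('a)"
  by (rule fq_algebraI[OF Const_hom])

lemma power_card_minus_1:
  fixes t :: 'a
  assumes "t \<noteq> 0" shows "t ^ (CARD('a) - 1) = 1"
proof -
  have "t * t ^ (CARD('a) - 1) = t * 1"
    using power_card_eq_self[of t] F.q_pos by (metis Suc_diff_1 mult.right_neutral power_Suc)
  then show ?thesis using assms by simp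
qed

lemma steenrod_total_hom: "comm_ring_hom (steenrod_total :: 'a mpoly \<Rightarrow> _)"
proof -
  have "comm_ring_hom (\<lambda>c :: 'a. [:Const c:])"
    by unfold_locales (auto simp: hom_distribs one_pCons)
  then show ?thesis unfolding steenrod_total_def[abs_def] by (rule comm_ring_hom.mpoly_eval_hom)
qed

text \<open>Frobenius is linear over \<open>F\<^sub>q\<close>, so a linear form l goes to l + l^q t,
  which factors as l (1 + l^(q-1) t).\<close>

lemma steenrod_total_lin:
  "steenrod_total (lin m c) = [:lin m c:] * [:1, lin m (c :: nat \<Rightarrow> 'a) ^ (CARD('a) - 1):]"
proof -
  interpret st: comm_ring_hom "steenrod_total :: 'a mpoly \<Rightarrow> _" by (rule steenrod_total_hom)
  have hom: "comm_ring_hom (\<lambda>c :: 'a. [:Const c:])"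
    by unfold_locales (auto simp: hom_distribs one_pCons)
  have Const: "steenrod_total (Const a) = [:Const a:]" for a :: 'a
    by (simp add: steenrod_total_def comm_ring_hom.mpoly_eval_Const[OF hom])
  have Var: "steenrod_total (Var k :: 'a mpoly) = [:Var k, Var k ^ CARD('a):]" for k
    by (simp add: steenrod_total_def comm_ring_hom.mpoly_eval_Var[OF hom])
  have "steenrod_total (lin m c) = (\<Sum>j<2 * m. [:Const (c j) * Var j, Const (c j) * Var j ^ CARD('a):])"
    by (simp add: lin_def st.hom_sum st.hom_mult Const Var mult.commute[of "Const _"])
  also have "\<dots> = [:\<Sum>j<2 * m. Const (c j) * Var j, \<Sum>j<2 * m. Const (c j) * Var j ^ CARD('a):]"
    by (induction m) (simp_all, (simp add: add.assoc)?)
  also have "(\<Sum>j<2 * m. Const (c j) * Var j ^ CARD('a)) = lin m c ^ CARD('a)"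
    using F.frob_sum[of "\<lambda>j. Const (c j) * Var j" "{..<2 * m}" 1] F.frob_emb[of _ 1]
    by (simp add: lin_def power_mult_distrib)
  also have "lin m c ^ CARD('a) = lin m c * lin m c ^ (CARD('a) - 1)"
    using F.q_pos by (metis Suc_diff_1 power_Suc)
  finally show ?thesis by (simp add: lin_def)
qed

text \<open>The exponent makes this insensitive to nonzero scalars, hence a function of the
  projective point.\<close>

definition pt :: "(nat \<Rightarrow> 'a) \<Rightarrow> 'a mpoly" where
  "pt c = lin m c ^ (CARD('a) - 1)"

lemma steenrod_u_poly: "steenrod i (u_poly m :: 'a mpoly) = u_poly m * esum pt (iso_pts m) i"
proof -
  interpret st: comm_ring_hom "steenrod_total :: 'a mpoly \<Rightarrow> _" by (rule steenrod_total_hom)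
  have "steenrod_total (u_poly m :: 'a mpoly) =
      (\<Prod>c\<in>iso_pts m. [:lin m c:]) * (\<Prod>c\<in>iso_pts m. [:1, pt c:])"
    unfolding u_poly_eq st.hom_prod steenrod_total_lin pt_def by (rule prod.distrib)
  also have "(\<Prod>c\<in>iso_pts m. [:lin m (c :: nat \<Rightarrow> 'a):]) = [:u_poly m:]"
    unfolding u_poly_eq by (induction rule: infinite_finite_induct) (auto simp: one_pCons)
  finally show ?thesis by (simp add: steenrod_def esum_def)
qed

lemma u_poly_nonzero: "u_poly m \<noteq> (0 :: 'a mpoly)"
proof -
  have "lin m c \<noteq> 0" if c: "c \<in> iso_pts m" for c :: "nat \<Rightarrow> 'a"
  proof -
    obtain k where "c k = 1" using c by (auto simp: iso_pts_def monic_at_def)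
    then have "c \<noteq> (\<lambda>_. 0)" by auto
    then show ?thesis using c by (simp add: lin_eq_0_iff iso_pts_def)
  qed
  then show ?thesis unfolding u_poly_eq using finite_iso_pts by (simp add: prod_zero_iff)
qed

lemma d_poly_eq: "d_poly i m = (esum pt (iso_pts m) (e_exp CARD('a) i m) :: 'a mpoly)"
  unfolding d_poly_def steenrod_u_poly
proof (rule the_equality)
  show "esum pt (iso_pts m) (e_exp CARD('a) i m) \<in> polyring m \<and>
    u_poly m * esum pt (iso_pts m) (e_exp CARD('a) i m) = u_poly m * esum pt (iso_pts m) (e_exp CARD('a) i m)"
    unfolding pt_def by (auto intro!: polyring_esum polyring_power polyring_lin finite_iso_pts)
qed (use u_poly_nonzero in auto)

lemma polyring_d_poly: "d_poly i m \<in> (polyring m :: 'a mpoly set)"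
  unfolding d_poly_eq pt_def by (intro polyring_esum polyring_power polyring_lin finite_iso_pts)

lemma homogeneous_d_poly: "homogeneous ((CARD('a) - 1) * e_exp CARD('a) i m) (d_poly i m :: 'a mpoly)"
  unfolding d_poly_eq pt_def
  using homogeneous_power[OF homogeneous_lin] by (intro homogeneous_esum finite_iso_pts) auto

text \<open>\<open>g\<close> permutes the isotropic lines, and \<open>pt\<close> does not see the
  scalars by which the images differ from monic representatives, so symmetric functions of all its
  values are fixed.\<close>

lemma act_d_poly:
  assumes g: "g \<in> (orth_group m :: 'a mat set)"
  shows "act m g (d_poly i m) = d_poly i m"
proof -
  interpret act: comm_ring_hom "act m g" by (rule act_hom)
  \<comment> \<open>Row action of \<open>g\<close>, set to zero beyond the variables so that it
    stays in \<open>vecs\<close>.\<close>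
  let ?h = "\<lambda>c j. if j < 2 * m then \<Sum>k<2 * m. c k * g $$ (k, j) else 0"
  have h_bform: "bform m (?h c) (?h d) = bform m c d" for c d
  proof -
    have "bform m (?h c) (?h d) = bform m (\<lambda>j. \<Sum>k<2 * m. g $$ (k, j) * c k) (\<lambda>j. \<Sum>k<2 * m. g $$ (k, j) * d k)"
      unfolding bform_def by (intro sum.cong refl) (auto simp: mult.commute)
    also have "\<dots> = bform m c d"
      by (rule bform_mult_preserved) (rule orth_rows[OF g])
    finally show ?thesis .
  qed
  have h_qform: "qform m (?h c) = qform m c" for c
    using h_bform[of c c] two by (simp add: bform_self)
  have h_vecs: "?h c \<in> vecs {..<2 * m}" for c by (auto simp: vecs_def)
  have h_lin: "act m g (lin m c) = lin m (?h c)" for c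
    unfolding act_lin by (auto simp: lin_def)
  have h_inj: "c = d" if "c \<in> vecs {..<2 * m}" "d \<in> vecs {..<2 * m}" "?h c = ?h d" for c d
  proof
    fix j show "c j = d j"
    proof (cases "j < 2 * m")
      case True
      then have "2 * m - 1 - j < 2 * m" by auto
      moreover have "bform m c (unit (2 * m - 1 - j)) = bform m d (unit (2 * m - 1 - j))"
        using h_bform[of c] h_bform[of d] that(3) by metis
      ultimately show ?thesis using True by (simp add: bform_unit_right)
    qed (use that in \<open>auto simp: vecs_def\<close>)
  qed
  have "\<exists>t d. t \<noteq> 0 \<and> d \<in> iso_pts m \<and> ?h c = (\<lambda>j. t * d j)" if c: "c \<in> iso_pts m" for c
  proof -
    have "?h c \<noteq> (\<lambda>_. 0)"
    proof
      assume "?h c = (\<lambda>_. 0)"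
      also have "\<dots> = ?h (\<lambda>_. 0)" by auto
      finally have "c = (\<lambda>_. 0)" using h_inj[of c "\<lambda>_. 0"] c by (auto simp: iso_pts_def vecs_def)
      then show False using c by (auto simp: iso_pts_def monic_at_def)
    qed
    then obtain k where k: "?h c k \<noteq> 0" by blast
    then have k2: "k < 2 * m" by (meson)
    obtain l t where l: "l \<le> k" "t \<noteq> 0" "monic_at l (\<lambda>i. ?h c i / t)"
      using ex_monic_scale[of "?h c" k, OF k] by blast
    let ?d = "\<lambda>i. ?h c i / t"
    have hd: "?h c = (\<lambda>j. t * ?d j)" using l by auto
    have "qform m (?h c) = t ^ 2 * qform m ?d" by (subst hd) (rule qform_scale)
    then have "qform m ?d = 0" using h_qform[of c] c l by (auto simp: iso_pts_def)
    moreover have "?d \<in> vecs {..<2 * m}" by (auto simp: vecs_def)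
    moreover have "l < 2 * m" using l(1) k2 by linarith
    ultimately have "?d \<in> iso_pts m" using l(3) unfolding iso_pts_def by blast
    then show ?thesis using hd l(2) by blast
  qed
  then have "\<forall>c\<in>iso_pts m. \<exists>x. fst x \<noteq> 0 \<and> snd x \<in> iso_pts m \<and> ?h c = (\<lambda>j. fst x * snd x j)"
    by simp
  from bchoice[OF this] obtain x where
    x: "\<forall>c\<in>iso_pts m. fst (x c) \<noteq> 0 \<and> snd (x c) \<in> iso_pts m \<and> ?h c = (\<lambda>j. fst (x c) * snd (x c) j)"
    by blast
  \<comment> \<open>\<open>s c\<close> is the monic representative of the image line and
    \<open>t c\<close> the scalar that carries it to the image of \<open>c\<close>.\<close>
  define t s where "t = (\<lambda>c. fst (x c))" and "s = (\<lambda>c. snd (x c))"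
  have s: "t c \<noteq> 0 \<and> s c \<in> iso_pts m \<and> ?h c = (\<lambda>j. t c * s c j)" if "c \<in> iso_pts m" for c
    using x that unfolding t_def s_def by blast
  have "inj_on s (iso_pts m)"
  proof (rule inj_onI)
    fix c d assume cd: "c \<in> iso_pts m" "d \<in> iso_pts m" "s c = s d"
    \<comment> \<open>If the image lines agree, cross-multiplying by the scalars makes the images
      equal, so that injectivity of the row action applies.\<close>
    have "?h (\<lambda>j. t d * c j) j = ?h (\<lambda>j. t c * d j) j" for j
    proof -
      have "?h (\<lambda>j. t d * c j) j = t d * ?h c j" by (simp add: sum_distrib_left mult.assoc)
      also have "?h c j = t c * s d j" using s[OF cd(1)] cd(3) by (metis (no_types, lifting))
      also have "t d * (t c * s d j) = t c * (t d * s d j)" by (rule mult.left_commute)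
      also have "t d * s d j = ?h d j" using s[OF cd(2)] by (metis (no_types, lifting))
      also have "t c * ?h d j = ?h (\<lambda>j. t c * d j) j" by (simp add: sum_distrib_left mult.assoc)
      finally show ?thesis .
    qed
    then have "?h (\<lambda>j. t d * c j) = ?h (\<lambda>j. t c * d j)" by (rule ext)
    then have "(\<lambda>j. t d * c j) = (\<lambda>j. t c * d j)"
      by (rule h_inj[rotated 2]) (use cd in \<open>auto simp: iso_pts_def vecs_def\<close>)
    then have eq: "t d * c j = t c * d j" for j by meson
    obtain k l where "monic_at k c" "monic_at l d" using cd by (auto simp: iso_pts_def)
    then show "c = d" using monic_at_scale_inj[of k c l d "t d" "t c"] eq s[OF cd(1)] s[OF cd(2)] by blast
  qed
  then have "bij_betw s (iso_pts m) (iso_pts m)"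
    using endo_inj_surj[OF finite_iso_pts, of s m] s unfolding bij_betw_def by blast
  moreover have "act m g (pt c) = pt (s c)" if "c \<in> iso_pts m" for c
  proof -
    have "act m g (pt c) = (Const (t c) * lin m (s c)) ^ (CARD('a) - 1)"
      unfolding pt_def act.hom_power h_lin lin_scale[symmetric] using s[OF that] by simp
    also have "\<dots> = Const (t c ^ (CARD('a) - 1)) * pt (s c)"
      by (simp add: pt_def power_mult_distrib hom_distribs)
    finally show ?thesis using s[OF that] power_card_minus_1[of "t c"] by simp
  qed
  ultimately show ?thesis
    unfolding d_poly_eq act.hom_esum[OF finite_iso_pts]
    using esum_reindex[of s "iso_pts m" "iso_pts m" pt] esum_cong[of "iso_pts m" "\<lambda>c. act m g (pt c)" "\<lambda>c. pt (s c)"]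
    by simp
qed

text \<open>A Frobenius power of a linear form has the same coefficients in the powers of the
  variables, so \<open>g\<close> acts by one matrix on the generic point and on its twist.\<close>

lemma act_xi:
  assumes g: "g \<in> (orth_group m :: 'a mat set)"
  shows "act m g (xi m i) = xi m i"
proof (cases "i = 1")
  case True
  then show ?thesis using g by (simp add: orth_group_def)
next
  case False
  interpret act: comm_ring_hom "act m g" by (rule act_hom)
  let ?Q = "CARD('a) ^ (i - 1)"
  have G: "(\<Sum>l<2 * m. Const (g $$ (l, i)) * Const (g $$ (2 * m - 1 - l, j))) = (if i = 2 * m - 1 - j then 1 else 0)"
    if "i < 2 * m" "j < 2 * m" for i j
    using orth_columns[OF g that] by (simp add: Const.hom_sum[symmetric] Const.hom_mult[symmetric])
  have "lin m c ^ ?Q = (\<Sum>j<2 * m. Const (c j) * Var j ^ ?Q)" for c :: "nat \<Rightarrow> 'a"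
    unfolding lin_def F.frob_sum power_mult_distrib F.frob_emb ..
  then have "act m g (xi m i) = bform m (\<lambda>k. \<Sum>j<2 * m. Const (g $$ (k, j)) * Var j)
      (\<lambda>k. \<Sum>j<2 * m. Const (g $$ (k, j)) * Var j ^ ?Q)"
    unfolding bform_Var[OF False, symmetric] act.hom_bform act.hom_power act_Var by (simp add: lin_def)
  also have "\<dots> = xi m i"
    unfolding bform_Var[OF False, symmetric] by (rule bform_mult_preserved) (rule G)
  finally show ?thesis .
qed

lemma Hsys_invariants: "Hsys m \<subseteq> (invariants m :: 'a mpoly set)"
  by (auto simp: Hsys_def invariants_def polyring_xi polyring_d_poly act_xi act_d_poly)

end

section \<open>Finite generation and common zeros\<close>

definition prime_set :: "'r::comm_ring_1 set \<Rightarrow> bool" where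
  "prime_set P \<longleftrightarrow> module_over UNIV P \<and> 1 \<notin> P \<and> (\<forall>a b. a * b \<in> P \<longrightarrow> a \<in> P \<or> b \<in> P)"

lemma module_over_plus_multiples:
  assumes "module_over UNIV M"
  shows "module_over UNIV {y + c * a | y c. y \<in> M}"
  unfolding module_over_def
proof (intro conjI ballI)
  show "0 \<in> {y + c * a | y c. y \<in> M}"
    using module_overD(1)[OF assms] by (intro CollectI exI[of _ 0]) simp
next
  fix u v assume "u \<in> {y + c * a | y c. y \<in> M}" "v \<in> {y + c * a | y c. y \<in> M}"
  then obtain y c z d where "y \<in> M" "z \<in> M" "u = y + c * a" "v = z + d * a" by blast
  then have "y + z \<in> M" "u + v = (y + z) + (c + d) * a"
    using module_overD(2)[OF assms] by (auto simp: algebra_simps)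
  then show "u + v \<in> {y + c * a | y c. y \<in> M}" by blast
next
  fix b u assume "u \<in> {y + c * a | y c. y \<in> M}"
  then obtain y c where "y \<in> M" "u = y + c * a" by blast
  then have "b * y \<in> M" "b * u = b * y + (b * c) * a"
    using module_overD(3)[OF assms] by (auto simp: algebra_simps)
  then show "b * u \<in> {y + c * a | y c. y \<in> M}" by blast
qed

text \<open>An ideal maximal among those containing \<open>I\<close> and no power of
  \<open>x\<close> is prime: enlarging it by an outside element brings in a power of
  \<open>x\<close>, and for two outside elements with product inside, the two powers multiply into
  the ideal.\<close>

lemma ex_prime_avoiding_powers:
  fixes I :: "'r::comm_ring_1 set"
  assumes I: "module_over UNIV I" "\<And>n. x ^ n \<notin> I"
  shows "\<exists>P. prime_set P \<and> I \<subseteq> P \<and> x \<notin> P"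
proof -
  define S where "S = {J. module_over UNIV J \<and> I \<subseteq> J \<and> (\<forall>n. x ^ n \<notin> J)}"
  have IS: "I \<in> S" using I by (auto simp: S_def)
  have "\<exists>M\<in>S. \<forall>X\<in>S. M \<subseteq> X \<longrightarrow> X = M"
  proof (rule subset_Zorn_nonempty)
    show "S \<noteq> {}" using IS by blast
    fix C assume C: "C \<noteq> {}" "subset.chain S C"
    then have CS: "J \<in> S" if "J \<in> C" for J using that by (auto simp: subset.chain_def)
    have "module_over UNIV (\<Union>C)"
      unfolding module_over_def
    proof (intro conjI ballI)
      obtain J where J: "J \<in> C" using C(1) by blast
      then have "0 \<in> J" using CS[OF J] by (auto simp: S_def module_over_def)
      then show "0 \<in> \<Union>C" using J by blast
    next
      fix u v assume "u \<in> \<Union>C" "v \<in> \<Union>C"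
      then obtain J J' where J: "J \<in> C" "J' \<in> C" "u \<in> J" "v \<in> J'" by blast
      then have "J \<subseteq> J' \<or> J' \<subseteq> J" using C(2) by (auto simp: subset.chain_def)
      then obtain K where "K \<in> C" "u \<in> K" "v \<in> K" using J by blast
      then show "u + v \<in> \<Union>C" using CS[of K] by (auto simp: S_def module_over_def)
    next
      fix a u assume "u \<in> \<Union>C"
      then obtain J where J: "J \<in> C" "u \<in> J" by blast
      then have "a * u \<in> J" using CS[of J] by (auto simp: S_def module_over_def)
      then show "a * u \<in> \<Union>C" using J by blast
    qed
    moreover have "I \<subseteq> \<Union>C" using C(1) CS by (auto simp: S_def)
    moreover have "x ^ n \<notin> \<Union>C" for n using CS by (auto simp: S_def)
    ultimately show "\<Union>C \<in> S" by (simp add: S_def)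
  qed
  then obtain M where M: "M \<in> S" and max: "\<And>X. X \<in> S \<Longrightarrow> M \<subseteq> X \<Longrightarrow> X = M" by blast
  have mod: "module_over UNIV M" and pw: "\<And>n. x ^ n \<notin> M" using M by (auto simp: S_def)
  have reach: "\<exists>n y c. y \<in> M \<and> x ^ n = y + c * a" if a: "a \<notin> M" for a
  proof (rule ccontr)
    assume none: "\<not> ?thesis"
    let ?X = "{y + c * a | y c. y \<in> M}"
    have sub: "M \<subseteq> ?X"
    proof
      fix y assume "y \<in> M"
      moreover have "y = y + 0 * a" by simp
      ultimately show "y \<in> ?X" by blast
    qed
    have "?X \<in> S"
      using module_over_plus_multiples[OF mod, of a] sub M none unfolding S_def by blast
    then have "?X = M" using max sub by blast
    moreover have "0 + 1 * a \<in> ?X" using module_overD(1)[OF mod] by blast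
    ultimately show False using a by simp
  qed
  have "a \<in> M \<or> b \<in> M" if ab: "a * b \<in> M" for a b
  proof (rule ccontr)
    assume "\<not> (a \<in> M \<or> b \<in> M)"
    then obtain n y c k z d where y: "y \<in> M" "x ^ n = y + c * a" and z: "z \<in> M" "x ^ k = z + d * b"
      using reach[of a] reach[of b] by blast
    have "x ^ (n + k) = (y + c * a) * (z + d * b)" by (simp only: power_add y z)
    also have "\<dots> = (z + d * b) * y + ((c * a) * z + (c * d) * (a * b))" by (simp add: algebra_simps)
    finally have "x ^ (n + k) = \<dots>" .
    moreover have "(z + d * b) * y \<in> M" "(c * a) * z \<in> M" "(c * d) * (a * b) \<in> M"
      using module_overD(3)[OF mod] y z ab by blast+
    ultimately have "x ^ (n + k) \<in> M" using module_overD(2)[OF mod] by metis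
    then show False using pw by blast
  qed
  then have "prime_set M" using mod pw[of 0] by (auto simp: prime_set_def)
  moreover have "I \<subseteq> M" "x \<notin> M" using M pw[of 1] by (auto simp: S_def)
  ultimately show ?thesis by blast
qed

text \<open>The type has infinitely many variables, and the coefficients in
  \<open>lin_hull UNIV X\<close> may use any of them. Besides selecting a degree, this discards
  monomials with a variable of index at least \<open>2 * m\<close> and so returns to
  \<open>polyring m\<close>.\<close>

definition homog_part :: "nat \<Rightarrow> nat \<Rightarrow> 'a::comm_ring_1 mpoly \<Rightarrow> 'a mpoly" where
  "homog_part m d f = (\<Sum>\<mu>\<in>Poly_Mapping.keys f.
     if Poly_Mapping.keys \<mu> \<subseteq> {..<2 * m} \<and> mdeg \<mu> = d then Poly_Mapping.single \<mu> (Poly_Mapping.lookup f \<mu>) else 0)"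

lemma homog_part_add: "homog_part m d (f + g) = homog_part m d f + homog_part m d g"
  unfolding homog_part_def by (rule setsum_keys_plus_distrib) (auto simp: single_add)

lemma homog_part_id:
  "(\<And>\<mu>. \<mu> \<in> Poly_Mapping.keys f \<Longrightarrow> Poly_Mapping.keys \<mu> \<subseteq> {..<2 * m} \<and> mdeg \<mu> = d) \<Longrightarrow> homog_part m d f = f"
  unfolding homog_part_def by (subst (3) poly_mapping_decomp) (auto intro!: sum.cong)

lemma homog_part_zero:
  "(\<And>\<mu>. \<mu> \<in> Poly_Mapping.keys f \<Longrightarrow> \<not> (Poly_Mapping.keys \<mu> \<subseteq> {..<2 * m} \<and> mdeg \<mu> = d)) \<Longrightarrow> homog_part m d f = 0"
  unfolding homog_part_def by (intro sum.neutral ballI if_not_P) blast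

lemma keys_add_nat: "Poly_Mapping.keys (\<mu> + \<nu> :: nat \<Rightarrow>\<^sub>0 nat) = Poly_Mapping.keys \<mu> \<union> Poly_Mapping.keys \<nu>"
  by (auto simp: in_keys_iff lookup_add)

lemma single_eq_Const_mult: "Poly_Mapping.single \<mu> c = Const c * (Poly_Mapping.single \<mu> 1 :: 'a::comm_ring_1 mpoly)"
  by (simp add: Const_def mult_single)

lemma finite_bounded_monomials:
  "finite {\<mu> :: nat \<Rightarrow>\<^sub>0 nat. Poly_Mapping.keys \<mu> \<subseteq> {..<n} \<and> (\<forall>k. Poly_Mapping.lookup \<mu> k < N)}" (is "finite ?M")
proof -
  have "Poly_Mapping.lookup ` ?M \<subseteq> {f. \<forall>x. (x \<in> {..<n} \<longrightarrow> f x \<in> {..<N}) \<and> (x \<notin> {..<n} \<longrightarrow> f x = 0)}"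
    by (auto simp: in_keys_iff)
  then have "finite (Poly_Mapping.lookup ` ?M)"
    by (rule finite_subset) (rule finite_set_of_finite_funs; simp)
  moreover have "inj_on Poly_Mapping.lookup ?M" by (auto intro: inj_onI simp: poly_mapping_eqI)
  ultimately show ?thesis by (rule finite_imageD)
qed

text \<open>
  Graded Nakayama: a monomial with a large exponent lies in the ideal of \<open>X\<close>, and its part of the
  right degree expresses it through monomials of smaller degree.
\<close>

lemma finitely_generated_over_parameters:
  fixes X :: "'a::comm_ring_1 mpoly set"
  assumes X: "X \<subseteq> polyring m" "\<And>h. h \<in> X \<Longrightarrow> \<exists>d>0. homogeneous d h"
    and nilp: "\<And>k. k < 2 * m \<Longrightarrow> \<exists>n. Var k ^ n \<in> lin_hull UNIV X"
  shows "\<exists>B. finite B \<and> B \<subseteq> polyring m \<and> polyring m \<subseteq> lin_hull (gen_subalgebra X) B"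
proof -
  let ?A = "gen_subalgebra X"
  have A: "subring_set ?A" by (rule gen_subalgebra_subring)
  have I: "module_over UNIV (lin_hull UNIV X)" by (rule lin_hull_module) (simp add: subring_set_def)
  have "\<exists>N. \<forall>k<j. Var k ^ N \<in> lin_hull UNIV X" if "j \<le> 2 * m" for j
    using that
  proof (induction j)
    case (Suc j)
    then obtain N n where N: "\<forall>k<j. Var k ^ N \<in> lin_hull UNIV X" "Var j ^ n \<in> lin_hull UNIV X"
      using nilp[of j] by auto
    have "Var k ^ (N + n) \<in> lin_hull UNIV X" if "k < Suc j" for k
    proof (cases "k = j")
      case True
      then show ?thesis using module_overD(3)[OF I, of "Var j ^ N"] N(2) by (simp add: power_add)
    next
      case False
      then show ?thesis using module_overD(3)[OF I, of "Var k ^ n"] N(1) that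
        by (simp add: power_add mult.commute)
    qed
    then show ?case by blast
  qed simp
  then obtain N0 where N0: "\<forall>k<2 * m. Var k ^ N0 \<in> lin_hull UNIV X" by blast
  \<comment> \<open>The successor makes the bound positive, so that an exponent reaching it belongs
    to a variable that occurs in the monomial.\<close>
  define N where "N = Suc N0"
  have N: "Var k ^ N \<in> lin_hull UNIV X" if "k < 2 * m" for k
    unfolding N_def power_Suc using N0 that module_overD(3)[OF I] by blast
  define B where "B = (\<lambda>\<mu>. Poly_Mapping.single \<mu> (1 :: 'a)) `
    {\<mu>. Poly_Mapping.keys \<mu> \<subseteq> {..<2 * m} \<and> (\<forall>k. Poly_Mapping.lookup \<mu> k < N)}"
  let ?H = "lin_hull ?A B"
  have H: "module_over ?A ?H" by (rule lin_hull_module[OF A])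
  have CH: "Const c * f \<in> ?H" if "f \<in> ?H" for c f
    using that module_overD(3)[OF H] gen_subalgebra.const by blast
  have mono: "Poly_Mapping.single \<mu> 1 \<in> ?H" if "Poly_Mapping.keys \<mu> \<subseteq> {..<2 * m}" for \<mu>
    using that
  proof (induction "mdeg \<mu>" arbitrary: \<mu> rule: less_induct)
    case less
    show ?case
    proof (cases "\<forall>k. Poly_Mapping.lookup \<mu> k < N")
      case True
      then have "Poly_Mapping.single \<mu> 1 \<in> B" using less.prems by (auto simp: B_def)
      then show ?thesis by (rule lin_hull_base[OF A])
    next
      case False
      then obtain k where k: "N \<le> Poly_Mapping.lookup \<mu> k" by (auto simp: not_less)
      then have km: "k < 2 * m" using less.prems by (auto simp: N_def in_keys_iff subset_iff)
      define \<nu> where "\<nu> = \<mu> - Poly_Mapping.single k N"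
      have \<mu>: "\<mu> = Poly_Mapping.single k N + \<nu>"
        by (rule poly_mapping_eqI) (use k in \<open>auto simp: \<nu>_def lookup_add lookup_minus lookup_single when_def\<close>)
      \<comment> \<open>As \<open>h\<close> has positive degree, the monomials of \<open>a\<close>
        that contribute have smaller degree than \<open>\<mu>\<close> and are covered by the
        induction hypothesis.\<close>
      have step: "homog_part m (mdeg \<mu>) (a * h) \<in> ?H" if h: "h \<in> X" for a h
      proof (induction a rule: poly_mapping_add_induct)
        case zero
        then show ?case using lin_hull.zero by (simp add: homog_part_def)
      next
        case (single \<alpha> c)
        obtain d where d: "d > 0" "homogeneous d h" using X(2)[OF h] by blast
        have keys: "\<exists>\<beta>\<in>Poly_Mapping.keys h. \<gamma> = \<alpha> + \<beta>"
          if "\<gamma> \<in> Poly_Mapping.keys (Poly_Mapping.single \<alpha> c * h)" for \<gamma>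
          using that keys_mult[of "Poly_Mapping.single \<alpha> c" h] by (auto split: if_splits)
        show ?case
        proof (cases "Poly_Mapping.keys \<alpha> \<subseteq> {..<2 * m} \<and> mdeg \<alpha> + d = mdeg \<mu>")
          case True
          have "homog_part m (mdeg \<mu>) (Poly_Mapping.single \<alpha> c * h) = Poly_Mapping.single \<alpha> c * h"
          proof (rule homog_part_id)
            fix \<gamma> assume "\<gamma> \<in> Poly_Mapping.keys (Poly_Mapping.single \<alpha> c * h)"
            then obtain \<beta> where \<beta>: "\<beta> \<in> Poly_Mapping.keys h" "\<gamma> = \<alpha> + \<beta>" using keys by blast
            moreover have "Poly_Mapping.keys \<beta> \<subseteq> {..<2 * m}" using X(1) h \<beta> by (auto simp: polyring_def)
            ultimately show "Poly_Mapping.keys \<gamma> \<subseteq> {..<2 * m} \<and> mdeg \<gamma> = mdeg \<mu>"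
              using True d(2) by (auto simp: keys_add_nat mdeg_add homogeneous_iff)
          qed
          also have "\<dots> = h * (Const c * Poly_Mapping.single \<alpha> 1)"
            by (subst single_eq_Const_mult) (simp add: mult.commute)
          also have "\<dots> \<in> ?H"
          proof -
            have "Poly_Mapping.single \<alpha> 1 \<in> ?H" using less.hyps[of \<alpha>] True d(1) by auto
            then show ?thesis using CH module_overD(3)[OF H] gen_subalgebra.gen[OF h] by blast
          qed
          finally show ?thesis .
        next
          case False
          have "homog_part m (mdeg \<mu>) (Poly_Mapping.single \<alpha> c * h) = 0"
          proof (rule homog_part_zero)
            fix \<gamma> assume "\<gamma> \<in> Poly_Mapping.keys (Poly_Mapping.single \<alpha> c * h)"
            then obtain \<beta> where \<beta>: "\<beta> \<in> Poly_Mapping.keys h" "\<gamma> = \<alpha> + \<beta>" using keys by blast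
            then show "\<not> (Poly_Mapping.keys \<gamma> \<subseteq> {..<2 * m} \<and> mdeg \<gamma> = mdeg \<mu>)"
              using False d(2) by (auto simp: keys_add_nat mdeg_add homogeneous_iff)
          qed
          then show ?thesis using lin_hull.zero by simp
        qed
      next
        case (add f g)
        then show ?case by (simp add: distrib_right homog_part_add lin_hull_add)
      qed
      have part: "homog_part m (mdeg \<mu>) f \<in> ?H" if "f \<in> lin_hull UNIV X" for f
        using that
      proof (induction rule: lin_hull.induct)
        case zero
        then show ?case using lin_hull.zero by (simp add: homog_part_def)
      qed (auto simp: homog_part_add intro: lin_hull_add step)
      have "Poly_Mapping.single \<mu> (1 :: 'a) = Poly_Mapping.single \<nu> 1 * Var k ^ N"
        by (simp add: Var_power mult_single \<mu> add.commute)
      then have "Poly_Mapping.single \<mu> (1 :: 'a) \<in> lin_hull UNIV X"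
        using module_overD(3)[OF I, of "Poly_Mapping.single \<nu> 1"] N[OF km] by simp
      moreover have "homog_part m (mdeg \<mu>) (Poly_Mapping.single \<mu> (1 :: 'a)) = Poly_Mapping.single \<mu> 1"
        by (rule homog_part_id) (use less.prems in auto)
      ultimately show ?thesis using part by metis
    qed
  qed
  have "f \<in> ?H" if "f \<in> polyring m" for f
  proof -
    have "finite K \<Longrightarrow> K \<subseteq> Poly_Mapping.keys f \<Longrightarrow>
        (\<Sum>\<mu>\<in>K. Poly_Mapping.single \<mu> (Poly_Mapping.lookup f \<mu>)) \<in> ?H" for K
    proof (induction K rule: finite_induct)
      case (insert \<mu> K)
      then have "Poly_Mapping.single \<mu> 1 \<in> ?H" using \<open>f \<in> _\<close> mono[of \<mu>] by (auto simp: polyring_def)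
      then have "Poly_Mapping.single \<mu> (Poly_Mapping.lookup f \<mu>) \<in> ?H"
        by (subst single_eq_Const_mult) (rule CH)
      then show ?case using insert by (simp add: lin_hull_add)
    qed (simp add: lin_hull.zero)
    from this[of "Poly_Mapping.keys f"] show ?thesis by (simp flip: poly_mapping_decomp)
  qed
  moreover have "finite B" unfolding B_def by (rule finite_imageI[OF finite_bounded_monomials])
  moreover have "B \<subseteq> polyring m" by (auto simp: B_def polyring_def)
  ultimately show ?thesis by blast
qed

text \<open>Together with \<open>hom_mpoly_eval\<close> this presents every homomorphism out of the
  polynomials as evaluation at the images of the variables, so that a residue map becomes a
  point.\<close>

lemma mpoly_eval_Const_Var: "mpoly_eval Const Var f = (f :: 'a::comm_ring_1 mpoly)"
  unfolding mpoly_eval_alt mon_eval_Var single_eq_Const_mult[symmetric] by (rule poly_mapping_decomp[symmetric])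

lemma comp_hom:
  assumes "comm_ring_hom f" "comm_ring_hom g" shows "comm_ring_hom (\<lambda>x. g (f x))"
proof -
  interpret f: comm_ring_hom f by (rule assms)
  interpret g: comm_ring_hom g by (rule assms)
  show ?thesis by unfold_locales (simp_all add: f.hom_add g.hom_add f.hom_mult g.hom_mult)
qed

lemma to_fract_hom: "comm_ring_hom (to_fract :: 'r::idom \<Rightarrow> 'r fract)"
  by unfold_locales auto

section \<open>Values of the system at a point\<close>

context orth_setting
begin

lemma eval_lin:
  assumes "comm_ring_hom (emb :: 'a \<Rightarrow> 'k::field)"
  shows "mpoly_eval emb v (lin m c) = fq_algebra.val emb m v c"
proof -
  interpret E: fq_algebra emb p r "CARD('a)" by (rule fq_algebraI[OF assms])
  interpret ev: comm_ring_hom "mpoly_eval emb v" by (rule E.mpoly_eval_hom)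
  show ?thesis by (simp add: lin_def E.val_def ev.hom_sum ev.hom_mult)
qed

lemma eval_xi:
  assumes "comm_ring_hom (emb :: 'a \<Rightarrow> 'k::field)"
  shows "mpoly_eval emb v (xi m i) =
    (if i = 1 then qform m v else bform m v (\<lambda>k. v k ^ (CARD('a) ^ (i - 1))))"
proof -
  interpret E: comm_ring_hom emb by (rule assms)
  interpret ev: comm_ring_hom "mpoly_eval emb v" by (rule E.mpoly_eval_hom)
  show ?thesis
  proof (cases "i = 1")
    case True
    then show ?thesis using ev.hom_qform[of m Var] by (simp add: qform_Var)
  next
    case False
    then show ?thesis
      using ev.hom_bform[of m Var "\<lambda>k. Var k ^ (CARD('a) ^ (i - 1))"] bform_Var[of i m, where ?'a = 'a]
      by (simp add: ev.hom_power)
  qed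
qed

lemma eval_d_poly_nonzero:
  assumes "isotropic_point (emb :: 'a \<Rightarrow> 'k::field) p r CARD('a) m v J u"
  shows "mpoly_eval emb v (d_poly (card J) m) \<noteq> 0"
proof -
  interpret P: isotropic_point emb p r "CARD('a)" m v J u by (rule assms)
  interpret ev: comm_ring_hom "mpoly_eval emb v" by (rule P.mpoly_eval_hom)
  have E: "comm_ring_hom emb" by (rule P.comm_ring_hom_axioms)
  let ?a = "\<lambda>c. P.val m v c ^ (CARD('a) - 1)"
  have "mpoly_eval emb v (pt c) = ?a c" for c
    by (simp add: pt_def ev.hom_power eval_lin[OF E])
  then have "mpoly_eval emb v (d_poly (card J) m) = esum ?a (iso_pts m) (e_exp CARD('a) (card J) m)"
    by (simp add: d_poly_eq ev.hom_esum[OF finite_iso_pts])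
  also have "e_exp CARD('a) (card J) m = card {c \<in> iso_pts m. ?a c \<noteq> 0}"
    using P.card_iso_pts_nonzero[OF m_pos] P.q_gt_1 by simp
  also have "esum ?a (iso_pts m) \<dots> \<noteq> 0" by (rule esum_top[OF finite_iso_pts])
  finally show ?thesis .
qed

lemma only_common_zero:
  assumes hom: "comm_ring_hom (emb :: 'a \<Rightarrow> 'k::field)"
    and zero: "\<And>f. f \<in> Hsys m \<Longrightarrow> mpoly_eval emb v f = 0" and k: "k < 2 * m"
  shows "v k = 0"
proof -
  interpret E: fq_field emb p r "CARD('a)"
    unfolding fq_field_def by (rule fq_algebraI[OF hom])
  let ?q = "CARD('a)"
  have xi0: "mpoly_eval emb v (xi m i) = 0" if "1 \<le> i" "i \<le> m" for i
    using zero that by (auto simp: Hsys_def)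
  \<comment> \<open>The first \<open>m\<close> coordinates and the last \<open>m\<close> in reversed
    order are the two halves of the hyperbolic pairs.\<close>
  have polar: "E.polar {..<m} v (\<lambda>k. v (2 * m - 1 - k)) i = bform m v (\<lambda>k. v k ^ (?q ^ i))" for i
    unfolding E.polar_def bform_def sum_lessThan_double
    by (intro sum.cong refl) (auto simp: mult.commute)
  \<comment> \<open>For \<open>i = 0\<close> the value is twice \<open>\<xi>\<^sub>1\<close>,
    otherwise the member of index \<open>i + 1\<close>; the \<open>m\<close> equations thus cover
    exactly \<open>i < m\<close>.\<close>
  have "E.polar {..<m} v (\<lambda>k. v (2 * m - 1 - k)) i = 0" if "i < m" for i
  proof (cases "i = 0")
    case True
    then show ?thesis using xi0[of 1] m_pos unfolding polar by (simp add: eval_xi[OF hom] bform_self)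
  next
    case False
    then show ?thesis using xi0[of "Suc i"] that unfolding polar by (simp add: eval_xi[OF hom])
  qed
  then have iso: "bform m v (\<lambda>k. v k ^ (?q ^ i)) = 0" for i
    using E.polar_eq_0[of "{..<m}" v "\<lambda>k. v (2 * m - 1 - k)" i] polar by simp
  obtain J where J: "J \<subseteq> {..<2 * m}" "E.fq_indep v J"
    "\<forall>k\<in>{..<2 * m}. \<exists>a. v k = (\<Sum>j\<in>J. emb (a j) * v j)"
    using E.ex_fq_basis[of "{..<2 * m}" v] by auto
  from bchoice[OF J(3)] obtain a where a: "\<forall>k\<in>{..<2 * m}. v k = (\<Sum>j\<in>J. emb (a k j) * v j)" by blast
  have pt: "isotropic_point emb p r ?q m v J (\<lambda>j k. a k j)"
    by unfold_locales (use iso J a in auto)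
  interpret P: isotropic_point emb p r ?q m v J "\<lambda>j k. a k j" by (rule pt)
  have "card J = 0"
  proof (rule ccontr)
    assume "card J \<noteq> 0"
    then have "d_poly (card J) m \<in> (Hsys m :: 'a mpoly set)"
      using P.card_J_le by (auto simp: Hsys_def)
    then show False using zero eval_d_poly_nonzero[OF pt] by blast
  qed
  then have "J = {}" using P.finite_J by simp
  then show ?thesis using a k by auto
qed

end

section \<open>Residue fields\<close>

text \<open>
  A type cannot depend on a prime ideal that occurs inside a proof. If some prime ideal refutes the
  claim that \<open>Hsys m\<close> has no common zero but the origin, one such ideal is fixed once and for all by
  choice, so that its residue ring becomes a type (depending on \<open>'a\<close> only).
\<close>

definition bad_prime :: "'a::{field,finite} mpoly set \<Rightarrow> bool" where
  "bad_prime P \<longleftrightarrow> prime_set P \<and> (\<exists>m k. m \<ge> 1 \<and> Hsys m \<subseteq> P \<and> k < 2 * m \<and> Var k \<notin> P)"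

text \<open>The default \<open>{0}\<close> is prime because polynomials form a domain, so the
  quotient is a domain in either case.\<close>

definition chosen_prime :: "'a::{field,finite} mpoly set" where
  "chosen_prime = (if \<exists>P. bad_prime (P :: 'a mpoly set) then SOME P. bad_prime P else {0})"

lemma prime_chosen_prime: "prime_set (chosen_prime :: 'a::{field,finite} mpoly set)"
proof (cases "\<exists>P. bad_prime (P :: 'a mpoly set)")
  case True
  then have "bad_prime (chosen_prime :: 'a mpoly set)" unfolding chosen_prime_def by (simp add: someI_ex)
  then show ?thesis by (simp add: bad_prime_def)
next
  case False
  then show ?thesis unfolding chosen_prime_def by (auto simp: prime_set_def module_over_def)
qed

lemma chosen_module: "module_over UNIV (chosen_prime :: 'a::{field,finite} mpoly set)"
  using prime_chosen_prime[where ?'a = 'a] by (simp add: prime_set_def)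

lemma chosen_diff: "f \<in> chosen_prime \<Longrightarrow> g \<in> chosen_prime \<Longrightarrow> f - g \<in> chosen_prime"
  by (rule module_over_diff[OF chosen_module]) (auto simp: subring_set_def)

quotient_type (overloaded) 'a residues_mod = "'a::{field,finite} mpoly" / "\<lambda>f g. f - g \<in> chosen_prime"
proof (rule equivpI)
  show "reflp (\<lambda>f g. f - g \<in> (chosen_prime :: 'a mpoly set))"
    using module_overD(1)[OF chosen_module] by (simp add: reflp_def)
  show "symp (\<lambda>f g. f - g \<in> (chosen_prime :: 'a mpoly set))"
    using chosen_diff[OF module_overD(1)[OF chosen_module]] by (metis (no_types, lifting) diff_0 minus_diff_eq sympI)
  show "transp (\<lambda>f g. f - g \<in> (chosen_prime :: 'a mpoly set))"
    using module_overD(2)[OF chosen_module] by (metis (no_types, lifting) diff_add_cancel add_diff_eq transpI)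
qed

abbreviation to_residue :: "'a::{field,finite} mpoly \<Rightarrow> 'a residues_mod" where
  "to_residue \<equiv> abs_residues_mod"

lemma to_residue_eq_iff:
  fixes f g :: "'a::{field,finite} mpoly"
  shows "to_residue f = to_residue g \<longleftrightarrow> f - g \<in> chosen_prime"
  using Quotient3_rel[OF Quotient3_residues_mod, of f g]
    module_overD(1)[OF chosen_module[where ?'a = 'a]] by simp

lemma to_residue_rep: "to_residue (rep_residues_mod a) = a"
  by (rule Quotient3_abs_rep[OF Quotient3_residues_mod])

lemma rep_to_residue: "rep_residues_mod (to_residue f) - f \<in> chosen_prime"
  using to_residue_rep[of "to_residue f"] by (simp add: to_residue_eq_iff)

lemma residue_cases: obtains f where "a = to_residue f"
  using to_residue_rep[of a] by metis

instantiation residues_mod :: ("{field,finite}") idom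
begin

definition "0 = to_residue 0"
definition "1 = to_residue 1"
definition "a + b = to_residue (rep_residues_mod a + rep_residues_mod b)"
definition "- a = to_residue (- rep_residues_mod a)"
definition "a - b = to_residue (rep_residues_mod a - rep_residues_mod b)"
definition "a * b = to_residue (rep_residues_mod a * rep_residues_mod b)"

lemma to_residue_add: "to_residue f + to_residue g = to_residue (f + g)"
proof -
  have "(rep_residues_mod (to_residue f) - f) + (rep_residues_mod (to_residue g) - g) \<in> chosen_prime"
    using module_overD(2)[OF chosen_module] rep_to_residue by blast
  then show ?thesis unfolding plus_residues_mod_def to_residue_eq_iff by (simp add: algebra_simps)
qed

lemma to_residue_diff: "to_residue f - to_residue g = to_residue (f - g)"
proof -
  have "(rep_residues_mod (to_residue f) - f) - (rep_residues_mod (to_residue g) - g) \<in> chosen_prime"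
    using chosen_diff rep_to_residue by blast
  then show ?thesis unfolding minus_residues_mod_def to_residue_eq_iff by (simp add: algebra_simps)
qed

lemma to_residue_uminus: "- to_residue f = to_residue (- f)"
proof -
  have "0 - (rep_residues_mod (to_residue f) - f) \<in> chosen_prime"
    using chosen_diff module_overD(1)[OF chosen_module] rep_to_residue by blast
  then show ?thesis unfolding uminus_residues_mod_def to_residue_eq_iff by (simp add: algebra_simps)
qed

lemma to_residue_mult: "to_residue f * to_residue g = to_residue (f * g)"
proof -
  let ?f = "rep_residues_mod (to_residue f)" and ?g = "rep_residues_mod (to_residue g)"
  have "?g * (?f - f) + f * (?g - g) \<in> chosen_prime"
    using module_overD[OF chosen_module] rep_to_residue by blast
  then show ?thesis unfolding times_residues_mod_def to_residue_eq_iff by (simp add: algebra_simps)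
qed

instance
proof
  fix a b c :: "'a residues_mod"
  obtain f g h where abc: "a = to_residue f" "b = to_residue g" "c = to_residue h"
    using residue_cases by metis
  note simps = abc to_residue_add to_residue_mult to_residue_diff to_residue_uminus
    zero_residues_mod_def one_residues_mod_def
  have prime: "prime_set (chosen_prime :: 'a mpoly set)" by (rule prime_chosen_prime)
  show "a * b * c = a * (b * c)" by (simp add: simps mult.assoc)
  show "a * b = b * a" by (simp add: simps mult.commute)
  show "1 * a = a" by (simp add: simps)
  show "a + b + c = a + (b + c)" by (simp add: simps add.assoc)
  show "a + b = b + a" by (simp add: simps add.commute)
  show "0 + a = a" by (simp add: simps)
  show "- a + a = 0" by (simp add: simps)
  show "a - b = a + - b" by (simp add: simps)
  show "(a + b) * c = a * c + b * c" by (simp add: simps distrib_right)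
  show "a * (b + c) = a * b + a * c" by (simp add: simps distrib_left)
  show "0 * a = 0" "a * 0 = 0" by (simp_all add: simps)
  have "(0 - (0 - 1) :: 'a mpoly) \<notin> chosen_prime" using prime by (simp add: prime_set_def)
  then have "(0 - 1 :: 'a mpoly) \<notin> chosen_prime"
    using chosen_diff[OF module_overD(1)[OF chosen_module]] by blast
  then show "(0 :: 'a residues_mod) \<noteq> 1" by (simp only: simps to_residue_eq_iff not_False_eq_True)
  show "a \<noteq> 0 \<Longrightarrow> b \<noteq> 0 \<Longrightarrow> a * b \<noteq> 0"
    using prime unfolding prime_set_def simps to_residue_eq_iff diff_0_right by blast
qed

end

lemma to_residue_hom: "comm_ring_hom to_residue"
  by unfold_locales
    (simp_all add: to_residue_add to_residue_mult zero_residues_mod_def one_residues_mod_def)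

lemma to_residue_eq_0_iff: "to_residue f = 0 \<longleftrightarrow> f \<in> chosen_prime"
  by (simp add: zero_residues_mod_def to_residue_eq_iff)

context orth_setting
begin

text \<open>A prime refuting the claim makes the chosen prime refute it too, with some
  \<open>m'\<close> and \<open>k'\<close> of its own. Modulo the chosen prime the variables become a
  common zero of \<open>Hsys m'\<close> over a fraction field, nonzero at \<open>k'\<close>, against
  \<open>only_common_zero\<close>.\<close>

lemma no_bad_prime:
  assumes P: "prime_set P" "Hsys m \<subseteq> (P :: 'a mpoly set)" and k: "k < 2 * m"
  shows "Var k \<in> P"
proof (rule ccontr)
  assume "Var k \<notin> P"
  then have "\<exists>P. bad_prime (P :: 'a mpoly set)" using P k m_pos unfolding bad_prime_def by blast
  then have "bad_prime (chosen_prime :: 'a mpoly set)" unfolding chosen_prime_def by (simp add: someI_ex)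
  then obtain m' k' where m': "m' \<ge> 1" "Hsys m' \<subseteq> (chosen_prime :: 'a mpoly set)" "k' < 2 * m'"
    "Var k' \<notin> (chosen_prime :: 'a mpoly set)" by (auto simp: bad_prime_def)
  interpret S: orth_setting p r m' field_type
    using prime_p odd_p card_a m' by unfold_locales
  define \<pi> where "\<pi> f = to_fract (to_residue f)" for f :: "'a mpoly"
  have \<pi>: "comm_ring_hom \<pi>" unfolding \<pi>_def by (rule comp_hom[OF to_residue_hom to_fract_hom])
  interpret \<pi>: comm_ring_hom \<pi> by (rule \<pi>)
  have \<pi>0: "\<pi> f = 0 \<longleftrightarrow> f \<in> chosen_prime" for f by (simp add: \<pi>_def to_residue_eq_0_iff)
  \<comment> \<open>Evaluation at the images of the variables is the residue map itself, so
    vanishing means membership in the chosen prime.\<close>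
  have ev: "mpoly_eval (\<lambda>a. \<pi> (Const a)) (\<lambda>k. \<pi> (Var k)) f = \<pi> f" for f
    using \<pi>.hom_mpoly_eval[of Const Var f] by (simp add: mpoly_eval_Const_Var)
  have "\<pi> (Var k') = 0"
    by (rule S.only_common_zero[OF comp_hom[OF Const_hom \<pi>] _ m'(3)]) (use m'(2) ev \<pi>0 in auto)
  then show False using \<pi>0 m'(4) by blast
qed

lemma Var_nilpotent_mod_Hsys:
  assumes "k < 2 * m"
  shows "\<exists>n. Var k ^ n \<in> lin_hull UNIV (Hsys m :: 'a mpoly set)"
proof (rule ccontr)
  assume none: "\<not> ?thesis"
  have U: "subring_set (UNIV :: 'a mpoly set)" by (simp add: subring_set_def)
  obtain P where "prime_set P" "lin_hull UNIV (Hsys m :: 'a mpoly set) \<subseteq> P" "Var k \<notin> P"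
    using ex_prime_avoiding_powers[OF lin_hull_module[OF U], of "Var k" "Hsys m"] none by blast
  then show False using no_bad_prime[of P k] lin_hull_base[OF U] assms by blast
qed

text \<open>Both claims are tested at the generic point of a totally isotropic subspace: the first
  \<open>i\<close> coordinates are indeterminates, the others zero. All the
  \<open>\<xi>\<^sub>j\<close> vanish there, while \<open>eval_d_poly_nonzero\<close> applies to
  \<open>d_poly i m\<close>.\<close>

lemma d_poly_xi_distinct:
  assumes i: "1 \<le> i" "i \<le> m"
  shows "d_poly i m \<noteq> (0 :: 'a mpoly)" "1 \<le> j \<Longrightarrow> d_poly i m \<noteq> (xi m j :: 'a mpoly)"
proof -
  let ?q = "CARD('a)"
  define emb where "emb a = to_fract (Const a)" for a :: 'a
  define v where "v k = (if k < i then to_fract (Var k :: 'a mpoly) else 0)" for k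
  have hom: "comm_ring_hom emb" unfolding emb_def by (rule comp_hom[OF Const_hom to_fract_hom])
  interpret fr: comm_ring_hom "to_fract :: 'a mpoly \<Rightarrow> _" by (rule to_fract_hom)
  interpret E: fq_field emb p r ?q unfolding fq_field_def by (rule fq_algebraI[OF hom])
  interpret ev: comm_ring_hom "mpoly_eval emb v" by (rule E.mpoly_eval_hom)
  \<comment> \<open>As \<open>i \<le> m\<close>, two paired indices are never both below
    \<open>i\<close>.\<close>
  have vv: "v k * v (2 * m - 1 - k) ^ n = 0" if "n > 0" for k n
    using i that by (auto simp: v_def)
  have iso: "bform m v (\<lambda>k. v k ^ n) = 0" if "n > 0" for n
    unfolding bform_def by (intro sum.neutral ballI vv that)
  have "E.fq_indep v {..<i}"
    unfolding E.fq_indep_def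
  proof (intro allI impI ballI)
    fix a k assume a: "(\<Sum>k<i. emb (a k) * v k) = 0" and k: "k \<in> {..<i}"
    let ?c = "\<lambda>k. if k < i then a k else 0"
    have "(\<Sum>k<i. emb (a k) * v k) = to_fract (\<Sum>k<i. Const (a k) * Var k)"
      by (simp add: emb_def v_def fr.hom_sum)
    also have "(\<Sum>k<i. Const (a k) * Var k) = lin m ?c"
      unfolding lin_def using i by (intro sum.mono_neutral_cong_left) auto
    finally have "lin m ?c = 0" using a by simp
    then have "?c = (\<lambda>_. 0)" using i by (subst (asm) lin_eq_0_iff) (auto simp: vecs_def)
    from fun_cong[OF this, of k] show "a k = 0" using k by simp
  qed
  then have "isotropic_point emb p r ?q m v {..<i} (\<lambda>j k. if j = k \<and> k < i then 1 else 0)"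
  proof unfold_locales
    fix k
    have "(\<Sum>j<i. emb (if j = k \<and> k < i then 1 else 0) * v j) = (\<Sum>j<i. if j = k then v j else 0)"
      by (intro sum.cong) auto
    then show "v k = (\<Sum>j<i. emb (if j = k \<and> k < i then 1 else 0) * v j)" by (simp add: v_def)
  qed (use i iso E.q_pos in auto)
  from eval_d_poly_nonzero[OF this] have nz: "mpoly_eval emb v (d_poly i m) \<noteq> 0" by simp
  then show "d_poly i m \<noteq> (0 :: 'a mpoly)" by auto
  show "d_poly i m \<noteq> (xi m j :: 'a mpoly)" if "1 \<le> j"
  proof -
    have "qform m v = 0" unfolding qform_def using vv[of 1] by (intro sum.neutral) auto
    then have "mpoly_eval emb v (xi m j) = 0" using iso E.q_pos by (simp add: eval_xi[OF hom])
    then show ?thesis using nz by auto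
  qed
qed

text \<open>At the rational point with y_1 = x_1 = 1 and all other coordinates zero, Frobenius
  twists are trivial and the value is 1 or 2.\<close>

lemma xi_nonzero: "xi m i \<noteq> (0 :: 'a mpoly)"
proof
  assume z: "xi m i = (0 :: 'a mpoly)"
  have id: "comm_ring_hom (\<lambda>x :: 'a. x)" by unfold_locales auto
  let ?c = "\<lambda>k. unit (m - 1) k + 1 * unit m k :: 'a"
  have lt: "m - 1 < 2 * m" "m < 2 * m" "2 * m - 1 - m = m - 1" using m_pos by auto
  have Q: "qform m ?c = 1"
    unfolding qform_add qform_unit[OF lt(1)] qform_unit[OF lt(2)] bform_unit_right[OF lt(2)] lt(3)
    by (simp add: unit_def)
  have "mpoly_eval (\<lambda>x. x) ?c (xi m i) = (if i = 1 then 1 else 2)"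
    unfolding eval_xi[OF id] power_card_power_eq_self bform_self Q by simp
  then show False using z two comm_ring_hom.mpoly_eval_0[OF id] by (auto split: if_splits)
qed

lemma finite_Hsys: "finite (Hsys m)"
  by (simp add: Hsys_def)

lemma e_exp_inj: "i \<le> m \<Longrightarrow> j \<le> m \<Longrightarrow> e_exp CARD('a) i m = e_exp CARD('a) j m \<Longrightarrow> i = j"
proof -
  let ?q = "CARD('a)"
  assume ij: "i \<le> m" "j \<le> m" "e_exp ?q i m = e_exp ?q j m"
  then have "?q ^ (2 * m) - ?q ^ (2 * m - i) = ?q ^ (2 * m) - ?q ^ (2 * m - j)"
    using e_exp_mult[of i m ?q] e_exp_mult[of j m ?q] m_pos F.q_pos by simp
  moreover have "?q ^ (2 * m - i) \<le> ?q ^ (2 * m)" "?q ^ (2 * m - j) \<le> ?q ^ (2 * m)"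
    using F.q_pos by (auto intro!: power_increasing)
  ultimately have "?q ^ (2 * m - i) = ?q ^ (2 * m - j)" by linarith
  then have "2 * m - i = 2 * m - j" using F.q_gt_1 by simp
  then show "i = j" using ij m_pos by linarith
qed

text \<open>\<open>Hsys m\<close> is a set, so its size rests on distinctness. Degrees separate the
  \<open>\<xi>\<^sub>i\<close> from each other, and likewise the \<open>d_poly i m\<close>; across
  the two families degrees can coincide, as for q = 3 and m = 1, and
  \<open>d_poly_xi_distinct\<close> is used instead.\<close>

lemma card_Hsys: "card (Hsys m :: 'a mpoly set) = 2 * m"
proof -
  let ?q = "CARD('a)"
  have "inj_on (xi m :: nat \<Rightarrow> 'a mpoly) {1..m}"
  proof (rule inj_onI)
    fix i j assume ij: "i \<in> {1..m}" "j \<in> {1..m}" "xi m i = (xi m j :: 'a mpoly)"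
    then have "homogeneous (?q ^ (i - 1) + 1) (xi m i :: 'a mpoly)"
      "homogeneous (?q ^ (j - 1) + 1) (xi m i :: 'a mpoly)"
      using homogeneous_xi[of i m, where ?'a = 'a] homogeneous_xi[of j m, where ?'a = 'a] by auto
    then have "?q ^ (i - 1) + 1 = ?q ^ (j - 1) + 1" using homogeneous_unique xi_nonzero by blast
    then have "i - 1 = j - 1" using F.q_gt_1 by simp
    then show "i = j" using ij by auto
  qed
  then have c1: "card (xi m ` {1..m} :: 'a mpoly set) = m" by (simp add: card_image)
  have "inj_on (\<lambda>i. d_poly i m :: 'a mpoly) {1..m}"
  proof (rule inj_onI)
    fix i j assume ij: "i \<in> {1..m}" "j \<in> {1..m}" "d_poly i m = (d_poly j m :: 'a mpoly)"
    have h: "homogeneous ((?q - 1) * e_exp ?q j m) (d_poly i m :: 'a mpoly)"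
      unfolding ij(3) by (rule homogeneous_d_poly)
    have "d_poly i m \<noteq> (0 :: 'a mpoly)" using d_poly_xi_distinct(1)[of i] ij(1) by auto
    then have "(?q - 1) * e_exp ?q i m = (?q - 1) * e_exp ?q j m"
      by (rule homogeneous_unique[OF homogeneous_d_poly h])
    then have "e_exp ?q i m = e_exp ?q j m" using F.q_gt_1 by simp
    then show "i = j" using e_exp_inj ij by auto
  qed
  then have c2: "card ((\<lambda>i. d_poly i m) ` {1..m} :: 'a mpoly set) = m" by (simp add: card_image)
  have "xi m ` {1..m} \<inter> (\<lambda>i. d_poly i m) ` {1..m} = ({} :: 'a mpoly set)"
    using d_poly_xi_distinct(2) by fastforce
  then show ?thesis unfolding Hsys_def by (subst card_Un_disjoint) (simp_all only: c1 c2 finite_imageI finite_atLeastAtMost mult_2)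
qed

lemma Hsys_homogeneous:
  assumes "f \<in> (Hsys m :: 'a mpoly set)" shows "f \<noteq> 0 \<and> (\<exists>k>0. homogeneous k f)"
proof -
  consider i where "i \<in> {1..m}" "f = xi m i" | i where "i \<in> {1..m}" "f = d_poly i m"
    using assms by (auto simp: Hsys_def)
  then show ?thesis
  proof cases
    case 1
    then show ?thesis using homogeneous_xi[of i m, where ?'a = 'a] xi_nonzero[of i] by fastforce
  next
    case 2
    have "e_exp CARD('a) i m \<noteq> 0"
    proof
      assume "e_exp CARD('a) i m = 0"
      then have "i = 0" using e_exp_inj[of i 0] 2 by (simp add: e_exp_def)
      then show False using 2 by simp
    qed
    then have "(CARD('a) - 1) * e_exp CARD('a) i m > 0" using F.q_gt_1 by simp
    then show ?thesis using homogeneous_d_poly[of i] d_poly_xi_distinct(1)[of i] 2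
      by (metis atLeastAtMost_iff)
  qed
qed

lemma hsopI:
  assumes "Hsys m \<subseteq> R" "finite_module_over (gen_subalgebra (Hsys m)) (R :: 'a mpoly set)"
  shows "hsop (2 * m) R (Hsys m)"
  unfolding hsop_def using assms finite_Hsys card_Hsys Hsys_homogeneous by blast

lemma Hsys_polyring: "Hsys m \<subseteq> (polyring m :: 'a mpoly set)"
  using Hsys_invariants by (auto simp: invariants_def)

lemma module_over_gen_subalgebra:
  assumes "Hsys m \<subseteq> R" "\<And>a. Const a \<in> R" "\<And>f g. f \<in> R \<Longrightarrow> g \<in> R \<Longrightarrow> f + g \<in> R \<and> f * g \<in> R"
  shows "module_over (gen_subalgebra (Hsys m)) (R :: 'a mpoly set)"
proof -
  have "f \<in> R" if "f \<in> gen_subalgebra (Hsys m)" for f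
    using that by (induction rule: gen_subalgebra.induct) (use assms in auto)
  moreover have "0 \<in> R" using assms(2)[of 0] by simp
  ultimately show ?thesis using assms(3) by (auto simp: module_over_def)
qed

lemma module_over_invariants: "module_over (gen_subalgebra (Hsys m)) (invariants m :: 'a mpoly set)"
proof (rule module_over_gen_subalgebra[OF Hsys_invariants])
  fix f g :: "'a mpoly" assume fg: "f \<in> invariants m" "g \<in> invariants m"
  have "act m h (f + g) = act m h f + act m h g \<and> act m h (f * g) = act m h f * act m h g" for h
  proof -
    interpret act: comm_ring_hom "act m h" by (rule act_hom)
    show ?thesis by (simp add: act.hom_add act.hom_mult)
  qed
  then show "f + g \<in> invariants m \<and> f * g \<in> invariants m"
    using fg by (auto simp: invariants_def polyring_add polyring_mult)
qed (auto simp: invariants_def polyring_Const)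

theorem hsop_Hsys:
  "hsop (2 * m) (polyring m) (Hsys m :: 'a mpoly set)"
  "hsop (2 * m) (invariants m) (Hsys m :: 'a mpoly set)"
proof -
  let ?A = "gen_subalgebra (Hsys m :: 'a mpoly set)"
  have A: "subring_set ?A" by (rule gen_subalgebra_subring)
  obtain B where B: "finite B" "B \<subseteq> polyring m" "polyring m \<subseteq> lin_hull ?A B"
    using finitely_generated_over_parameters[OF Hsys_polyring] Hsys_homogeneous Var_nilpotent_mod_Hsys
    by blast
  have "module_over ?A (polyring m)"
    using Hsys_polyring by (rule module_over_gen_subalgebra)
      (auto simp: polyring_Const polyring_add polyring_mult)
  from finite_module_overI[OF A this B] show "hsop (2 * m) (polyring m) (Hsys m :: 'a mpoly set)"
    by (rule hsopI[OF Hsys_polyring])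
  have "noetherian_mod ?A (lin_hull ?A B)"
    by (rule noetherian_lin_hull[OF A noetherian_gen_subalgebra[OF finite_Hsys] B(1)])
  moreover have "invariants m \<subseteq> lin_hull ?A B" using B(3) by (auto simp: invariants_def)
  ultimately have "\<exists>C. finite C \<and> C \<subseteq> (invariants m :: 'a mpoly set) \<and> invariants m \<subseteq> lin_hull ?A C"
    unfolding noetherian_mod_def using module_over_invariants by meson
  then obtain C where C: "finite C" "C \<subseteq> (invariants m :: 'a mpoly set)" "invariants m \<subseteq> lin_hull ?A C"
    by blast
  show "hsop (2 * m) (invariants m) (Hsys m :: 'a mpoly set)"
    by (rule hsopI[OF Hsys_invariants finite_module_overI[OF A module_over_invariants C]])
qed

end

theorem theorem3p12:
  fixes p r m :: nat
  assumes "prime p" and "odd p" and "r \<ge> 1"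
    and "CARD('a::{field,finite}) = p ^ r"
    and "m \<ge> 1"
  shows "hsop (2 * m) (polyring m) (Hsys m :: 'a mpoly set)
    \<and> hsop (2 * m) (invariants m) (Hsys m :: 'a mpoly set)"
proof -
  interpret orth_setting p r m "TYPE('a)"
    using assms by unfold_locales
  show ?thesis using hsop_Hsys by blast
qed

end
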